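(* Let $(\mathcal{X},\mathcal{F},m)$ be a probability space with $\mathcal{X}$ Polish and pre-compact, and let $(\mathcal{E},\mathbb{D})$ be a conservative, local (diffusion type) Dirichlet form on $L^2(\mathcal{X};m)$ with associated Markov process $(X_t)$ with continuous paths, realized on $\Omega=\mathcal{C}([0,1],\mathcal{X})$, $X_t(\omega)=\omega(t)$, with law $\mathbb{P}$ (initial distribution $m$). For $s>0$ let $\mathbb{P}^s$ be the law of the time-scaled process $X^s_t=X_{st}$, $t\in[0,1]$. Then for all $\alpha>0$ and all compact subsets $\Gamma$ of $\{\gamma\in\mathcal{C}([0,1],\mathcal{X}):\widetilde H(\gamma)>\alpha\}$, $$\limsup_{s\to0}\, s\log\mathbb{P}^s(X_\cdot\in\Gamma)\le-\alpha.$$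
   Context: $\mathbb{D}_b=\mathbb{D}\cap L^\infty$; $I(f,g;h)=\mathcal{E}(gh,f)+\mathcal{E}(fh,g)-\mathcal{E}(fg,h)$, $I_f(h)=I(f,f;h)$; $\mathbb{D}_0=\{f\in\mathbb{D}_b: I_f(h)\le\|h\|_{L^1}\ \forall h\in\mathbb{D}_b\}$; intrinsic pseudometric $d(x,y)=\sup_{f\in\mathbb{D}_0}\{f(x)-f(y)\}$ (pre-compactness of $\mathcal{X}$ is with respect to $d$). $AC^2([0,1],\mathcal{X})$ is the set of curves $\gamma$ for which there is $m\in L^2([0,1])$ with $d(\gamma(s),\gamma(t))\le\int_s^t m(r)\,dr$ for all $0\le s\le t\le1$; for such $\gamma$ the metric derivative $|\dot\gamma|(t)=\lim_{h\to0}d(\gamma(t),\gamma(t+h))/|h|$ exists for a.e. $t$. The energy is $\widetilde H(\gamma)=\frac12\int_0^1|\dot\gamma|^2(r)\,dr$ if $\gamma\in AC^2([0,1],\mathcal{X})$ and $\widetilde H(\gamma)=\infty$ otherwise.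
   Formalization: The supremum defining the intrinsic pseudometric d is taken only over continuous functions f in D_0, since elements of D_0 are L^2 classes and their pointwise values f(x), f(y) are otherwise undefined. *)

theory Defs
  imports "HOL-Probability.Probability"
begin

definition L2 :: "'a measure \<Rightarrow> ('a \<Rightarrow> real) set" where
  "L2 M = {f \<in> borel_measurable M. integrable M (\<lambda>x. (f x)^2)}"

definition e1 :: "'a measure \<Rightarrow> (('a \<Rightarrow> real) \<Rightarrow> ('a \<Rightarrow> real) \<Rightarrow> real) \<Rightarrow> ('a \<Rightarrow> real) \<Rightarrow> real" where
  "e1 M E w = E w w + (\<integral>x. (w x)^2 \<partial>M)"

definition dirichlet_form ::
  "'a measure \<Rightarrow> ('a \<Rightarrow> real) set \<Rightarrow> (('a \<Rightarrow> real) \<Rightarrow> ('a \<Rightarrow> real) \<Rightarrow> real) \<Rightarrow> bool" where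
  "dirichlet_form M D E \<longleftrightarrow>
     D \<subseteq> L2 M \<and>
     (\<forall>f\<in>D. \<forall>g\<in>D. \<forall>a b::real. (\<lambda>x. a * f x + b * g x) \<in> D) \<and>
     (\<forall>f\<in>D. \<forall>g. g \<in> borel_measurable M \<and> (AE x in M. f x = g x) \<longrightarrow>
         g \<in> D \<and> (\<forall>h\<in>D. E g h = E f h \<and> E h g = E h f)) \<and>
     (\<forall>f\<in>L2 M. \<forall>\<epsilon>>0. \<exists>g\<in>D. (\<integral>x. (f x - g x)^2 \<partial>M) < \<epsilon>) \<and>
     (\<forall>f\<in>D. \<forall>g\<in>D. E f g = E g f) \<and>
     (\<forall>f\<in>D. \<forall>g\<in>D. \<forall>h\<in>D. \<forall>a b::real.
         E (\<lambda>x. a * f x + b * g x) h = a * E f h + b * E g h) \<and>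
     (\<forall>f\<in>D. E f f \<ge> 0) \<and>
     (\<forall>u::nat \<Rightarrow> 'a \<Rightarrow> real. (\<forall>n. u n \<in> D) \<and>
         (\<forall>\<epsilon>>0. \<exists>N. \<forall>n\<ge>N. \<forall>k\<ge>N. e1 M E (\<lambda>x. u n x - u k x) < \<epsilon>) \<longrightarrow>
         (\<exists>v\<in>D. (\<lambda>n. e1 M E (\<lambda>x. u n x - v x)) \<longlonglongrightarrow> 0)) \<and>
     (\<forall>f\<in>D. (\<lambda>x. min 1 (max 0 (f x))) \<in> D \<and>
         E (\<lambda>x. min 1 (max 0 (f x))) (\<lambda>x. min 1 (max 0 (f x))) \<le> E f f)"

definition strongly_local ::
  "'a measure \<Rightarrow> ('a \<Rightarrow> real) set \<Rightarrow> (('a \<Rightarrow> real) \<Rightarrow> ('a \<Rightarrow> real) \<Rightarrow> real) \<Rightarrow> bool" where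
  "strongly_local M D E \<longleftrightarrow>
     (\<forall>f\<in>D. \<forall>g\<in>D. \<forall>a::real. (AE x in M. (f x + a) * g x = 0) \<longrightarrow> E f g = 0)"

definition path_space :: "(real \<Rightarrow> 'a::topological_space) set" where
  "path_space = {\<omega>. continuous_on {0..1} \<omega> \<and> \<omega> \<in> extensional {0..1}}"

definition path_sets :: "(real \<Rightarrow> 'a::topological_space) measure" where
  "path_sets = restrict_space (PiM {0..1} (\<lambda>_. borel)) path_space"

definition bounded_borel :: "('a::topological_space \<Rightarrow> real) \<Rightarrow> bool" where
  "bounded_borel f \<longleftrightarrow> f \<in> borel_measurable borel \<and> bounded (range f)"

definition markov_law ::
  "(real \<Rightarrow> 'a::topological_space) measure \<Rightarrow> (real \<Rightarrow> ('a \<Rightarrow> real) \<Rightarrow> ('a \<Rightarrow> real)) \<Rightarrow> bool" where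
  "markov_law P T \<longleftrightarrow>
     (\<forall>t g. 0 \<le> t \<and> t \<le> 1 \<and> bounded_borel g \<longrightarrow> bounded_borel (T t g)) \<and>
     (\<forall>u t (g::'a \<Rightarrow> real) (n::nat) (r::nat \<Rightarrow> real) (f::nat \<Rightarrow> 'a \<Rightarrow> real).
        0 \<le> u \<and> 0 \<le> t \<and> u + t \<le> 1 \<and> bounded_borel g \<and>
        (\<forall>i<n. 0 \<le> r i \<and> r i \<le> u \<and> bounded_borel (f i)) \<longrightarrow>
        (\<integral>\<omega>. (\<Prod>i<n. f i (\<omega> (r i))) * g (\<omega> (u + t)) \<partial>P) =
        (\<integral>\<omega>. (\<Prod>i<n. f i (\<omega> (r i))) * T t g (\<omega> u) \<partial>P))"

definition conservative :: "'a measure \<Rightarrow> (real \<Rightarrow> ('a \<Rightarrow> real) \<Rightarrow> ('a \<Rightarrow> real)) \<Rightarrow> bool" where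
  "conservative M T \<longleftrightarrow> (\<forall>t\<in>{0..1}. AE x in M. T t (\<lambda>_. 1) x = 1)"

text \<open>The Dirichlet form (E,D) is the one associated with the process (law P started from m):
  with (f, T_t g)_m = E_P[f(X_0) g(X_t)],
  D = {f in L^2 : sup_t t^{-1}(f - T_t f, f) finite}, E(f,g) = lim_{t->0} t^{-1}(f - T_t f, g).\<close>
definition associated ::
  "'a measure \<Rightarrow> (real \<Rightarrow> 'a) measure \<Rightarrow> ('a \<Rightarrow> real) set \<Rightarrow>
     (('a \<Rightarrow> real) \<Rightarrow> ('a \<Rightarrow> real) \<Rightarrow> real) \<Rightarrow> bool" where
  "associated M P D E \<longleftrightarrow>
     (\<forall>f\<in>L2 M. f \<in> D \<longleftrightarrow> (\<exists>C. \<forall>t\<in>{0<..1}.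
         ((\<integral>x. (f x)^2 \<partial>M) - (\<integral>\<omega>. f (\<omega> 0) * f (\<omega> t) \<partial>P)) / t \<le> C)) \<and>
     (\<forall>f\<in>D. \<forall>g\<in>D.
         ((\<lambda>t. ((\<integral>x. f x * g x \<partial>M) - (\<integral>\<omega>. f (\<omega> 0) * g (\<omega> t) \<partial>P)) / t) \<longlongrightarrow> E f g)
           (at_right 0))"

definition Db :: "('a \<Rightarrow> real) set \<Rightarrow> ('a \<Rightarrow> real) set" where
  "Db D = {f \<in> D. bounded (range f)}"

definition Iform :: "(('a \<Rightarrow> real) \<Rightarrow> ('a \<Rightarrow> real) \<Rightarrow> real) \<Rightarrow>
    ('a \<Rightarrow> real) \<Rightarrow> ('a \<Rightarrow> real) \<Rightarrow> ('a \<Rightarrow> real) \<Rightarrow> real" where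
  "Iform E f g h = E (\<lambda>x. g x * h x) f + E (\<lambda>x. f x * h x) g - E (\<lambda>x. f x * g x) h"

definition D0 :: "'a measure \<Rightarrow> ('a \<Rightarrow> real) set \<Rightarrow>
    (('a \<Rightarrow> real) \<Rightarrow> ('a \<Rightarrow> real) \<Rightarrow> real) \<Rightarrow> ('a \<Rightarrow> real) set" where
  "D0 M D E = {f \<in> Db D. \<forall>h\<in>Db D. Iform E f f h \<le> (\<integral>x. \<bar>h x\<bar> \<partial>M)}"

definition intrinsic_dist :: "'a::topological_space measure \<Rightarrow> ('a \<Rightarrow> real) set \<Rightarrow>
    (('a \<Rightarrow> real) \<Rightarrow> ('a \<Rightarrow> real) \<Rightarrow> real) \<Rightarrow> 'a \<Rightarrow> 'a \<Rightarrow> ereal" where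
  "intrinsic_dist M D E x y =
     (SUP f \<in> {f \<in> D0 M D E. continuous_on UNIV f}. ereal (f x - f y))"

definition AC2 :: "('a \<Rightarrow> 'a \<Rightarrow> ereal) \<Rightarrow> (real \<Rightarrow> 'a) \<Rightarrow> bool" where
  "AC2 d \<gamma> \<longleftrightarrow> (\<exists>mm::real \<Rightarrow> real. mm \<in> borel_measurable lborel \<and>
      set_integrable lborel {0..1} mm \<and> set_integrable lborel {0..1} (\<lambda>r. (mm r)^2) \<and>
      (\<forall>s t. 0 \<le> s \<and> s \<le> t \<and> t \<le> 1 \<longrightarrow>
          d (\<gamma> s) (\<gamma> t) \<le> ereal (set_lebesgue_integral lborel {s..t} mm)))"

definition metric_deriv :: "('a \<Rightarrow> 'a \<Rightarrow> ereal) \<Rightarrow> (real \<Rightarrow> 'a) \<Rightarrow> real \<Rightarrow> real" where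
  "metric_deriv d \<gamma> t =
     Lim (at 0 within {-t..1-t}) (\<lambda>h. real_of_ereal (d (\<gamma> t) (\<gamma> (t + h))) / \<bar>h\<bar>)"

definition Htilde :: "('a \<Rightarrow> 'a \<Rightarrow> ereal) \<Rightarrow> (real \<Rightarrow> 'a) \<Rightarrow> ennreal" where
  "Htilde d \<gamma> = (if AC2 d \<gamma>
     then ennreal (1/2) * (\<integral>\<^sup>+ t\<in>{0..1}. ennreal ((metric_deriv d \<gamma> t)^2) \<partial>lborel)
     else \<infinity>)"

definition unif_compact :: "(real \<Rightarrow> 'a::metric_space) set \<Rightarrow> bool" where
  "unif_compact \<Gamma> \<longleftrightarrow> \<Gamma> \<subseteq> path_space \<and>
     (\<forall>\<sigma>::nat \<Rightarrow> real \<Rightarrow> 'a. (\<forall>n. \<sigma> n \<in> \<Gamma>) \<longrightarrow>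
        (\<exists>\<gamma>\<in>\<Gamma>. \<exists>r. strict_mono r \<and> uniform_limit {0..1} (\<sigma> \<circ> r) \<gamma> sequentially))"

definition scaled_prob :: "(real \<Rightarrow> 'a) measure \<Rightarrow> real \<Rightarrow> (real \<Rightarrow> 'a) set \<Rightarrow> real" where
  "scaled_prob P s \<Gamma> = measure P {\<omega> \<in> space P. (\<lambda>t\<in>{0..1}. \<omega> (s * t)) \<in> \<Gamma>}"

definition slog :: "real \<Rightarrow> real \<Rightarrow> ereal" where
  "slog s p = (if p = 0 then -\<infinity> else ereal (s * ln p))"

end

theory Submission
  imports Defs
begin

text \<open>For \<open>f\<close> in \<open>D0\<close> and real \<open>l\<close>, Davies' method shows that \<open>g \<mapsto> exp (- l f) T t (exp (l f) g)\<close> has norm at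
  most \<open>exp (l\<^sup>2 t / 2)\<close> on \<open>L\<^sup>2(m)\<close>. Chaining this bound with the Markov property, for times \<open>t\<^sub>i\<close>, continuous
  \<open>f\<^sub>i\<close> in \<open>D0\<close> and slopes \<open>a\<^sub>i\<close>, the exponential Chebyshev inequality gives probability at most
  \<open>exp (- \<alpha> / s)\<close> to the event that the time-scaled path \<open>\<omega>\<close> makes the gain
  \<open>\<Sum>\<^sub>i a\<^sub>i (f\<^sub>i (\<omega> t') - f\<^sub>i (\<omega> t)) - a\<^sub>i\<^sup>2 (t' - t) / 2\<close>, with \<open>t = t\<^sub>i\<close> and \<open>t'\<close> the next time, exceed \<open>\<alpha>\<close>. These
  events are open, and a path lying in none of them has all its discrete energies bounded by \<open>\<alpha>\<close>,
  hence is absolutely continuous with energy at most \<open>\<alpha>\<close>. So they cover a compact \<open>\<Gamma>\<close> on which the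
  energy exceeds \<open>\<alpha>\<close>, and finitely many suffice.\<close>

section \<open>Curves with bounded discrete energy\<close>

text \<open>\<open>markov_law\<close> describes \<open>T t g\<close> only through its correlations
  with the past. Contraction bounds and the composition law for \<open>T\<close> have to be
  recovered by testing against past observables, up to null sets, and the form sees the process only
  through the pair of times 0 and \<open>t\<close>. That \<open>M\<close> is invariant is therefore
  something to prove, from \<open>E (\<lambda>_. 1) f = 0\<close>, before anything can be said at
  later times. Elements of the domain are produced by averaging in time, since such averages have
  increments linear in time.

  The constants of the rate arise as follows. Membership in \<open>D0\<close> says that the energy
  density of \<open>f\<close> is at most 1; the second-order term of cosh, with its exact
  coefficient 1/2, turns this into the exponent \<open>l^2 * t / 2\<close>, while strong locality
  removes the terms of higher order. For a step of length \<open>h\<close> over a distance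
  \<open>y\<close>, the slope \<open>y / h\<close> maximises \<open>a * y - a^2 * h / 2\<close>, and
  the maximum \<open>y^2 / (2 * h)\<close> is the contribution of the step to half the discrete
  energy. After the time change, the slope \<open>a / s\<close> multiplies both terms by
  \<open>1 / s\<close>.\<close>

lemma AE_convergent_of_L1_summable:
  fixes f :: "nat \<Rightarrow> 'b \<Rightarrow> real"
  assumes int: "\<And>j. integrable Q (\<lambda>\<omega>. f (Suc j) \<omega> - f j \<omega>)"
    and le: "\<And>j. (\<integral>\<omega>. \<bar>f (Suc j) \<omega> - f j \<omega>\<bar> \<partial>Q) \<le> e j" and "summable e"
  shows "AE \<omega> in Q. convergent (\<lambda>j. f j \<omega>)"
proof -
  have [measurable]: "(\<lambda>\<omega>. f (Suc j) \<omega> - f j \<omega>) \<in> borel_measurable Q" for j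
    using int by auto
  have "(\<integral>\<^sup>+\<omega>. (\<Sum>j. ennreal \<bar>f (Suc j) \<omega> - f j \<omega>\<bar>) \<partial>Q) = (\<Sum>j. \<integral>\<^sup>+\<omega>. ennreal \<bar>f (Suc j) \<omega> - f j \<omega>\<bar> \<partial>Q)"
    by (rule nn_integral_suminf) auto
  also have "\<dots> = (\<Sum>j. ennreal (\<integral>\<omega>. \<bar>f (Suc j) \<omega> - f j \<omega>\<bar> \<partial>Q))"
    using int by (subst nn_integral_eq_integral) auto
  also have "\<dots> = ennreal (\<Sum>j. \<integral>\<omega>. \<bar>f (Suc j) \<omega> - f j \<omega>\<bar> \<partial>Q)"
    by (rule suminf_ennreal2) (auto intro!: summable_comparison_test'[OF \<open>summable e\<close>] le)
  finally have "(\<integral>\<^sup>+\<omega>. (\<Sum>j. ennreal \<bar>f (Suc j) \<omega> - f j \<omega>\<bar>) \<partial>Q) \<noteq> \<infinity>"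
    by simp
  then have "AE \<omega> in Q. (\<Sum>j. ennreal \<bar>f (Suc j) \<omega> - f j \<omega>\<bar>) \<noteq> \<infinity>"
    by (intro nn_integral_noteq_infinite) auto
  then show ?thesis
  proof eventually_elim
    case (elim \<omega>)
    then have "summable (\<lambda>j. \<bar>f (Suc j) \<omega> - f j \<omega>\<bar>)"
      by (intro summable_suminf_not_top) auto
    then have "summable (\<lambda>j. f (Suc j) \<omega> - f j \<omega>)"
      by (rule summable_rabs_cancel)
    then have "convergent (\<lambda>n. \<Sum>j<n. f (Suc j) \<omega> - f j \<omega>)"
      by (simp add: summable_iff_convergent)
    then have "convergent (\<lambda>n. f n \<omega> - f 0 \<omega>)"
      by (subst (asm) sum_lessThan_telescope)
    then have "convergent (\<lambda>n. (f n \<omega> - f 0 \<omega>) + f 0 \<omega>)"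
      by (rule convergent_add) (rule convergent_const)
    then show ?case by simp
  qed
qed

text \<open>Removing any one interval \<open>(p, q)\<close> splits the rest: disjointness puts every
  other interval entirely before \<open>p\<close> or entirely after \<open>q\<close>. By induction
  on the cardinality the two halves are bounded by \<open>\<psi> a p\<close> and
  \<open>\<psi> q b\<close>, and superadditivity, used twice, glues the three values together. This
  avoids listing \<open>F\<close> in order.\<close>

lemma sum_superadditive_le:
  fixes \<psi> :: "real \<Rightarrow> real \<Rightarrow> real" and F :: "(real \<times> real) set"
  assumes nonneg: "\<And>s t. A \<le> s \<Longrightarrow> s \<le> t \<Longrightarrow> t \<le> B \<Longrightarrow> 0 \<le> \<psi> s t"
    and super: "\<And>s t u. A \<le> s \<Longrightarrow> s \<le> t \<Longrightarrow> t \<le> u \<Longrightarrow> u \<le> B \<Longrightarrow> \<psi> s t + \<psi> t u \<le> \<psi> s u"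
  shows "\<lbrakk>finite F; A \<le> a; a \<le> b; b \<le> B; \<And>s t. (s, t) \<in> F \<Longrightarrow> a \<le> s \<and> s \<le> t \<and> t \<le> b;
     pairwise (\<lambda>I J. disjnt {fst I..snd I} {fst J..snd J}) F\<rbrakk> \<Longrightarrow> (\<Sum>I\<in>F. \<psi> (fst I) (snd I)) \<le> \<psi> a b"
proof (induction "card F" arbitrary: F a b rule: less_induct)
  case less
  show ?case
  proof (cases "F = {}")
    case True
    then show ?thesis using nonneg less.prems by simp
  next
    case False
    then obtain p q where pq: "(p, q) \<in> F" by auto
    define L where "L = {I \<in> F. snd I < p}"
    define R where "R = {I \<in> F. q < fst I}"
    have pq_le: "a \<le> p" "p \<le> q" "q \<le> b" using less.prems(5)[OF pq] by auto
    have Feq: "F = insert (p, q) (L \<union> R)"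
    proof
      show "F \<subseteq> insert (p, q) (L \<union> R)"
      proof
        fix I assume I: "I \<in> F"
        show "I \<in> insert (p, q) (L \<union> R)"
        proof (cases "I = (p, q)")
          case False
          then have "disjnt {fst I..snd I} {p..q}" using pairwiseD[OF less.prems(6) I pq] by simp
          moreover have "fst I \<le> snd I" using less.prems(5)[of "fst I" "snd I"] I by simp
          ultimately have "snd I < p \<or> q < fst I" using pq_le(2)
            unfolding disjnt_iff by (metis atLeastAtMost_iff linorder_not_le order_refl order_trans nle_le)
          then show ?thesis using I by (auto simp: L_def R_def)
        qed simp
      qed
      show "insert (p, q) (L \<union> R) \<subseteq> F" using pq by (auto simp: L_def R_def)
    qed
    have fin: "finite L" "finite R" using less.prems(1) by (auto simp: L_def R_def)
    have notin: "(p, q) \<notin> L" "(p, q) \<notin> R" using pq_le by (auto simp: L_def R_def)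
    have disj: "L \<inter> R = {}"
    proof -
      have "False" if "I \<in> L" "I \<in> R" for I
        using that less.prems(5)[of "fst I" "snd I"] pq_le by (auto simp: L_def R_def)
      then show ?thesis by auto
    qed
    have card: "card L < card F" "card R < card F"
    proof -
      have "L \<subseteq> F" "R \<subseteq> F" by (auto simp: L_def R_def)
      then have "L \<subset> F" "R \<subset> F" using pq notin by auto
      then show "card L < card F" "card R < card F" by (auto intro: psubset_card_mono less.prems(1))
    qed
    have pw: "pairwise (\<lambda>I J. disjnt {fst I..snd I} {fst J..snd J}) L" "pairwise (\<lambda>I J. disjnt {fst I..snd I} {fst J..snd J}) R"
      by (rule pairwise_subset[OF less.prems(6)], auto simp: L_def R_def)+
    have 1: "(\<Sum>I\<in>L. \<psi> (fst I) (snd I)) \<le> \<psi> a p"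
      by (rule less.hyps[OF card(1) fin(1)]) (use less.prems pq_le pw in \<open>force simp: L_def\<close>)+
    have 2: "(\<Sum>I\<in>R. \<psi> (fst I) (snd I)) \<le> \<psi> q b"
      by (rule less.hyps[OF card(2) fin(2)]) (use less.prems pq_le pw in \<open>force simp: R_def\<close>)+
    have "(\<Sum>I\<in>F. \<psi> (fst I) (snd I)) = \<psi> p q + ((\<Sum>I\<in>L. \<psi> (fst I) (snd I)) + (\<Sum>I\<in>R. \<psi> (fst I) (snd I)))"
      unfolding Feq using fin notin disj by (simp add: sum.union_disjoint)
    also have "\<dots> \<le> \<psi> p q + (\<psi> a p + \<psi> q b)" using 1 2 by simp
    also have "\<dots> \<le> \<psi> a q + \<psi> q b" using super[of a p q] pq_le less.prems by simp
    also have "\<dots> \<le> \<psi> a b" using super[of a q b] pq_le less.prems by simp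
    finally show ?thesis .
  qed
qed

text \<open>A weak-type estimate: the intervals on which \<open>\<psi>\<close> exceeds
  \<open>\<epsilon>\<close> times the length form a Vitali cover of \<open>S\<close>. A disjoint
  subfamily covers \<open>S\<close> up to a null set, and superadditivity caps its total length by
  \<open>\<psi> a b / \<epsilon>\<close>. The point \<open>x\<close> may be an endpoint of its
  intervals, which later accommodates one-sided increments.\<close>

lemma vitali_superadditive:
  fixes \<psi> :: "real \<Rightarrow> real \<Rightarrow> real"
  assumes nonneg: "\<And>s t. a \<le> s \<Longrightarrow> s \<le> t \<Longrightarrow> t \<le> b \<Longrightarrow> 0 \<le> \<psi> s t"
    and super: "\<And>s t u. a \<le> s \<Longrightarrow> s \<le> t \<Longrightarrow> t \<le> u \<Longrightarrow> u \<le> b \<Longrightarrow> \<psi> s t + \<psi> t u \<le> \<psi> s u"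
    and ab: "a \<le> b" and \<epsilon>: "\<epsilon> > 0"
    and fine: "\<And>x \<rho>. x \<in> S \<Longrightarrow> \<rho> > 0 \<Longrightarrow> \<exists>s t. s \<le> x \<and> x \<le> t \<and> s < t \<and> t - s < \<rho> \<and> a \<le> s \<and> t \<le> b \<and> \<epsilon> * (t - s) < \<psi> s t"
  obtains U where "S \<subseteq> U" "U \<in> lmeasurable" "measure lebesgue U \<le> \<psi> a b / \<epsilon>"
proof -
  define K where "K = {(s, t). a \<le> s \<and> s < t \<and> t \<le> b \<and> \<epsilon> * (t - s) < \<psi> s t}"
  let ?c = "\<lambda>I::real \<times> real. (fst I + snd I) / 2" and ?r = "\<lambda>I::real \<times> real. (snd I - fst I) / 2"
  have ball: "cball (?c I) (?r I) = {fst I..snd I}" for I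
    by (auto simp: cball_def dist_real_def abs_real_def field_simps split: if_splits)
  have r: "0 < ?r I" if "I \<in> K" for I using that by (auto simp: K_def)
  have cov: "\<exists>i. i \<in> K \<and> x \<in> cball (?c i) (?r i) \<and> ?r i < \<rho>" if x: "x \<in> S" "0 < \<rho>" for x \<rho>
  proof -
    obtain s t where st: "s \<le> x" "x \<le> t" "s < t" "t - s < \<rho>" "a \<le> s" "t \<le> b" "\<epsilon> * (t - s) < \<psi> s t"
      using fine[OF x] by blast
    then show ?thesis
      unfolding ball by (intro exI[of _ "(s, t)"]) (auto simp: K_def)
  qed
  obtain C where C: "countable C" "C \<subseteq> K"
     "pairwise (\<lambda>i j. disjnt (cball (?c i) (?r i)) (cball (?c j) (?r j))) C"
     "negligible (S - (\<Union>i \<in> C. cball (?c i) (?r i)))"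
    by (rule Vitali_covering_theorem_cballs[where a = ?c and r = ?r, OF r cov])
  let ?U = "\<Union>I\<in>C. {fst I..snd I}"
  have bound: "measure lebesgue (\<Union>I\<in>F. {fst I..snd I}) \<le> \<psi> a b / \<epsilon>" if F: "F \<subseteq> C" "finite F" for F
  proof -
    have "measure lebesgue (\<Union>I\<in>F. {fst I..snd I}) \<le> (\<Sum>I\<in>F. measure lebesgue {fst I..snd I})"
      using F by (intro measure_UNION_le) auto
    also have "\<dots> \<le> (\<Sum>I\<in>F. \<psi> (fst I) (snd I) / \<epsilon>)"
    proof (rule sum_mono)
      fix I assume "I \<in> F"
      then have "I \<in> K" using F C by auto
      then show "measure lebesgue {fst I..snd I} \<le> \<psi> (fst I) (snd I) / \<epsilon>"
        using \<epsilon> by (auto simp: K_def field_simps)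
    qed
    also have "\<dots> = (\<Sum>I\<in>F. \<psi> (fst I) (snd I)) / \<epsilon>" by (simp add: sum_divide_distrib)
    also have "\<dots> \<le> \<psi> a b / \<epsilon>"
    proof (rule divide_right_mono)
      show "(\<Sum>I\<in>F. \<psi> (fst I) (snd I)) \<le> \<psi> a b"
      proof (rule sum_superadditive_le[where A = a and B = b])
        show "a \<le> s \<and> s \<le> t \<and> t \<le> b" if "(s, t) \<in> F" for s t
          using that F C by (auto simp: K_def)
        show "pairwise (\<lambda>I J. disjnt {fst I..snd I} {fst J..snd J}) F"
          using pairwise_subset[OF C(3) F(1)] unfolding ball .
      qed (use nonneg super F ab in auto)
    qed (use \<epsilon> in auto)
    finally show ?thesis .
  qed
  have U: "?U \<in> lmeasurable" "measure lebesgue ?U \<le> \<psi> a b / \<epsilon>"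
    using fmeasurable_UN_bound[OF C(1) _ bound] measure_UN_bound[OF C(1) _ bound] by auto
  let ?N = "S - ?U"
  have N: "negligible ?N" using C(4) unfolding ball .
  show thesis
  proof (rule that[of "?U \<union> ?N"])
    show "?U \<union> ?N \<in> lmeasurable" by (intro fmeasurable.Un U(1) negligible_imp_measurable N)
    have "measure lebesgue (?U \<union> ?N) \<le> measure lebesgue ?U + measure lebesgue ?N"
      by (intro measure_Un_le fmeasurableD U(1) negligible_imp_measurable N)
    then show "measure lebesgue (?U \<union> ?N) \<le> \<psi> a b / \<epsilon>" using U negligible_imp_measure0[OF N] by simp
  qed auto
qed

text \<open>\<open>d s t\<close> stands for the intrinsic distance between the positions of one
  curve at times \<open>s\<close> and \<open>t\<close>, so that only a pseudometric on the unit
  interval is left of the space. \<open>C\<close> bounds the discrete energies without the factor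
  1/2 and will be \<open>2 * \<alpha>\<close>.\<close>

locale finite_energy =
  fixes d :: "real \<Rightarrow> real \<Rightarrow> real" and C :: real
  assumes nonneg: "\<And>s t. s \<in> {0..1} \<Longrightarrow> t \<in> {0..1} \<Longrightarrow> 0 \<le> d s t"
    and self: "\<And>t. t \<in> {0..1} \<Longrightarrow> d t t = 0"
    and sym: "\<And>s t. s \<in> {0..1} \<Longrightarrow> t \<in> {0..1} \<Longrightarrow> d s t = d t s"
    and tri: "\<And>s t u. s \<in> {0..1} \<Longrightarrow> t \<in> {0..1} \<Longrightarrow> u \<in> {0..1} \<Longrightarrow> d s u \<le> d s t + d t u"
    and energy: "\<And>n t. 0 \<le> t 0 \<Longrightarrow> (\<And>i. i < n \<Longrightarrow> t i < t (Suc i)) \<Longrightarrow> t n \<le> 1 \<Longrightarrow>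
      (\<Sum>i<n. (d (t i) (t (Suc i)))\<^sup>2 / (t (Suc i) - t i)) \<le> C"
begin

lemma C_nonneg: "0 \<le> C" using energy[of "\<lambda>_. 0" 0] by simp

lemma modulus: "0 \<le> s \<Longrightarrow> s \<le> t \<Longrightarrow> t \<le> 1 \<Longrightarrow> d s t \<le> sqrt (C * (t - s))"
proof (cases "s = t")
  case False
  assume st: "0 \<le> s" "s \<le> t" "t \<le> 1"
  have "(d s t)\<^sup>2 / (t - s) \<le> C"
    using energy[of "\<lambda>i. if i = 0 then s else t" 1] st False by simp
  then have "(d s t)\<^sup>2 \<le> C * (t - s)" using st False by (simp add: field_simps)
  then show ?thesis by (rule real_le_rsqrt)
qed (use self C_nonneg in auto)

section \<open>Dyadic step functions of difference quotients\<close>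

definition node :: "nat \<Rightarrow> nat \<Rightarrow> real" where "node n k = real k / 2 ^ n"
definition slope :: "nat \<Rightarrow> nat \<Rightarrow> real" where "slope n k = 2 ^ n * d (node n k) (node n (Suc k))"
definition cell :: "nat \<Rightarrow> nat \<Rightarrow> real set" where "cell n k = {node n k..<node n (Suc k)}"
definition m :: "nat \<Rightarrow> real \<Rightarrow> real" where "m n x = (\<Sum>k<2 ^ n. slope n k * indicator (cell n k) x)"

lemma node_mono: "k \<le> l \<Longrightarrow> node n k \<le> node n l" by (simp add: node_def divide_right_mono)
lemma node_less_iff: "node n k < node n l \<longleftrightarrow> k < l" by (simp add: node_def divide_less_cancel)
lemma node_le_iff: "node n k \<le> node n l \<longleftrightarrow> k \<le> l" by (simp add: node_def divide_le_cancel)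
lemma node_0: "node n 0 = 0" by (simp add: node_def)
lemma node_top: "node n (2 ^ n) = 1" by (simp add: node_def)
lemma node_range: "k \<le> 2 ^ n \<Longrightarrow> node n k \<in> {0..1}"
  using node_mono[of 0 k n] node_mono[of k "2 ^ n" n] by (simp add: node_0 node_top)
lemma node_Suc: "node n (Suc k) - node n k = 1 / 2 ^ n"
  by (simp add: node_def diff_divide_distrib[symmetric])
lemma node_refine: "n \<le> N \<Longrightarrow> node n k = node N (k * 2 ^ (N - n))"
proof -
  assume "n \<le> N"
  then have "(2::real) ^ N = 2 ^ n * 2 ^ (N - n)" by (simp add: power_add[symmetric])
  then show ?thesis by (simp add: node_def)
qed

lemma slope_nonneg: "k < 2 ^ n \<Longrightarrow> 0 \<le> slope n k"
  unfolding slope_def using node_range[of k n] node_range[of "Suc k" n] by (intro mult_nonneg_nonneg nonneg) auto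

lemma m_measurable [measurable]: "m n \<in> borel_measurable borel"
  unfolding m_def cell_def by measurable

lemma m_nonneg: "0 \<le> m n x"
  unfolding m_def using slope_nonneg by (intro sum_nonneg mult_nonneg_nonneg) auto

lemma indicator_cell:
  "indicator (cell n k) x * indicator {node n p..<node n q} x = (if k \<in> {p..<q} then indicator (cell n k) x else (0::real))"
proof (cases "x \<in> cell n k")
  case True
  have "x \<in> {node n p..<node n q} \<longleftrightarrow> k \<in> {p..<q}"
  proof
    assume x: "x \<in> {node n p..<node n q}"
    then have "node n p < node n (Suc k)" "node n k < node n q" using True by (auto simp: cell_def)
    then show "k \<in> {p..<q}" unfolding node_less_iff by auto
  next
    assume "k \<in> {p..<q}"
    then have "node n p \<le> node n k" "node n (Suc k) \<le> node n q" unfolding node_le_iff by auto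
    then show "x \<in> {node n p..<node n q}" using True by (auto simp: cell_def)
  qed
  then show ?thesis using True by (simp add: indicator_def)
qed simp

lemma indicator_cell_integral: "integrable lborel (indicator (cell n k) :: real \<Rightarrow> real)"
  "(\<integral>x. indicator (cell n k) x \<partial>lborel) = (1 / 2 ^ n :: real)"
  using node_Suc[of n k] node_mono[of k "Suc k" n] unfolding cell_def by (auto simp: node_Suc)

lemma m_eq_slope:
  assumes "k < 2 ^ n" "x \<in> cell n k"
  shows "m n x = slope n k"
proof -
  have "indicator (cell n l) x = (if l = k then 1 else (0::real))" for l
    using indicator_cell[of n l x k "Suc k"] assms(2) by (auto simp: cell_def indicator_def split: if_splits)
  then have "m n x = (\<Sum>l<2 ^ n. if l = k then slope n l else 0)"
    unfolding m_def by (intro sum.cong) auto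
  then show ?thesis using assms(1) by simp
qed

lemma m_restrict:
  assumes "q \<le> 2 ^ n"
  shows "m n x * indicator {node n p..<node n q} x = (\<Sum>k\<in>{p..<q}. slope n k * indicator (cell n k) x)"
proof -
  have "m n x * indicator {node n p..<node n q} x = (\<Sum>k<2 ^ n. if k \<in> {p..<q} then slope n k * indicator (cell n k) x else 0)"
    unfolding m_def sum_distrib_right mult.assoc indicator_cell by (intro sum.cong) auto
  also have "\<dots> = (\<Sum>k\<in>{..<2 ^ n} \<inter> {p..<q}. slope n k * indicator (cell n k) x)"
    by (subst sum.inter_restrict) auto
  also have "{..<2 ^ n} \<inter> {p..<q} = {p..<q}" using assms by auto
  finally show ?thesis .
qed

lemma m_outside: "x \<notin> {0..<1} \<Longrightarrow> m n x = 0"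
proof -
  have "m n x * indicator {node n 0..<node n (2 ^ n)} x = m n x"
    using m_restrict[where q = "2 ^ n" and n = n and p = 0, OF order_refl] unfolding m_def atLeast0LessThan .
  then show "x \<notin> {0..<1} \<Longrightarrow> m n x = 0" by (simp add: node_0 node_top)
qed

lemma m_integrable: "integrable lborel (m n)"
  unfolding m_def using indicator_cell_integral(1)
  by (intro Bochner_Integration.integrable_sum integrable_mult_right) auto

lemma m_integral_nodes:
  assumes "q \<le> 2 ^ n"
  shows "(\<integral>x. m n x * indicator {node n p..<node n q} x \<partial>lborel) = (\<Sum>k\<in>{p..<q}. d (node n k) (node n (Suc k)))"
proof -
  have "(\<integral>x. m n x * indicator {node n p..<node n q} x \<partial>lborel) = (\<Sum>k\<in>{p..<q}. slope n k * (1 / 2 ^ n))"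
    unfolding m_restrict[OF assms] using indicator_cell_integral[of n]
    by (subst Bochner_Integration.integral_sum) auto
  then show ?thesis by (simp add: slope_def)
qed

lemma d_le_m_integral:
  assumes "p \<le> q" "q \<le> 2 ^ n"
  shows "d (node n p) (node n q) \<le> (\<integral>x. m n x * indicator {node n p..<node n q} x \<partial>lborel)"
  unfolding m_integral_nodes[OF assms(2)] using assms
proof (induction q)
  case 0
  then show ?case using self[of "node n 0"] by (simp add: node_0)
next
  case (Suc q)
  show ?case
  proof (cases "p = Suc q")
    case True
    then show ?thesis using self[OF node_range[OF Suc.prems(2)]] by simp
  next
    case False
    then have "d (node n p) (node n q) \<le> (\<Sum>k\<in>{p..<q}. d (node n k) (node n (Suc k)))" using Suc by auto
    moreover have "d (node n p) (node n (Suc q)) \<le> d (node n p) (node n q) + d (node n q) (node n (Suc q))"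
      using Suc.prems False by (intro tri node_range) auto
    ultimately show ?thesis using False Suc.prems by (simp add: sum.atLeastLessThan_Suc)
  qed
qed

lemma m_bound: obtains K where "\<And>x. \<bar>m n x\<bar> \<le> K"
proof (rule that)
  fix x
  show "\<bar>m n x\<bar> \<le> (\<Sum>k<2 ^ n. \<bar>slope n k\<bar>)"
    unfolding m_def by (intro order_trans[OF sum_abs] sum_mono) (auto simp: abs_mult indicator_def)
qed

lemma m_mult_integrable: "integrable lborel (\<lambda>x. m n x * m N x)"
proof -
  obtain K where K: "\<And>x. \<bar>m n x\<bar> \<le> K" using m_bound by blast
  show ?thesis
  proof (rule Bochner_Integration.integrable_bound)
    show "integrable lborel (\<lambda>x. K * m N x)" using m_integrable by simp
    show "AE x in lborel. norm (m n x * m N x) \<le> norm (K * m N x)"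
      using K by (intro AE_I2) (auto simp: abs_mult intro!: mult_right_mono order_trans[OF K])
  qed measurable
qed

text \<open>By the triangle inequality the \<open>m n\<close> form a submartingale for the dyadic filtration; being bounded
  in \<open>L\<^sup>2\<close>, they converge.\<close>
lemma m_inner_product_ge:
  assumes "n \<le> N"
  shows "(\<Sum>k<2 ^ n. (slope n k)\<^sup>2 / 2 ^ n) \<le> (\<integral>x. m n x * m N x \<partial>lborel)"
proof -
  have int: "integrable lborel (\<lambda>x. m N x * indicator (cell n k) x)" for k
    by (rule integrable_mult_indicator[OF _ m_integrable, of _ N, simplified mult.commute[of _ "m N _"] real_scaleR_def])
      (simp add: cell_def)
  have "(\<Sum>k<2 ^ n. (slope n k)\<^sup>2 / 2 ^ n) \<le> (\<Sum>k<2 ^ n. slope n k * (\<integral>x. m N x * indicator (cell n k) x \<partial>lborel))"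
  proof (rule sum_mono)
    fix k :: nat assume k: "k \<in> {..<2 ^ n}"
    let ?l = "k * 2 ^ (N - n)" and ?u = "Suc k * 2 ^ (N - n)"
    have "?u \<le> 2 ^ n * 2 ^ (N - n)" using k by (intro mult_right_mono) auto
    then have u: "?u \<le> 2 ^ N" using assms by (simp add: power_add[symmetric])
    have "slope n k / 2 ^ n = d (node N ?l) (node N ?u)"
      unfolding slope_def node_refine[OF assms, of k] node_refine[OF assms, of "Suc k"] by simp
    also have "\<dots> \<le> (\<integral>x. m N x * indicator {node N ?l..<node N ?u} x \<partial>lborel)"
      by (rule d_le_m_integral[OF _ u]) simp
    also have "{node N ?l..<node N ?u} = cell n k"
      unfolding cell_def node_refine[OF assms, of k] node_refine[OF assms, of "Suc k"] ..
    finally have "slope n k * (slope n k / 2 ^ n) \<le> slope n k * (\<integral>x. m N x * indicator (cell n k) x \<partial>lborel)"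
      using k slope_nonneg by (intro mult_left_mono) auto
    then show "(slope n k)\<^sup>2 / 2 ^ n \<le> slope n k * (\<integral>x. m N x * indicator (cell n k) x \<partial>lborel)"
      by (simp add: power2_eq_square)
  qed
  also have "\<dots> = (\<integral>x. (\<Sum>k<2 ^ n. slope n k * (m N x * indicator (cell n k) x)) \<partial>lborel)"
    using int by (subst Bochner_Integration.integral_sum) auto
  also have "\<dots> = (\<integral>x. m n x * m N x \<partial>lborel)"
    unfolding m_def[of n] sum_distrib_right
    by (intro Bochner_Integration.integral_cong sum.cong refl) (simp only: mult_ac)
  finally show ?thesis .
qed

lemma m_square_integral: "(\<integral>x. (m n x)\<^sup>2 \<partial>lborel) = (\<Sum>k<2 ^ n. (slope n k)\<^sup>2 / 2 ^ n)"
proof -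
  have "(m n x)\<^sup>2 = (\<Sum>k<2 ^ n. (slope n k)\<^sup>2 * indicator (cell n k) x)" for x
  proof -
    have "m n x * m n x = (\<Sum>k<2 ^ n. slope n k * indicator (cell n k) x * m n x)"
      by (subst (1) m_def) (simp only: sum_distrib_right)
    also have "\<dots> = (\<Sum>k<2 ^ n. (slope n k)\<^sup>2 * indicator (cell n k) x)"
      by (intro sum.cong refl) (auto simp: m_eq_slope power2_eq_square indicator_def)
    finally show ?thesis by (simp add: power2_eq_square)
  qed
  then have "(\<integral>x. (m n x)\<^sup>2 \<partial>lborel) = (\<integral>x. (\<Sum>k<2 ^ n. (slope n k)\<^sup>2 * indicator (cell n k) x) \<partial>lborel)" by simp
  also have "\<dots> = (\<Sum>k<2 ^ n. (slope n k)\<^sup>2 / 2 ^ n)"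
    using indicator_cell_integral[of n] by (subst Bochner_Integration.integral_sum) auto
  finally show ?thesis .
qed

lemma m_square_integral_le: "(\<integral>x. (m n x)\<^sup>2 \<partial>lborel) \<le> C"
proof -
  have "(\<integral>x. (m n x)\<^sup>2 \<partial>lborel) = (\<Sum>k<2 ^ n. (d (node n k) (node n (Suc k)))\<^sup>2 / (node n (Suc k) - node n k))"
    unfolding m_square_integral node_Suc slope_def
    by (intro sum.cong refl) (simp add: power_mult_distrib power2_eq_square)
  also have "\<dots> \<le> C" by (rule energy) (auto simp: node_0 node_top node_less_iff)
  finally show ?thesis .
qed

lemma m_square_integrable: "integrable lborel (\<lambda>x. (m n x)\<^sup>2)"
  using m_mult_integrable[of n n] by (simp add: power2_eq_square)

text \<open>Expanding the square and bounding the cross term from below by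
  \<open>m_inner_product_ge\<close> gives a Pythagorean inequality: the increments are paid for by
  the growth of the square norms, which is bounded by \<open>C\<close>.\<close>

lemma m_L2_increment:
  assumes "n \<le> N"
  shows "(\<integral>x. (m N x - m n x)\<^sup>2 \<partial>lborel) \<le> (\<integral>x. (m N x)\<^sup>2 \<partial>lborel) - (\<integral>x. (m n x)\<^sup>2 \<partial>lborel)"
proof -
  have "(\<integral>x. (m N x - m n x)\<^sup>2 \<partial>lborel) = (\<integral>x. (m N x)\<^sup>2 + (m n x)\<^sup>2 - 2 * (m n x * m N x) \<partial>lborel)"
    by (intro Bochner_Integration.integral_cong) (auto simp: power2_diff mult_ac)
  also have "\<dots> = (\<integral>x. (m N x)\<^sup>2 \<partial>lborel) + (\<integral>x. (m n x)\<^sup>2 \<partial>lborel) - 2 * (\<integral>x. m n x * m N x \<partial>lborel)"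
    using m_square_integrable m_mult_integrable by simp
  also have "\<dots> \<le> (\<integral>x. (m N x)\<^sup>2 \<partial>lborel) - (\<integral>x. (m n x)\<^sup>2 \<partial>lborel)"
    using m_inner_product_ge[OF assms] m_square_integral[of n] by simp
  finally show ?thesis .
qed

lemma m_L1_Cauchy:
  assumes e: "e > 0"
  shows "\<exists>n0. \<forall>n N. n0 \<le> n \<longrightarrow> n \<le> N \<longrightarrow> (\<integral>x. \<bar>m N x - m n x\<bar> \<partial>lborel) \<le> e"
proof -
  define a where "a n = (\<integral>x. (m n x)\<^sup>2 \<partial>lborel)" for n
  have mono: "a n \<le> a N" if "n \<le> N" for n N
  proof -
    have "0 \<le> (\<integral>x. (m N x - m n x)\<^sup>2 \<partial>lborel)" by simp
    then show ?thesis using m_L2_increment[OF that] unfolding a_def by linarith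
  qed
  then have "incseq a" by (simp add: incseq_def)
  moreover have "bdd_above (range a)" unfolding a_def by (rule bdd_aboveI2[OF m_square_integral_le])
  ultimately have "convergent a" by (metis LIMSEQ_incseq_SUP convergentI)
  then have "Cauchy a" by (rule convergent_Cauchy)
  \<comment> \<open>The threshold is \<open>e\<^sup>2\<close> because the bound below turns an error
    \<open>e\<^sup>2\<close> in the mean square into \<open>e\<^sup>2 / (2 * e) + e / 2 = e\<close>
    in the mean.\<close>
  then obtain n0 where n0: "\<And>n N. n0 \<le> n \<Longrightarrow> n0 \<le> N \<Longrightarrow> \<bar>a n - a N\<bar> < e\<^sup>2"
    using e unfolding Cauchy_def dist_real_def by (metis zero_less_power)
  show ?thesis
  proof (intro exI[of _ n0] allI impI)
    fix n N assume n: "n0 \<le> n" "n \<le> N"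
    have sq: "(\<integral>x. (m N x - m n x)\<^sup>2 \<partial>lborel) \<le> e\<^sup>2"
      using m_L2_increment[OF n(2)] n0[of n N] n unfolding a_def by auto
    have isq: "integrable lborel (\<lambda>x. (m N x - m n x)\<^sup>2)"
    proof -
      have "integrable lborel (\<lambda>x. (m N x)\<^sup>2 + (m n x)\<^sup>2 - 2 * (m n x * m N x))"
        using m_square_integrable m_mult_integrable by simp
      then show ?thesis by (simp add: power2_diff mult_ac)
    qed
    have ind: "integrable lborel (indicator {0..<1} :: real \<Rightarrow> real)" "(\<integral>x. indicator {0..<1::real} x \<partial>lborel) = (1::real)"
    proof -
      have c: "cell 0 0 = {0..<1}" by (simp add: cell_def node_def)
      show "integrable lborel (indicator {0..<1} :: real \<Rightarrow> real)"
        using indicator_cell_integral(1)[of 0 0] unfolding c .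
      show "(\<integral>x. indicator {0..<1::real} x \<partial>lborel) = (1::real)"
        using indicator_cell_integral(2)[of 0 0] unfolding c by (simp only: power_0 div_by_1)
    qed
    \<comment> \<open>Instead of the Cauchy-Schwarz inequality,
      \<open>\<bar>y\<bar> \<le> y^2 / (2 * e) + e / 2\<close> is integrated. The indicator makes
      the constant integrable and costs nothing, since all \<open>m n\<close> vanish outside the
      unit interval.\<close>
    have "(\<integral>x. \<bar>m N x - m n x\<bar> \<partial>lborel) \<le> (\<integral>x. (m N x - m n x)\<^sup>2 / (2 * e) + (e / 2) * indicator {0..<1} x \<partial>lborel)"
    proof (rule integral_mono)
      fix x
      show "\<bar>m N x - m n x\<bar> \<le> (m N x - m n x)\<^sup>2 / (2 * e) + (e / 2) * indicator {0..<1} x"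
      proof (cases "x \<in> {0..<1}")
        case True
        have "2 * \<bar>m N x - m n x\<bar> * e \<le> \<bar>m N x - m n x\<bar>\<^sup>2 + e\<^sup>2" by (rule sum_squares_bound)
        then show ?thesis using e True by (simp add: field_simps power2_eq_square)
      qed (simp add: m_outside)
    qed (use m_integrable isq ind in auto)
    also have "\<dots> = (\<integral>x. (m N x - m n x)\<^sup>2 \<partial>lborel) / (2 * e) + e / 2"
      using isq ind by simp
    also have "\<dots> \<le> e\<^sup>2 / (2 * e) + e / 2"
      using sq e by (intro add_right_mono divide_right_mono) auto
    also have "\<dots> = e" using e by (simp add: power2_eq_square)
    finally show "(\<integral>x. \<bar>m N x - m n x\<bar> \<partial>lborel) \<le> e" .
  qed
qed

text \<open>Along a subsequence with geometric errors in the mean the step functions converge almost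
  everywhere. Fatou's lemma keeps both the error to each \<open>m (r i)\<close> and the bound
  \<open>C\<close> on the square integral. The explicit rate later measures the exceptional sets for
  the metric derivative.\<close>

lemma limit_speed:
  obtains \<mu> r where "\<mu> \<in> borel_measurable borel" "\<And>x. 0 \<le> \<mu> x" "\<And>x. x \<notin> {0..<1} \<Longrightarrow> \<mu> x = 0"
    "strict_mono (r :: nat \<Rightarrow> nat)" "integrable lborel \<mu>"
    "\<And>i. (\<integral>x. \<bar>\<mu> x - m (r i) x\<bar> \<partial>lborel) \<le> (1/2)^i"
    "(\<integral>\<^sup>+x. ennreal ((\<mu> x)\<^sup>2) \<partial>lborel) \<le> ennreal C"
proof -
  have "\<exists>n0. \<forall>n N. n0 \<le> n \<longrightarrow> n \<le> N \<longrightarrow> (\<integral>x. \<bar>m N x - m n x\<bar> \<partial>lborel) \<le> (1/2)^i" for i :: nat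
    by (rule m_L1_Cauchy) simp
  then obtain n0 where n0: "\<And>i n N. n0 i \<le> n \<Longrightarrow> n \<le> N \<Longrightarrow> (\<integral>x. \<bar>m N x - m n x\<bar> \<partial>lborel) \<le> (1/2)^i"
    using choice[of "\<lambda>i n0. \<forall>n N. n0 \<le> n \<longrightarrow> n \<le> N \<longrightarrow> (\<integral>x. \<bar>m N x - m n x\<bar> \<partial>lborel) \<le> (1/2)^i"] by blast
  \<comment> \<open>The sum dominates \<open>n0 i\<close>, and the summand \<open>i\<close> makes
    the sequence strictly increasing.\<close>
  define r where "r i = i + (\<Sum>j\<le>i. n0 j)" for i
  have r_ge: "n0 i \<le> r i" for i
  proof -
    have "n0 i \<le> (\<Sum>j\<le>i. n0 j)" by (rule member_le_sum) auto
    then show ?thesis by (simp add: r_def)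
  qed
  have r_mono: "strict_mono r" by (rule strict_mono_Suc_iff[THEN iffD2]) (simp add: r_def)
  have le: "(\<integral>x. \<bar>m (r j) x - m (r i) x\<bar> \<partial>lborel) \<le> (1/2)^i" if "i \<le> j" for i j
    using n0[OF r_ge] strict_mono_less_eq[OF r_mono, of i j] that by simp
  have conv: "AE x in lborel. convergent (\<lambda>j. m (r j) x)"
  proof (rule AE_convergent_of_L1_summable)
    show "integrable lborel (\<lambda>x. m (r (Suc j)) x - m (r j) x)" for j using m_integrable by simp
    show "(\<integral>x. \<bar>m (r (Suc j)) x - m (r j) x\<bar> \<partial>lborel) \<le> (1/2)^j" for j by (rule le) simp
    show "summable (\<lambda>j. (1/2::real)^j)" by (rule summable_geometric) simp
  qed
  \<comment> \<open>Where the sequence diverges, \<open>lim\<close> is arbitrary; the maximum with 0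
    keeps \<open>\<mu>\<close> nonnegative there and has no effect on limits of the nonnegative
    \<open>m (r j)\<close>.\<close>
  define \<mu> where "\<mu> x = max 0 (lim (\<lambda>j. m (r j) x))" for x
  have \<mu>m [measurable]: "\<mu> \<in> borel_measurable borel" unfolding \<mu>_def by measurable
  have \<mu>0: "\<mu> x = 0" if "x \<notin> {0..<1}" for x using that by (simp add: \<mu>_def m_outside)
  have lim: "AE x in lborel. (\<lambda>j. m (r j) x) \<longlonglongrightarrow> \<mu> x"
    using conv
  proof eventually_elim
    case (elim x)
    then have l: "(\<lambda>j. m (r j) x) \<longlonglongrightarrow> lim (\<lambda>j. m (r j) x)" by (simp add: convergent_LIMSEQ_iff)
    have "0 \<le> lim (\<lambda>j. m (r j) x)" by (rule LIMSEQ_le_const[OF l]) (use m_nonneg in auto)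
    with l show ?case by (simp add: \<mu>_def)
  qed
  have nn: "(\<integral>\<^sup>+x. ennreal \<bar>\<mu> x - m (r i) x\<bar> \<partial>lborel) \<le> ennreal ((1/2)^i)" for i
  proof -
    have "(\<integral>\<^sup>+x. ennreal \<bar>\<mu> x - m (r i) x\<bar> \<partial>lborel) = (\<integral>\<^sup>+x. liminf (\<lambda>j. ennreal \<bar>m (r j) x - m (r i) x\<bar>) \<partial>lborel)"
    proof (rule nn_integral_cong_AE)
      show "AE x in lborel. ennreal \<bar>\<mu> x - m (r i) x\<bar> = liminf (\<lambda>j. ennreal \<bar>m (r j) x - m (r i) x\<bar>)"
        using lim
      proof eventually_elim
        case (elim x)
        then have "(\<lambda>j. ennreal \<bar>m (r j) x - m (r i) x\<bar>) \<longlonglongrightarrow> ennreal \<bar>\<mu> x - m (r i) x\<bar>"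
          by (intro tendsto_ennrealI tendsto_intros)
        then show ?case by (intro lim_imp_Liminf[symmetric]) auto
      qed
    qed
    also have "\<dots> \<le> liminf (\<lambda>j. \<integral>\<^sup>+x. ennreal \<bar>m (r j) x - m (r i) x\<bar> \<partial>lborel)"
      by (rule nn_integral_liminf) measurable
    also have "\<dots> \<le> ennreal ((1/2)^i)"
    proof (rule Liminf_le)
      have "(\<integral>\<^sup>+x. ennreal \<bar>m (r j) x - m (r i) x\<bar> \<partial>lborel) = ennreal (\<integral>x. \<bar>m (r j) x - m (r i) x\<bar> \<partial>lborel)" for j
        using m_integrable by (intro nn_integral_eq_integral) auto
      then show "\<forall>\<^sub>F j in sequentially. (\<integral>\<^sup>+x. ennreal \<bar>m (r j) x - m (r i) x\<bar> \<partial>lborel) \<le> ennreal ((1/2)^i)"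
        using le unfolding eventually_sequentially by (auto intro!: exI[of _ i] ennreal_leI)
    qed simp
    finally show ?thesis .
  qed
  have idiff: "integrable lborel (\<lambda>x. \<mu> x - m (r i) x)" for i
    using nn[of i] by (intro integrableI_bounded) (auto simp: less_top[symmetric] top_unique)
  have i\<mu>: "integrable lborel \<mu>"
    using Bochner_Integration.integrable_add[OF idiff[of 0] m_integrable[of "r 0"]] by simp
  have L1: "(\<integral>x. \<bar>\<mu> x - m (r i) x\<bar> \<partial>lborel) \<le> (1/2)^i" for i
  proof -
    have "ennreal (\<integral>x. \<bar>\<mu> x - m (r i) x\<bar> \<partial>lborel) = (\<integral>\<^sup>+x. ennreal \<bar>\<mu> x - m (r i) x\<bar> \<partial>lborel)"
      using idiff by (intro nn_integral_eq_integral[symmetric]) auto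
    also have "\<dots> \<le> ennreal ((1/2)^i)" by (rule nn)
    finally show ?thesis by (subst (asm) ennreal_le_iff) auto
  qed
  have L2: "(\<integral>\<^sup>+x. ennreal ((\<mu> x)\<^sup>2) \<partial>lborel) \<le> ennreal C"
  proof -
    have "(\<integral>\<^sup>+x. ennreal ((\<mu> x)\<^sup>2) \<partial>lborel) = (\<integral>\<^sup>+x. liminf (\<lambda>j. ennreal ((m (r j) x)\<^sup>2)) \<partial>lborel)"
    proof (rule nn_integral_cong_AE)
      show "AE x in lborel. ennreal ((\<mu> x)\<^sup>2) = liminf (\<lambda>j. ennreal ((m (r j) x)\<^sup>2))"
        using lim
      proof eventually_elim
        case (elim x)
        then have "(\<lambda>j. ennreal ((m (r j) x)\<^sup>2)) \<longlonglongrightarrow> ennreal ((\<mu> x)\<^sup>2)"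
          by (intro tendsto_ennrealI tendsto_intros)
        then show ?case by (intro lim_imp_Liminf[symmetric]) auto
      qed
    qed
    also have "\<dots> \<le> liminf (\<lambda>j. \<integral>\<^sup>+x. ennreal ((m (r j) x)\<^sup>2) \<partial>lborel)"
      by (rule nn_integral_liminf) measurable
    also have "\<dots> \<le> ennreal C"
    proof (rule Liminf_le)
      have "(\<integral>\<^sup>+x. ennreal ((m (r j) x)\<^sup>2) \<partial>lborel) = ennreal (\<integral>x. (m (r j) x)\<^sup>2 \<partial>lborel)" for j
        using m_square_integrable by (intro nn_integral_eq_integral) auto
      then show "\<forall>\<^sub>F j in sequentially. (\<integral>\<^sup>+x. ennreal ((m (r j) x)\<^sup>2) \<partial>lborel) \<le> ennreal C"
        by (intro always_eventually allI) (simp only: ennreal_leI m_square_integral_le)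
    qed simp
    finally show ?thesis .
  qed
  show thesis by (rule that[OF \<mu>m _ \<mu>0 r_mono i\<mu> L1 L2]) (simp add: \<mu>_def)
qed

end

lemma integral_Icc_bounds:
  fixes f :: "real \<Rightarrow> real"
  assumes f: "integrable lborel f"
  shows "f integrable_on {s..t}" "integral {s..t} f = (\<integral>x. f x * indicator {s..t} x \<partial>lborel)"
    "\<bar>integral {s..t} f\<bar> \<le> (\<integral>x. \<bar>f x\<bar> \<partial>lborel)"
    "set_lebesgue_integral lborel {s..t} f = integral {s..t} f"
proof -
  have si: "set_integrable lborel {s..t} f"
    unfolding set_integrable_def using f by (intro integrable_mult_indicator) auto
  show "f integrable_on {s..t}" "set_lebesgue_integral lborel {s..t} f = integral {s..t} f"
    using set_borel_integral_eq_integral[OF si] by auto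
  then show eq: "integral {s..t} f = (\<integral>x. f x * indicator {s..t} x \<partial>lborel)"
    by (simp add: set_lebesgue_integral_def mult.commute)
  have "\<bar>integral {s..t} f\<bar> \<le> (\<integral>x. \<bar>f x * indicator {s..t} x\<bar> \<partial>lborel)"
    unfolding eq by (rule integral_abs_bound)
  also have "\<dots> \<le> (\<integral>x. \<bar>f x\<bar> \<partial>lborel)"
    using f si by (intro integral_mono) (auto simp: set_integrable_def mult.commute indicator_def)
  finally show "\<bar>integral {s..t} f\<bar> \<le> (\<integral>x. \<bar>f x\<bar> \<partial>lborel)" .
qed

section \<open>The limit speed dominates the distance and is its metric derivative\<close>

locale finite_energy_speed = finite_energy +
  fixes \<mu> :: "real \<Rightarrow> real" and r :: "nat \<Rightarrow> nat"
  assumes \<mu>_measurable [measurable]: "\<mu> \<in> borel_measurable borel" and \<mu>_nonneg: "\<And>x. 0 \<le> \<mu> x"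
    and \<mu>_outside: "\<And>x. x \<notin> {0..<1} \<Longrightarrow> \<mu> x = 0"
    and r_mono: "strict_mono r" and \<mu>_integrable: "integrable lborel \<mu>"
    and L1_error: "\<And>i. (\<integral>x. \<bar>\<mu> x - m (r i) x\<bar> \<partial>lborel) \<le> (1/2)^i"
begin

lemma error_integrable: "integrable lborel (\<lambda>x. \<bar>\<mu> x - m (r i) x\<bar>)"
  using \<mu>_integrable m_integrable by auto

lemma integral_error:
  "integral {s..t} (\<lambda>x. \<mu> x - m (r i) x) = integral {s..t} \<mu> - integral {s..t} (m (r i))"
  by (intro integral_diff integral_Icc_bounds \<mu>_integrable m_integrable)

text \<open>A node of level \<open>n\<close> is a node of every finer level, so
  \<open>d_le_m_integral\<close> applies at level \<open>r j\<close>. Replacing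
  \<open>m (r j)\<close> by \<open>\<mu>\<close> costs at most \<open>(1/2)^j\<close>, and
  \<open>j\<close> tends to infinity.\<close>

lemma d_le_integral_nodes:
  assumes "p \<le> q" "q \<le> 2 ^ n"
  shows "d (node n p) (node n q) \<le> integral {node n p..node n q} \<mu>"
proof (rule LIMSEQ_le_const)
  show "(\<lambda>j. integral {node n p..node n q} \<mu> + (1/2)^j) \<longlonglongrightarrow> integral {node n p..node n q} \<mu>"
    using tendsto_add[OF tendsto_const LIMSEQ_power_zero[of "1/2::real"]] by simp
  have "d (node n p) (node n q) \<le> integral {node n p..node n q} \<mu> + (1/2)^j" if j: "n \<le> j" for j
  proof -
    let ?N = "r j" and ?I = "{node n p..node n q}"
    have nN: "n \<le> ?N" using j strict_mono_imp_increasing[OF r_mono, of j] by simp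
    let ?p = "p * 2 ^ (?N - n)" and ?q = "q * 2 ^ (?N - n)"
    have "?q \<le> 2 ^ n * 2 ^ (?N - n)" using assms by (intro mult_right_mono) auto
    then have q: "?q \<le> 2 ^ ?N" using nN by (simp add: power_add[symmetric])
    have "d (node n p) (node n q) \<le> (\<integral>x. m ?N x * indicator {node n p..<node n q} x \<partial>lborel)"
      unfolding node_refine[OF nN, of p] node_refine[OF nN, of q]
      by (rule d_le_m_integral[OF _ q]) (use assms in simp)
    also have "\<dots> \<le> (\<integral>x. m ?N x * indicator ?I x \<partial>lborel)"
    proof (rule integral_mono)
      have *: "integrable lborel (\<lambda>x. m ?N x * indicator A x)" if "A \<in> sets borel" for A
        using integrable_mult_indicator[of A lborel "m ?N"] m_integrable that by (simp add: mult.commute)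
      show "integrable lborel (\<lambda>x. m ?N x * indicator {node n p..<node n q} x)" "integrable lborel (\<lambda>x. m ?N x * indicator ?I x)"
        by (rule *, simp)+
    qed (auto simp: indicator_def m_nonneg)
    also have "\<dots> = integral ?I (m ?N)" by (rule integral_Icc_bounds(2)[OF m_integrable, symmetric])
    also have "\<dots> \<le> integral ?I \<mu> + (1/2)^j"
      using integral_Icc_bounds(3)[of "\<lambda>x. \<mu> x - m ?N x" "node n p" "node n q"] L1_error[of j] \<mu>_integrable m_integrable
      unfolding integral_error by auto
    finally show ?thesis .
  qed
  then show "\<exists>N. \<forall>j\<ge>N. d (node n p) (node n q) \<le> integral {node n p..node n q} \<mu> + (1/2)^j" by blast
qed

lemma integral_subset_le:
  assumes "s \<le> s'" "t' \<le> t"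
  shows "integral {s'..t'} \<mu> \<le> integral {s..t} \<mu>"
  using assms by (intro integral_subset_le integral_Icc_bounds \<mu>_integrable) (auto simp: \<mu>_nonneg)

text \<open>The endpoints are rounded inwards to dyadic nodes. The middle piece is
  \<open>d_le_integral_nodes\<close>; each of the two boundary pieces is shorter than a cell or
  equal to one in length, and \<open>modulus\<close> makes it vanish in the limit.\<close>

lemma d_le_integral:
  assumes st: "0 \<le> s" "s \<le> t" "t \<le> 1"
  shows "d s t \<le> integral {s..t} \<mu>"
proof (cases "s = t")
  case True
  then show ?thesis using self st by simp
next
  case False
  obtain n0 where n0: "1 / (t - s) < real n0" using reals_Archimedean2 by blast
  show ?thesis
  proof (rule LIMSEQ_le_const)
    have "(\<lambda>n. integral {s..t} \<mu> + 2 * sqrt (C * (1/2)^n)) \<longlonglongrightarrow> integral {s..t} \<mu> + 2 * sqrt (C * 0)"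
      by (intro tendsto_intros LIMSEQ_power_zero) auto
    then show "(\<lambda>n. integral {s..t} \<mu> + 2 * sqrt (C * (1/2)^n)) \<longlonglongrightarrow> integral {s..t} \<mu>" by simp
    have "d s t \<le> integral {s..t} \<mu> + 2 * sqrt (C * (1/2)^n)" if n: "n \<ge> n0" for n
    proof -
      have n2: "real n0 < 2 ^ n" using n of_nat_less_two_power[of n] by (meson le_less_trans of_nat_le_iff)
      \<comment> \<open>The interval has to be at least one cell long, so that the left endpoint
        rounded up does not pass the right endpoint rounded down.\<close>
      have ts: "1 \<le> 2 ^ n * (t - s)"
      proof -
        have "1 < real n0 * (t - s)" using n0 st False by (simp add: field_simps)
        also have "\<dots> \<le> 2 ^ n * (t - s)" using n2 st by (intro mult_right_mono) auto
        finally show ?thesis by simp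
      qed
      define p where "p = nat \<lceil>2 ^ n * s\<rceil>"
      define q where "q = nat \<lfloor>2 ^ n * t\<rfloor>"
      have p: "real p = of_int \<lceil>2 ^ n * s\<rceil>" using st by (simp add: p_def)
      have q: "real q = of_int \<lfloor>2 ^ n * t\<rfloor>" using st by (simp add: q_def)
      have p1: "2 ^ n * s \<le> real p" "real p \<le> 2 ^ n * s + 1" unfolding p by linarith+
      have q1: "real q \<le> 2 ^ n * t" "2 ^ n * t \<le> real q + 1" unfolding q by linarith+
      have "2 ^ n * s + 1 \<le> 2 ^ n * t" using ts by (simp add: right_diff_distrib)
      then have "\<lceil>2 ^ n * s\<rceil> \<le> \<lfloor>2 ^ n * t\<rfloor>" by linarith
      then have pq: "p \<le> q" unfolding p_def q_def by (rule nat_mono)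
      have "2 ^ n * t \<le> 2 ^ n * 1" using st by (intro mult_left_mono) auto
      then have "real q \<le> 2 ^ n" using q1 by linarith
      then have q2: "q \<le> 2 ^ n" by (metis of_nat_le_iff of_nat_numeral of_nat_power)
      let ?a = "node n p" and ?b = "node n q"
      have a: "s \<le> ?a" "?a - s \<le> (1/2)^n"
      proof -
        show "s \<le> ?a" using p1 by (simp add: node_def field_simps)
        have "?a \<le> (2 ^ n * s + 1) / 2 ^ n" unfolding node_def using p1 by (intro divide_right_mono) auto
        then show "?a - s \<le> (1/2)^n" by (simp add: add_divide_distrib power_one_over)
      qed
      have b: "?b \<le> t" "t - ?b \<le> (1/2)^n"
      proof -
        show "?b \<le> t" using q1 by (simp add: node_def field_simps)
        have "2 ^ n * t / 2 ^ n \<le> (real q + 1) / 2 ^ n" using q1 by (intro divide_right_mono) auto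
        then show "t - ?b \<le> (1/2)^n" by (simp add: node_def add_divide_distrib power_one_over)
      qed
      have r01: "?a \<in> {0..1}" "?b \<in> {0..1}" "?a \<le> ?b" using pq q2 by (auto intro!: node_range[THEN atLeastAtMost_iff[THEN iffD1, THEN conjunct1]] node_range[THEN atLeastAtMost_iff[THEN iffD1, THEN conjunct2]] node_mono)
      have "d s t \<le> d s ?a + (d ?a ?b + d ?b t)"
        using tri[of s ?a t] tri[of ?a ?b t] st r01 by auto
      also have "d s ?a \<le> sqrt (C * (1/2)^n)"
        by (rule order_trans[OF modulus]) (use a st r01 C_nonneg in \<open>auto intro!: mult_left_mono\<close>)
      also have "d ?b t \<le> sqrt (C * (1/2)^n)"
        by (rule order_trans[OF modulus]) (use b st r01 C_nonneg in \<open>auto intro!: mult_left_mono\<close>)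
      also have "d ?a ?b \<le> integral {?a..?b} \<mu>" by (rule d_le_integral_nodes[OF pq q2])
      also have "\<dots> \<le> integral {s..t} \<mu>" using a b by (intro integral_subset_le)
      finally show ?thesis by simp
    qed
    then show "\<exists>N. \<forall>n\<ge>N. d s t \<le> integral {s..t} \<mu> + 2 * sqrt (C * (1/2)^n)" by blast
  qed
qed

text \<open>A majorant for the deviation of \<open>d s t\<close> from a constant slope, built to be
  superadditive. The first term is additive and measures the error of the step function; the second,
  the shortfall of the distance below the length, is superadditive by the triangle
  inequality.\<close>

definition defect :: "nat \<Rightarrow> real \<Rightarrow> real \<Rightarrow> real" where
  "defect i s t = integral {s..t} (\<lambda>x. \<bar>\<mu> x - m (r i) x\<bar>) + (integral {s..t} \<mu> - d s t)"

lemma defect_nonneg: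
  assumes "0 \<le> s" "s \<le> t" "t \<le> 1"
  shows "0 \<le> defect i s t"
  unfolding defect_def using d_le_integral[OF assms]
  by (intro add_nonneg_nonneg integral_nonneg integral_Icc_bounds error_integrable) auto

lemma defect_superadditive:
  assumes "0 \<le> s" "s \<le> t" "t \<le> u" "u \<le> 1"
  shows "defect i s t + defect i t u \<le> defect i s u"
proof -
  have "integral {s..t} f + integral {t..u} f = integral {s..u} f" if "integrable lborel f" for f :: "real \<Rightarrow> real"
    by (intro Henstock_Kurzweil_Integration.integral_combine integral_Icc_bounds that assms)
  from this[OF error_integrable[of i]] this[OF \<mu>_integrable] show ?thesis
    unfolding defect_def using tri[of s t u] assms by simp
qed

lemma defect_bound:
  assumes k: "k < 2 ^ r i" and st: "node (r i) k \<le> s" "s \<le> t" "t \<le> node (r i) (Suc k)"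
  shows "\<bar>d s t - slope (r i) k * (t - s)\<bar> \<le> defect i s t"
proof -
  let ?n = "r i"
  have "node ?n k \<in> {0..1}" "node ?n (Suc k) \<in> {0..1}" using k by (auto intro!: node_range simp del: atLeastAtMost_iff)
  then have r01: "0 \<le> s" "t \<le> 1" using st by auto
  \<comment> \<open>\<open>m\<close> equals the slope on the half-open cell only; the right endpoint
    is a null set.\<close>
  have "integral {s..t} (m ?n) = integral {s..t} (\<lambda>x. slope ?n k)"
    by (rule integral_spike[where S = "{node ?n (Suc k)}"])
      (use st k in \<open>auto intro!: m_eq_slope[symmetric] simp: cell_def\<close>)
  then have mI: "integral {s..t} (m ?n) = slope ?n k * (t - s)" using st by simp
  have "norm (integral {s..t} (\<lambda>x. \<mu> x - m ?n x)) \<le> integral {s..t} (\<lambda>x. \<bar>\<mu> x - m ?n x\<bar>)"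
    by (rule Henstock_Kurzweil_Integration.integral_norm_bound_integral)
      (use \<mu>_integrable m_integrable in \<open>auto intro!: integral_Icc_bounds(1)\<close>)
  then show ?thesis
    using d_le_integral[OF r01(1) st(2) r01(2)] unfolding defect_def integral_error mI real_norm_def by linarith
qed

text \<open>At the nodes of level \<open>r i\<close> the distances add up exactly to the integral of
  \<open>m (r i)\<close>, so the total shortfall is the difference of the integrals of
  \<open>\<mu>\<close> and \<open>m (r i)\<close>. Each of the two terms of the defect thus
  contributes at most \<open>(1/2)^i\<close>.\<close>

lemma sum_defect: "(\<Sum>k<2 ^ r i. defect i (node (r i) k) (node (r i) (Suc k))) \<le> 2 * (1/2)^i"
proof -
  let ?n = "r i"
  have sumI: "(\<Sum>k<q. integral {node ?n k..node ?n (Suc k)} f) = integral {0..node ?n q} f"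
    if f: "integrable lborel f" for f :: "real \<Rightarrow> real" and q
  proof (induction q)
    case (Suc q)
    have "integral {0..node ?n q} f + integral {node ?n q..node ?n (Suc q)} f = integral {0..node ?n (Suc q)} f"
      using node_mono[of 0 q ?n] node_mono[of q "Suc q" ?n]
      by (intro Henstock_Kurzweil_Integration.integral_combine integral_Icc_bounds f) (auto simp: node_0)
    then show ?case using Suc by simp
  qed (simp add: node_0)
  have "(\<Sum>k<2 ^ ?n. d (node ?n k) (node ?n (Suc k))) = (\<integral>x. m ?n x * indicator {0..<1} x \<partial>lborel)"
    using m_integral_nodes[OF order_refl, of ?n 0] by (simp add: node_0 node_top atLeast0LessThan)
  also have "\<dots> = (\<integral>x. m ?n x * indicator {0..1} x \<partial>lborel)"
    by (intro Bochner_Integration.integral_cong refl) (auto simp: indicator_def m_outside)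
  also have "\<dots> = integral {0..1} (m ?n)" by (rule integral_Icc_bounds(2)[OF m_integrable, symmetric])
  finally have sd: "(\<Sum>k<2 ^ ?n. d (node ?n k) (node ?n (Suc k))) = integral {0..1} (m ?n)" .
  have "(\<Sum>k<2 ^ ?n. defect i (node ?n k) (node ?n (Suc k)))
      = integral {0..1} (\<lambda>x. \<bar>\<mu> x - m ?n x\<bar>) + (integral {0..1} \<mu> - integral {0..1} (m ?n))"
    unfolding defect_def using sumI[OF error_integrable[of i], of "2 ^ ?n"] sumI[OF \<mu>_integrable, of "2 ^ ?n"] sd
    by (simp add: sum.distrib sum_subtractf node_top)
  also have "\<dots> \<le> (1/2)^i + (1/2)^i"
    using integral_Icc_bounds(3)[OF error_integrable[of i], of 0 1] L1_error[of i]
      integral_Icc_bounds(3)[of "\<lambda>x. \<mu> x - m ?n x" 0 1] \<mu>_integrable m_integrable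
    unfolding integral_error by (intro add_mono) auto
  finally show ?thesis by simp
qed

text \<open>Near \<open>t\<close> the increment is compared with the slope of the cell of a fine
  level that contains \<open>t\<close>. This fails only where the defect exceeds
  \<open>\<epsilon>\<close> times the length on arbitrarily short intervals, where
  \<open>\<mu>\<close> and the step function differ by more than \<open>\<epsilon>\<close>, or at a
  node. A Vitali bound and Chebyshev's inequality make the first two sets small; the nodes are
  finitely many.\<close>

lemma speed_approx_negligible:
  assumes \<epsilon>: "\<epsilon> > 0"
  shows "negligible {t \<in> {0<..<1}. \<not> (\<forall>\<^sub>F h in at 0. \<bar>d t (t + h) / \<bar>h\<bar> - \<mu> t\<bar> \<le> 2 * \<epsilon>)}" (is "negligible ?Bad")
  unfolding negligible_outer_le
proof (intro allI impI)
  fix e :: real assume e: "e > 0"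
  \<comment> \<open>The Vitali bound contributes \<open>2 * (1/2)^i / \<epsilon>\<close> by
    \<open>sum_defect\<close>, and Chebyshev's inequality another
    \<open>(1/2)^i / \<epsilon>\<close>.\<close>
  obtain i where i: "(1/2)^i < e * \<epsilon> / 3" using real_arch_pow_inv[of "e * \<epsilon> / 3" "1/2"] e \<epsilon> by auto
  let ?n = "r i"
  let ?a = "\<lambda>k. node ?n k" and ?b = "\<lambda>k. node ?n (Suc k)"
  define S where "S k = {x \<in> {?a k<..<?b k}. \<forall>\<rho>>0. \<exists>s t. s \<le> x \<and> x \<le> t \<and> s < t \<and> t - s < \<rho> \<and> ?a k \<le> s \<and> t \<le> ?b k \<and> \<epsilon> * (t - s) < defect i s t}" for k
  have "\<exists>U. S k \<subseteq> U \<and> U \<in> lmeasurable \<and> measure lebesgue U \<le> defect i (?a k) (?b k) / \<epsilon>" if k: "k < 2 ^ ?n" for k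
  proof -
    have ab: "?a k \<in> {0..1}" "?b k \<in> {0..1}" "?a k \<le> ?b k"
      using node_range[of k ?n] node_range[of "Suc k" ?n] node_mono[of k "Suc k" ?n] k by auto
    obtain U where "S k \<subseteq> U" "U \<in> lmeasurable" "measure lebesgue U \<le> defect i (?a k) (?b k) / \<epsilon>"
    proof (rule vitali_superadditive[of "?a k" "?b k" "defect i" \<epsilon> "S k"])
      show "0 \<le> defect i s t" if "?a k \<le> s" "s \<le> t" "t \<le> ?b k" for s t
        using that ab by (intro defect_nonneg) auto
      show "defect i s t + defect i t u \<le> defect i s u" if "?a k \<le> s" "s \<le> t" "t \<le> u" "u \<le> ?b k" for s t u
        using that ab by (intro defect_superadditive) auto
      show "\<exists>s t. s \<le> x \<and> x \<le> t \<and> s < t \<and> t - s < \<rho> \<and> ?a k \<le> s \<and> t \<le> ?b k \<and> \<epsilon> * (t - s) < defect i s t"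
        if "x \<in> S k" "\<rho> > 0" for x \<rho> using that unfolding S_def by blast
    qed (use ab \<epsilon> in auto)
    then show ?thesis by blast
  qed
  then have "\<forall>k. \<exists>U. k < 2 ^ ?n \<longrightarrow> S k \<subseteq> U \<and> U \<in> lmeasurable \<and> measure lebesgue U \<le> defect i (?a k) (?b k) / \<epsilon>" by blast
  from choice[OF this] obtain U where U: "\<And>k. k < 2 ^ ?n \<Longrightarrow> S k \<subseteq> U k" "\<And>k. k < 2 ^ ?n \<Longrightarrow> U k \<in> lmeasurable"
    "\<And>k. k < 2 ^ ?n \<Longrightarrow> measure lebesgue (U k) \<le> defect i (?a k) (?b k) / \<epsilon>" by blast
  define UU where "UU = (\<Union>k<2 ^ ?n. U k)"
  have UU: "UU \<in> lmeasurable" "measure lebesgue UU \<le> 2 * (1/2)^i / \<epsilon>"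
  proof -
    show "UU \<in> lmeasurable" unfolding UU_def using U by (intro fmeasurable.finite_UN) auto
    have "measure lebesgue UU \<le> (\<Sum>k<2 ^ ?n. measure lebesgue (U k))"
      unfolding UU_def using U by (intro measure_UNION_le) (auto intro: fmeasurableD)
    also have "\<dots> \<le> (\<Sum>k<2 ^ ?n. defect i (?a k) (?b k) / \<epsilon>)" using U by (intro sum_mono) auto
    also have "\<dots> = (\<Sum>k<2 ^ ?n. defect i (?a k) (?b k)) / \<epsilon>" by (simp add: sum_divide_distrib)
    also have "\<dots> \<le> 2 * (1/2)^i / \<epsilon>" using sum_defect[of i] \<epsilon> by (intro divide_right_mono) auto
    finally show "measure lebesgue UU \<le> 2 * (1/2)^i / \<epsilon>" .
  qed
  define V where "V = {x \<in> {0..<1}. \<epsilon> < \<bar>\<mu> x - m ?n x\<bar>}"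
  have V: "V \<in> lmeasurable" "measure lebesgue V \<le> (1/2)^i / \<epsilon>"
  proof -
    have Vb: "V \<in> sets borel" unfolding V_def by measurable
    have Vsub: "V \<subseteq> {0..<1}" by (auto simp: V_def)
    show "V \<in> lmeasurable"
      by (rule bounded_set_imp_lmeasurable) (use Vb Vsub in \<open>auto intro: bounded_subset[of "{0..<1}"]\<close>)
    have "emeasure lborel V \<le> emeasure lborel {0..<1::real}" using Vsub by (intro emeasure_mono) auto
    then have int: "integrable lborel (indicator V :: real \<Rightarrow> real)"
      using Vb by (intro integrable_real_indicator) (auto simp: less_top[symmetric] top_unique)
    have "\<epsilon> * measure lborel V = (\<integral>x. \<epsilon> * indicator V x \<partial>lborel)" using Vb by simp
    also have "\<dots> \<le> (\<integral>x. \<bar>\<mu> x - m ?n x\<bar> \<partial>lborel)"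
    proof (rule integral_mono)
      show "integrable lborel (\<lambda>x. \<epsilon> * indicator V x)" using int by (rule integrable_mult_right)
      show "\<epsilon> * indicator V x \<le> \<bar>\<mu> x - m ?n x\<bar>" for x by (simp add: V_def indicator_def)
    qed (rule error_integrable)
    also have "\<dots> \<le> (1/2)^i" by (rule L1_error)
    finally have "measure lborel V \<le> (1/2)^i / \<epsilon>" using \<epsilon> by (simp add: field_simps)
    then show "measure lebesgue V \<le> (1/2)^i / \<epsilon>" using Vb by (simp add: measure_completion)
  qed
  \<comment> \<open>Away from the nodes, all sufficiently short intervals at \<open>t\<close> stay
    inside one cell, where \<open>defect_bound\<close> compares with a single slope.\<close>
  define G where "G = node ?n ` {..2 ^ ?n}"
  have G: "negligible G" unfolding G_def by (rule negligible_finite) simp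
  show "\<exists>T. ?Bad \<subseteq> T \<and> T \<in> lmeasurable \<and> measure lebesgue T \<le> e"
  proof (intro exI conjI)
    show T: "UU \<union> V \<union> G \<in> lmeasurable"
      by (intro fmeasurable.Un UU V negligible_imp_measurable G)
    have "measure lebesgue (UU \<union> V \<union> G) \<le> measure lebesgue (UU \<union> V) + measure lebesgue G"
      by (intro measure_Un_le fmeasurableD fmeasurable.Un UU V negligible_imp_measurable G)
    also have "\<dots> \<le> (measure lebesgue UU + measure lebesgue V) + 0"
      using negligible_imp_measure0[OF G] by (intro add_mono measure_Un_le fmeasurableD UU V) auto
    also have "\<dots> \<le> 3 * (1/2)^i / \<epsilon>" using UU(2) V(2) by (simp add: field_simps)
    also have "\<dots> \<le> e" using i \<epsilon> by (simp add: field_simps)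
    finally show "measure lebesgue (UU \<union> V \<union> G) \<le> e" .
    show "?Bad \<subseteq> UU \<union> V \<union> G"
    proof (rule subsetI, rule ccontr)
      fix t assume t: "t \<in> ?Bad" "t \<notin> UU \<union> V \<union> G"
      then have t01: "0 < t" "t < 1" by auto
      define k where "k = nat \<lfloor>2 ^ ?n * t\<rfloor>"
      have kr: "real k = of_int \<lfloor>2 ^ ?n * t\<rfloor>" using t01 by (simp add: k_def)
      have k1: "real k \<le> 2 ^ ?n * t" "2 ^ ?n * t < real k + 1" unfolding kr by linarith+
      have "2 ^ ?n * t < 2 ^ ?n * 1" using t01 by (intro mult_strict_left_mono) auto
      then have "real k < 2 ^ ?n" using k1 by linarith
      then have k2: "k < 2 ^ ?n" by (metis of_nat_less_iff of_nat_numeral of_nat_power)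
      have "?a k \<le> t" "t < ?b k" using k1 by (simp_all add: node_def field_simps)
      moreover have "t \<noteq> ?a k" using t k2 by (auto simp: G_def)
      ultimately have tk: "?a k < t" "t < ?b k" by auto
      have "t \<notin> S k" using t U(1)[OF k2] k2 by (auto simp: UU_def)
      then have "\<not> (\<forall>\<rho>>0. \<exists>s u. s \<le> t \<and> t \<le> u \<and> s < u \<and> u - s < \<rho> \<and> ?a k \<le> s \<and> u \<le> ?b k \<and> \<epsilon> * (u - s) < defect i s u)"
        using tk unfolding S_def by simp
      then obtain \<rho> where \<rho>: "\<rho> > 0"
        and nex: "\<not> (\<exists>s u. s \<le> t \<and> t \<le> u \<and> s < u \<and> u - s < \<rho> \<and> ?a k \<le> s \<and> u \<le> ?b k \<and> \<epsilon> * (u - s) < defect i s u)"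
        by blast
      have small: "defect i s u \<le> \<epsilon> * (u - s)" if "s \<le> t" "t \<le> u" "s < u" "u - s < \<rho>" "?a k \<le> s" "u \<le> ?b k" for s u
        using nex that not_le by blast
      have mt: "m ?n t = slope ?n k" using tk k2 by (intro m_eq_slope) (auto simp: cell_def)
      have "t \<notin> V" using t by auto
      then have \<mu>t: "\<bar>\<mu> t - slope ?n k\<bar> \<le> \<epsilon>" using t01 mt by (auto simp: V_def)
      have r01: "0 \<le> ?a k" "?b k \<le> 1" using node_range[of k ?n] node_range[of "Suc k" ?n] k2 by auto
      define \<delta> where "\<delta> = min \<rho> (min (t - ?a k) (?b k - t))"
      have \<delta>: "\<delta> > 0" using \<rho> tk by (simp add: \<delta>_def)
      \<comment> \<open>One \<open>\<epsilon>\<close> comes from the defect of the interval between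
        \<open>t\<close> and \<open>t + h\<close>, the other from replacing the slope by
        \<open>\<mu> t\<close>.\<close>
      have est: "\<bar>d t (t + h) / \<bar>h\<bar> - \<mu> t\<bar> \<le> 2 * \<epsilon>" if h: "h \<noteq> 0" "\<bar>h\<bar> < \<delta>" for h
      proof -
        have "\<bar>d t (t + h) - slope ?n k * \<bar>h\<bar>\<bar> \<le> \<epsilon> * \<bar>h\<bar>"
        proof (cases "h > 0")
          case True
          then have "\<bar>d t (t + h) - slope ?n k * (t + h - t)\<bar> \<le> defect i t (t + h)"
            using h tk k2 by (intro defect_bound) (auto simp: \<delta>_def)
          also have "\<dots> \<le> \<epsilon> * (t + h - t)" using True h tk by (intro small) (auto simp: \<delta>_def)
          finally show ?thesis using True by simp
        next
          case False
          then have "\<bar>d (t + h) t - slope ?n k * (t - (t + h))\<bar> \<le> defect i (t + h) t"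
            using h tk k2 by (intro defect_bound) (auto simp: \<delta>_def)
          also have "\<dots> \<le> \<epsilon> * (t - (t + h))" using False h tk by (intro small) (auto simp: \<delta>_def)
          finally have "\<bar>d (t + h) t - slope ?n k * \<bar>h\<bar>\<bar> \<le> \<epsilon> * \<bar>h\<bar>" using False by simp
          moreover have "d (t + h) t = d t (t + h)" using h t01 r01 False by (intro sym) (auto simp: \<delta>_def)
          ultimately show ?thesis by simp
        qed
        then have "\<bar>d t (t + h) - slope ?n k * \<bar>h\<bar>\<bar> / \<bar>h\<bar> \<le> \<epsilon>" using h by (simp add: field_simps)
        moreover have "\<bar>d t (t + h) / \<bar>h\<bar> - slope ?n k\<bar> = \<bar>d t (t + h) - slope ?n k * \<bar>h\<bar>\<bar> / \<bar>h\<bar>"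
        proof -
          have "d t (t + h) / \<bar>h\<bar> - slope ?n k = (d t (t + h) - slope ?n k * \<bar>h\<bar>) / \<bar>h\<bar>"
            using h by (simp add: field_simps)
          then show ?thesis by (simp add: abs_divide)
        qed
        ultimately show ?thesis using \<mu>t by linarith
      qed
      then have "\<forall>\<^sub>F h in at 0. \<bar>d t (t + h) / \<bar>h\<bar> - \<mu> t\<bar> \<le> 2 * \<epsilon>"
        unfolding eventually_at using \<delta> by (intro exI[of _ \<delta>]) (auto simp: dist_real_def)
      then show False using t by auto
    qed
  qed
qed

lemma speed_AE: "AE t in lborel. t \<in> {0<..<1} \<longrightarrow> ((\<lambda>h. d t (t + h) / \<bar>h\<bar>) \<longlongrightarrow> \<mu> t) (at 0)"
proof -
  let ?Bad = "\<lambda>j. {t \<in> {0<..<1}. \<not> (\<forall>\<^sub>F h in at 0. \<bar>d t (t + h) / \<bar>h\<bar> - \<mu> t\<bar> \<le> 2 * (1 / real (Suc j)))}"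
  have "AE t in lborel. t \<notin> ?Bad j" for j
    using speed_approx_negligible[of "1 / real (Suc j)"] AE_not_in[of "?Bad j" lebesgue]
    by (simp add: negligible_iff_null_sets AE_completion_iff)
  then have "AE t in lborel. \<forall>j. t \<notin> ?Bad j" unfolding AE_all_countable by (rule allI)
  then show ?thesis
  proof eventually_elim
    case (elim t)
    show ?case
    proof
      assume t: "t \<in> {0<..<1}"
      show "((\<lambda>h. d t (t + h) / \<bar>h\<bar>) \<longlongrightarrow> \<mu> t) (at 0)"
      proof (rule tendstoI)
        fix e :: real assume "e > 0"
        then obtain j where j: "1 / real (Suc j) < e / 2"
          using reals_Archimedean[of "e / 2"] by (auto simp: inverse_eq_divide)
        have "\<forall>\<^sub>F h in at 0. \<bar>d t (t + h) / \<bar>h\<bar> - \<mu> t\<bar> \<le> 2 * (1 / real (Suc j))" using elim t by blast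
        then show "\<forall>\<^sub>F h in at 0. dist (d t (t + h) / \<bar>h\<bar>) (\<mu> t) < e"
          by eventually_elim (use j in \<open>simp add: dist_real_def\<close>)
      qed
    qed
  qed
qed

end

section \<open>Stationarity of the diffusion\<close>

lemma bounded_borelI:
  "f \<in> borel_measurable borel \<Longrightarrow> (\<And>x. \<bar>f x\<bar> \<le> B) \<Longrightarrow> bounded_borel f"
  unfolding bounded_borel_def by (auto intro!: boundedI[of _ B])

lemma bounded_borelE:
  assumes "bounded_borel f"
  obtains B where "B > 0" "\<And>x. \<bar>f x\<bar> \<le> B"
  using assms unfolding bounded_borel_def bounded_pos by auto

lemma bounded_borel_measurable [dest]: "bounded_borel f \<Longrightarrow> f \<in> borel_measurable borel"
  by (simp add: bounded_borel_def)

lemma bounded_borel_const [simp]: "bounded_borel (\<lambda>_. c)"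
  by (rule bounded_borelI[of _ "\<bar>c\<bar>"]) auto

lemma bounded_borel_mult:
  assumes "bounded_borel f" "bounded_borel g" shows "bounded_borel (\<lambda>x. f x * g x)"
proof -
  obtain A B where A: "A > 0" "\<And>x. \<bar>f x\<bar> \<le> A" and B: "B > 0" "\<And>x. \<bar>g x\<bar> \<le> B"
    using assms by (metis bounded_borelE)
  show ?thesis
    by (rule bounded_borelI[of _ "A * B"])
      (use assms A B in \<open>auto simp: abs_mult intro!: mult_mono borel_measurable_times\<close>)
qed

lemma bounded_borel_add:
  assumes "bounded_borel f" "bounded_borel g" shows "bounded_borel (\<lambda>x. f x + g x)"
proof -
  obtain A B where A: "A > 0" "\<And>x. \<bar>f x\<bar> \<le> A" and B: "B > 0" "\<And>x. \<bar>g x\<bar> \<le> B"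
    using assms by (metis bounded_borelE)
  have "\<bar>f x + g x\<bar> \<le> A + B" for x
    using A(2)[of x] B(2)[of x] by linarith
  then show ?thesis
    by (rule bounded_borelI[rotated]) (use assms in \<open>auto intro!: borel_measurable_add\<close>)
qed

lemma bounded_borel_comp:
  fixes h :: "real \<Rightarrow> real"
  assumes "continuous_on UNIV h" "bounded_borel f"
  shows "bounded_borel (\<lambda>x. h (f x))"
proof -
  obtain B where B: "B > 0" "\<And>x. \<bar>f x\<bar> \<le> B"
    using assms bounded_borelE by metis
  have "compact (h ` {-B..B})"
    by (intro compact_continuous_image continuous_on_subset[OF assms(1)]) auto
  then have "bounded (h ` {-B..B})" by (rule compact_imp_bounded)
  moreover have "range (\<lambda>x. h (f x)) \<subseteq> h ` {-B..B}"
    using B by (auto simp: abs_le_iff minus_le_iff)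
  moreover have "(\<lambda>x. h (f x)) \<in> borel_measurable borel"
    using borel_measurable_continuous_onI[OF assms(1)] bounded_borel_measurable[OF assms(2)]
    by (rule measurable_compose[rotated])
  ultimately show ?thesis
    unfolding bounded_borel_def using bounded_subset by blast
qed

lemma bounded_borel_cmult: "bounded_borel f \<Longrightarrow> bounded_borel (\<lambda>x. c * f x)"
  by (rule bounded_borel_mult) auto

lemma bounded_borel_diff:
  "bounded_borel f \<Longrightarrow> bounded_borel g \<Longrightarrow> bounded_borel (\<lambda>x. f x - g x)"
  using bounded_borel_add[of f "\<lambda>x. -1 * g x"] bounded_borel_cmult[of g "-1"] by simp

lemma bounded_borel_sum:
  "(\<And>i. i \<in> I \<Longrightarrow> bounded_borel (f i)) \<Longrightarrow> bounded_borel (\<lambda>x. \<Sum>i\<in>I. f i x)"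
  by (induction I rule: infinite_finite_induct) (auto intro!: bounded_borel_add)

lemma bounded_borel_power2: "bounded_borel f \<Longrightarrow> bounded_borel (\<lambda>x. (f x)\<^sup>2)"
  by (rule bounded_borel_comp[of "\<lambda>y. y\<^sup>2"]) (auto intro!: continuous_intros)

lemma bounded_borel_abs: "bounded_borel f \<Longrightarrow> bounded_borel (\<lambda>x. \<bar>f x\<bar>)"
  by (rule bounded_borel_comp[of abs]) (auto intro!: continuous_intros)

lemma bounded_borel_exp: "bounded_borel f \<Longrightarrow> bounded_borel (\<lambda>x. exp (c * f x))"
  by (rule bounded_borel_comp[of "\<lambda>y. exp (c * y)"]) (auto intro!: continuous_intros)

lemma bounded_borel_sgn: "bounded_borel f \<Longrightarrow> bounded_borel (\<lambda>x. sgn (f x))"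
  by (rule bounded_borelI[of _ 1]) (auto simp: sgn_if dest!: bounded_borel_measurable)

text \<open>The error depends on \<open>c\<close> only through its oscillation at the mesh size. For
  the correlations to which this is applied, that oscillation is bounded uniformly over the starting
  time and over all test functions with values in [-1, 1].\<close>

lemma riemann_sum_error:
  fixes c :: "real \<Rightarrow> real"
  assumes "0 < \<epsilon>" "0 < N" and cont: "continuous_on {t..t+\<epsilon>} c"
    and osc: "\<And>r q. r \<in> {t..t+\<epsilon>} \<Longrightarrow> q \<in> {t..t+\<epsilon>} \<Longrightarrow> \<bar>r - q\<bar> \<le> \<epsilon> / real N \<Longrightarrow> \<bar>c r - c q\<bar> \<le> \<eta>"
  shows "\<bar>(1 / real N) * (\<Sum>k<N. c (t + real k * (\<epsilon> / real N))) - (1 / \<epsilon>) * integral {t..t+\<epsilon>} c\<bar> \<le> \<eta>"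
proof -
  define h where "h = \<epsilon> / real N"
  have h: "h > 0" "real N * h = \<epsilon>" using assms by (auto simp: h_def)
  have le: "real n * h \<le> \<epsilon>" if "n \<le> N" for n
    using h that by (metis mult_right_mono of_nat_le_iff less_imp_le)
  have int: "c integrable_on {x..y}" if "t \<le> x" "y \<le> t + \<epsilon>" for x y
    by (rule integrable_continuous_real, rule continuous_on_subset[OF cont]) (use that in auto)
  have "\<bar>h * (\<Sum>k<n. c (t + real k * h)) - integral {t..t + real n * h} c\<bar> \<le> real n * h * \<eta>" if "n \<le> N" for n
    using that
  proof (induction n)
    case 0
    then show ?case by simp
  next
    case (Suc n)
    define a where "a = t + real n * h"
    have a: "t \<le> a" "a + h \<le> t + \<epsilon>" and Sa: "t + real (Suc n) * h = a + h"
      using le[OF Suc.prems] h by (auto simp: a_def algebra_simps)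
    have split: "integral {t..a} c + integral {a..a+h} c = integral {t..a+h} c"
      by (rule Henstock_Kurzweil_Integration.integral_combine) (use a h int in auto)
    have "norm (integral (cbox a (a+h)) (\<lambda>x. c a - c x)) \<le> \<eta> * measure lborel (cbox a (a+h))"
    proof (rule integrable_bound)
      have "\<bar>c a - c a\<bar> \<le> \<eta>"
        using a h by (intro osc) (auto simp: h_def[symmetric])
      then show "0 \<le> \<eta>" by simp
      show "(\<lambda>x. c a - c x) integrable_on cbox a (a+h)"
        using int[of a "a+h"] a by (intro integrable_diff) auto
      show "norm (c a - c x) \<le> \<eta>" if "x \<in> cbox a (a+h)" for x
        using that a h osc[of a x] by (auto simp: h_def[symmetric])
    qed
    moreover have "integral {a..a+h} (\<lambda>x. c a - c x) = h * c a - integral {a..a+h} c"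
      using int[of a "a+h"] a h by (subst integral_diff) auto
    ultimately have "\<bar>h * c a - integral {a..a+h} c\<bar> \<le> h * \<eta>"
      using h by (simp add: mult.commute)
    moreover have "\<bar>h * (\<Sum>k<n. c (t + real k * h)) - integral {t..a} c\<bar> \<le> real n * h * \<eta>"
      unfolding a_def using Suc by auto
    ultimately have "\<bar>h * c a + h * (\<Sum>k<n. c (t + real k * h)) - (integral {t..a} c + integral {a..a+h} c)\<bar>
        \<le> h * \<eta> + real n * h * \<eta>"
      by linarith
    then show ?case
      unfolding Sa split[symmetric] by (simp add: a_def algebra_simps)
  qed
  from this[of N] have *: "\<bar>h * (\<Sum>k<N. c (t + real k * h)) - integral {t..t + \<epsilon>} c\<bar> \<le> \<epsilon> * \<eta>"
    using h by simp
  have "(1 / real N) * (\<Sum>k<N. c (t + real k * h)) - (1 / \<epsilon>) * integral {t..t+\<epsilon>} c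
      = (h * (\<Sum>k<N. c (t + real k * h)) - integral {t..t + \<epsilon>} c) / \<epsilon>"
    using assms(1,2) by (simp add: h_def field_simps)
  then have "\<bar>(1 / real N) * (\<Sum>k<N. c (t + real k * h)) - (1 / \<epsilon>) * integral {t..t+\<epsilon>} c\<bar>
      = \<bar>h * (\<Sum>k<N. c (t + real k * h)) - integral {t..t + \<epsilon>} c\<bar> / \<epsilon>"
    using assms(1) by simp
  also have "\<dots> \<le> \<eta>" using * assms(1) by (simp add: field_simps)
  finally show ?thesis by (simp add: h_def)
qed

section \<open>Correlations of the process and time averages\<close>

locale diffusion =
  fixes M :: "'a::polish_space measure"
    and D :: "('a \<Rightarrow> real) set"
    and E :: "('a \<Rightarrow> real) \<Rightarrow> ('a \<Rightarrow> real) \<Rightarrow> real"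
    and P :: "(real \<Rightarrow> 'a) measure"
    and T :: "real \<Rightarrow> ('a \<Rightarrow> real) \<Rightarrow> ('a \<Rightarrow> real)"
  assumes prob_M: "prob_space M" and sets_M: "sets M = sets borel"
    and form: "dirichlet_form M D E" and local: "strongly_local M D E"
    and prob_P: "prob_space P" and sets_P: "sets P = sets path_sets"
    and init: "distr P borel (\<lambda>\<omega>. \<omega> 0) = M"
    and markov: "markov_law P T" and assoc: "associated M P D E"
begin

sublocale M: prob_space M by (rule prob_M)
sublocale P: prob_space P by (rule prob_P)

text \<open>The common language of the form and of \<open>T\<close>: \<open>associated\<close> is
  stated with correlations from time 0, and \<open>T t g\<close> is accessible only by its
  correlations with the past. Choosing the first function as a sign recovers absolute moments from
  them.\<close>

definition corr :: "('a \<Rightarrow> real) \<Rightarrow> real \<Rightarrow> ('a \<Rightarrow> real) \<Rightarrow> real \<Rightarrow> real" where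
  "corr f s g t = (\<integral>\<omega>. f (\<omega> s) * g (\<omega> t) \<partial>P)"

text \<open>A Borel function need not be continuous along the paths, so regularity in time is asked
  in mean, uniformly over both times. It comes from path continuity for continuous \<open>g\<close>
  and, once \<open>M\<close> is known to be invariant, from the form for every bounded Borel
  \<open>g\<close>.\<close>

definition L1_continuous :: "('a \<Rightarrow> real) \<Rightarrow> bool" where
  "L1_continuous g \<longleftrightarrow> (\<forall>e>0. \<exists>\<delta>>0. \<forall>r\<in>{0..1}. \<forall>q\<in>{0..1}.
     \<bar>r - q\<bar> < \<delta> \<longrightarrow> (\<integral>\<omega>. \<bar>g (\<omega> r) - g (\<omega> q)\<bar> \<partial>P) < e)"

lemma L1_continuousE:
  assumes "L1_continuous g" "e > 0"
  obtains \<delta> where "\<delta> > 0" "\<And>r q. r \<in> {0..1} \<Longrightarrow> q \<in> {0..1} \<Longrightarrow> \<bar>r - q\<bar> < \<delta> \<Longrightarrow>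
      (\<integral>\<omega>. \<bar>g (\<omega> r) - g (\<omega> q)\<bar> \<partial>P) < e"
  using assms unfolding L1_continuous_def by blast

lemma space_P: "space P = path_space"
  using sets_eq_imp_space_eq[OF sets_P] unfolding path_sets_def
  by (auto simp: space_restrict_space space_PiM path_space_def PiE_def)

lemma measurable_M [simp]: "borel_measurable M = borel_measurable borel"
  by (rule measurable_cong_sets) (auto simp: sets_M)

lemma X_measurable [measurable]:
  assumes "t \<in> {0..1}" shows "(\<lambda>\<omega>. \<omega> t) \<in> measurable P borel"
proof -
  have "(\<lambda>\<omega>. \<omega> t) \<in> measurable (restrict_space (PiM {0..1} (\<lambda>_. borel)) path_space) borel"
    by (rule measurable_restrict_space1, rule measurable_component_singleton) (use assms in auto)
  then show ?thesis
    using measurable_cong_sets[OF sets_P refl, of borel] unfolding path_sets_def by auto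
qed

lemma measurable_at:
  "g \<in> borel_measurable borel \<Longrightarrow> t \<in> {0..1} \<Longrightarrow> (\<lambda>\<omega>. g (\<omega> t)) \<in> borel_measurable P"
  by (rule measurable_compose[OF X_measurable])

lemma bounded_borel_measurable_at:
  "bounded_borel g \<Longrightarrow> t \<in> {0..1} \<Longrightarrow> (\<lambda>\<omega>. g (\<omega> t)) \<in> borel_measurable P"
  by (rule measurable_at) auto

lemma integrable_at:
  assumes "bounded_borel f" "s \<in> {0..1}"
  shows "integrable P (\<lambda>\<omega>. f (\<omega> s))"
proof -
  obtain A where A: "A > 0" "\<And>x. \<bar>f x\<bar> \<le> A"
    using assms by (metis bounded_borelE)
  show ?thesis
    by (rule P.integrable_const_bound[where B = A])
      (use assms A in \<open>auto intro!: bounded_borel_measurable_at\<close>)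
qed

lemma integrable_at2:
  assumes "bounded_borel f" "bounded_borel g" "s \<in> {0..1}" "t \<in> {0..1}"
  shows "integrable P (\<lambda>\<omega>. f (\<omega> s) * g (\<omega> t))"
proof -
  obtain A B where A: "A > 0" "\<And>x. \<bar>f x\<bar> \<le> A" and B: "B > 0" "\<And>x. \<bar>g x\<bar> \<le> B"
    using assms by (metis bounded_borelE)
  show ?thesis
    by (rule P.integrable_const_bound[where B = "A * B"])
      (use assms A B in \<open>auto simp: abs_mult intro!: bounded_borel_measurable_at mult_mono borel_measurable_times\<close>)
qed

lemma integrable_M:
  assumes "bounded_borel f"
  shows "integrable M f"
proof -
  obtain A where A: "A > 0" "\<And>x. \<bar>f x\<bar> \<le> A"
    using assms by (metis bounded_borelE)
  show ?thesis
    by (rule M.integrable_const_bound[where B = A]) (use assms A in auto)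
qed

lemma integral_M_eq_start:
  fixes f :: "'a \<Rightarrow> real"
  shows "f \<in> borel_measurable borel \<Longrightarrow> (\<integral>x. f x \<partial>M) = (\<integral>\<omega>. f (\<omega> 0) \<partial>P)"
  using Bochner_Integration.integral_distr[of "\<lambda>\<omega>. \<omega> 0" P borel f] X_measurable[of 0] by (simp add: init)

lemma bounded_borel_T: "bounded_borel g \<Longrightarrow> t \<in> {0..1} \<Longrightarrow> bounded_borel (T t g)"
  using markov unfolding markov_law_def by auto

lemma corr_T:
  assumes "bounded_borel \<phi>" "bounded_borel g" "0 \<le> u" "u \<le> v" "0 \<le> t" "v + t \<le> 1"
  shows "corr \<phi> u (T t g) v = corr \<phi> u g (v + t)"
  using markov[unfolded markov_law_def, THEN conjunct2, rule_format,
      of v t g "Suc 0" "\<lambda>_. u" "\<lambda>_. \<phi>"] assms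
  unfolding corr_def by simp

lemma corr_cadd:
  assumes "bounded_borel \<phi>" "bounded_borel f" "bounded_borel g" "s \<in> {0..1}" "t \<in> {0..1}"
  shows "corr \<phi> s (\<lambda>x. a * f x + b * g x) t = a * corr \<phi> s f t + b * corr \<phi> s g t"
proof -
  have "corr \<phi> s (\<lambda>x. a * f x + b * g x) t
      = (\<integral>\<omega>. a * (\<phi> (\<omega> s) * f (\<omega> t)) + b * (\<phi> (\<omega> s) * g (\<omega> t)) \<partial>P)"
    unfolding corr_def by (simp add: algebra_simps)
  also have "\<dots> = a * corr \<phi> s f t + b * corr \<phi> s g t"
    unfolding corr_def by (subst Bochner_Integration.integral_add) (use assms integrable_at2 in auto)
  finally show ?thesis .
qed

lemma corr_sum:
  assumes "bounded_borel \<phi>" "\<And>i. i \<in> I \<Longrightarrow> bounded_borel (f i)" "s \<in> {0..1}" "t \<in> {0..1}"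
  shows "corr \<phi> s (\<lambda>x. c * (\<Sum>i\<in>I. f i x)) t = c * (\<Sum>i\<in>I. corr \<phi> s (f i) t)"
proof -
  have "corr \<phi> s (\<lambda>x. c * (\<Sum>i\<in>I. f i x)) t = (\<integral>\<omega>. c * (\<Sum>i\<in>I. \<phi> (\<omega> s) * f i (\<omega> t)) \<partial>P)"
    unfolding corr_def by (simp add: sum_distrib_left algebra_simps)
  also have "\<dots> = c * (\<Sum>i\<in>I. corr \<phi> s (f i) t)"
    unfolding corr_def by (subst integral_mult_right_zero, subst Bochner_Integration.integral_sum)
      (use assms integrable_at2 in auto)
  finally show ?thesis .
qed

lemma corr_bound:
  assumes "bounded_borel \<phi>" "bounded_borel g" "s \<in> {0..1}" "t \<in> {0..1}" "\<And>x. \<bar>g x\<bar> \<le> B"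
  shows "\<bar>corr \<phi> s g t\<bar> \<le> B * (\<integral>\<omega>. \<bar>\<phi> (\<omega> s)\<bar> \<partial>P)"
proof -
  have "\<bar>corr \<phi> s g t\<bar> \<le> (\<integral>\<omega>. \<bar>\<phi> (\<omega> s) * g (\<omega> t)\<bar> \<partial>P)"
    unfolding corr_def by (rule integral_abs_bound)
  also have "\<dots> \<le> (\<integral>\<omega>. B * \<bar>\<phi> (\<omega> s)\<bar> \<partial>P)"
  proof (rule integral_mono)
    show "\<bar>\<phi> (\<omega> s) * g (\<omega> t)\<bar> \<le> B * \<bar>\<phi> (\<omega> s)\<bar>" for \<omega>
      using assms(5) by (subst mult.commute) (simp add: abs_mult mult_right_mono)
  qed (use assms integrable_at2[of \<phi> g s t] integrable_at[OF bounded_borel_abs, of \<phi> s] in auto)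
  finally show ?thesis by simp
qed

lemma corr_diff_bound:
  assumes "bounded_borel \<phi>" "bounded_borel g" "u \<in> {0..1}" "r \<in> {0..1}" "q \<in> {0..1}" "\<And>x. \<bar>\<phi> x\<bar> \<le> K"
  shows "\<bar>corr \<phi> u g r - corr \<phi> u g q\<bar> \<le> K * (\<integral>\<omega>. \<bar>g (\<omega> r) - g (\<omega> q)\<bar> \<partial>P)"
proof -
  have int: "integrable P (\<lambda>\<omega>. \<bar>g (\<omega> r) - g (\<omega> q)\<bar>)"
    using assms integrable_at by auto
  have "corr \<phi> u g r - corr \<phi> u g q = (\<integral>\<omega>. \<phi> (\<omega> u) * g (\<omega> r) - \<phi> (\<omega> u) * g (\<omega> q) \<partial>P)"
    unfolding corr_def by (rule Bochner_Integration.integral_diff[symmetric]) (use assms integrable_at2 in auto)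
  also have "\<bar>\<dots>\<bar> \<le> (\<integral>\<omega>. \<bar>\<phi> (\<omega> u) * g (\<omega> r) - \<phi> (\<omega> u) * g (\<omega> q)\<bar> \<partial>P)"
    by (rule integral_abs_bound)
  also have "\<dots> \<le> (\<integral>\<omega>. K * \<bar>g (\<omega> r) - g (\<omega> q)\<bar> \<partial>P)"
  proof (rule integral_mono)
    show "integrable P (\<lambda>\<omega>. \<bar>\<phi> (\<omega> u) * g (\<omega> r) - \<phi> (\<omega> u) * g (\<omega> q)\<bar>)"
      using assms integrable_at2 by auto
    show "\<bar>\<phi> (\<omega> u) * g (\<omega> r) - \<phi> (\<omega> u) * g (\<omega> q)\<bar> \<le> K * \<bar>g (\<omega> r) - g (\<omega> q)\<bar>" for \<omega>
      using assms(6) by (simp add: right_diff_distrib[symmetric] abs_mult mult_right_mono)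
  qed (use int in auto)
  finally show ?thesis by simp
qed

lemma corr_continuous:
  assumes "bounded_borel \<phi>" "bounded_borel g" "u \<in> {0..1}" "L1_continuous g"
  shows "continuous_on {0..1} (corr \<phi> u g)"
  unfolding continuous_on_iff
proof (intro ballI allI impI)
  fix r e :: real assume r: "r \<in> {0..1}" and e: "e > 0"
  obtain K where K: "K > 0" "\<And>x. \<bar>\<phi> x\<bar> \<le> K"
    using assms by (metis bounded_borelE)
  obtain \<delta> where \<delta>: "\<delta> > 0" "\<And>r q. r \<in> {0..1} \<Longrightarrow> q \<in> {0..1} \<Longrightarrow> \<bar>r - q\<bar> < \<delta> \<Longrightarrow>
      (\<integral>\<omega>. \<bar>g (\<omega> r) - g (\<omega> q)\<bar> \<partial>P) < e / K"
    using L1_continuousE[OF assms(4) divide_pos_pos[OF e K(1)]] by blast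
  show "\<exists>d>0. \<forall>q\<in>{0..1}. dist q r < d \<longrightarrow> dist (corr \<phi> u g q) (corr \<phi> u g r) < e"
  proof (intro exI[of _ \<delta>] conjI ballI impI)
    fix q :: real assume q: "q \<in> {0..1}" "dist q r < \<delta>"
    have "\<bar>corr \<phi> u g q - corr \<phi> u g r\<bar> \<le> K * (\<integral>\<omega>. \<bar>g (\<omega> q) - g (\<omega> r)\<bar> \<partial>P)"
      by (rule corr_diff_bound) (use assms r q K in auto)
    also have "\<dots> < K * (e / K)"
      using \<delta>(2)[of q r] q r K by (intro mult_strict_left_mono) (auto simp: dist_real_def)
    finally show "dist (corr \<phi> u g q) (corr \<phi> u g r) < e" using K by (simp add: dist_real_def)
  qed (use \<delta> in auto)
qed

lemma L1_norm_eq_corr: "(\<integral>\<omega>. \<bar>w (\<omega> t)\<bar> \<partial>P) = corr (\<lambda>x. sgn (w x)) t w t"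
  unfolding corr_def by (simp add: sgn_mult_abs abs_sgn mult.commute)

text \<open>The test function is the sign of \<open>T r g\<close> on the set where the bound fails.
  By the Markov property its correlation with \<open>T r g\<close> is one with \<open>g\<close>, so
  the excess over \<open>B\<close> on that set has integral at most 0. The statement is along the
  process at time \<open>t\<close>, whose law is not yet identified.\<close>

lemma T_AE_bound:
  assumes "bounded_borel g" "\<And>x. \<bar>g x\<bar> \<le> B" "0 \<le> t" "0 \<le> r" "t + r \<le> 1"
  shows "AE \<omega> in P. \<bar>T r g (\<omega> t)\<bar> \<le> B"
proof -
  define w where "w = T r g"
  have w: "bounded_borel w" unfolding w_def using assms by (intro bounded_borel_T) auto
  define \<phi> where "\<phi> x = (if \<bar>w x\<bar> > B then sgn (w x) else 0)" for x
  have [measurable]: "w \<in> borel_measurable borel" using w by auto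
  have \<phi>: "bounded_borel \<phi>"
    unfolding \<phi>_def by (rule bounded_borelI[of _ 1]) (auto simp: sgn_if)
  have "corr \<phi> t w t = corr \<phi> t g (t + r)"
    unfolding w_def using assms \<phi> by (intro corr_T) auto
  also have "\<dots> \<le> B * (\<integral>\<omega>. \<bar>\<phi> (\<omega> t)\<bar> \<partial>P)"
    using corr_bound[of \<phi> g t "t + r" B] assms \<phi> by auto
  finally have le: "(\<integral>\<omega>. \<phi> (\<omega> t) * w (\<omega> t) - B * \<bar>\<phi> (\<omega> t)\<bar> \<partial>P) \<le> 0"
    using integrable_at2[OF \<phi> w, of t t] integrable_at[OF bounded_borel_abs[OF \<phi>], of t] assms
    unfolding corr_def by (subst Bochner_Integration.integral_diff) auto
  have pos: "0 \<le> \<phi> (\<omega> t) * w (\<omega> t) - B * \<bar>\<phi> (\<omega> t)\<bar>" for \<omega>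
    unfolding \<phi>_def by (auto simp: sgn_if)
  have int: "integrable P (\<lambda>\<omega>. \<phi> (\<omega> t) * w (\<omega> t) - B * \<bar>\<phi> (\<omega> t)\<bar>)"
    using integrable_at2[OF \<phi> w, of t t] integrable_at[OF bounded_borel_abs[OF \<phi>], of t] assms by auto
  have "(\<integral>\<omega>. \<phi> (\<omega> t) * w (\<omega> t) - B * \<bar>\<phi> (\<omega> t)\<bar> \<partial>P) = 0"
    by (rule antisym[OF le], rule Bochner_Integration.integral_nonneg) (rule pos)
  then have "AE \<omega> in P. \<phi> (\<omega> t) * w (\<omega> t) - B * \<bar>\<phi> (\<omega> t)\<bar> = 0"
    using integral_nonneg_eq_0_iff_AE[OF int] pos by auto
  then show ?thesis
  proof (eventually_elim)
    case (elim \<omega>)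
    have "0 \<le> B" using assms(2)[of undefined] by linarith
    show ?case using elim \<open>0 \<le> B\<close> unfolding w_def[symmetric] \<phi>_def by (auto simp: sgn_if split: if_splits)
  qed
qed

text \<open>\<open>T r g\<close> need not be measurable in \<open>r\<close>, and before stationarity is known the laws at different
  times may have different null sets. Hence the average is a limit of Riemann sums whose error is
  summable uniformly in \<open>t\<close>: they converge almost surely along the process at every time.\<close>
lemma time_average:
  assumes g: "bounded_borel g" and B: "\<And>x. \<bar>g x\<bar> \<le> B" and cont: "L1_continuous g"
    and \<epsilon>: "0 < \<epsilon>" "\<epsilon> \<le> 1"
  obtains f where "bounded_borel f" "\<And>x. \<bar>f x\<bar> \<le> B"
    "\<And>\<phi> u t. bounded_borel \<phi> \<Longrightarrow> 0 \<le> u \<Longrightarrow> u \<le> t \<Longrightarrow> t + \<epsilon> \<le> 1 \<Longrightarrow>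
      corr \<phi> u f t = (1 / \<epsilon>) * integral {t..t+\<epsilon>} (corr \<phi> u g)"
proof -
  have B0: "0 \<le> B" using B[of undefined] by linarith
  have "\<exists>N::nat. N > 0 \<and> (\<forall>r\<in>{0..1}. \<forall>q\<in>{0..1}. \<bar>r - q\<bar> \<le> \<epsilon> / real N \<longrightarrow>
      (\<integral>\<omega>. \<bar>g (\<omega> r) - g (\<omega> q)\<bar> \<partial>P) \<le> (1/2)^j)" for j :: nat
  proof -
    obtain \<delta> where \<delta>: "\<delta> > 0" "\<And>r q. r \<in> {0..1} \<Longrightarrow> q \<in> {0..1} \<Longrightarrow> \<bar>r - q\<bar> < \<delta> \<Longrightarrow>
      (\<integral>\<omega>. \<bar>g (\<omega> r) - g (\<omega> q)\<bar> \<partial>P) < (1/2)^j"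
      using L1_continuousE[OF cont, of "(1/2)^j"] by auto
    obtain N :: nat where N: "N > 0" "\<epsilon> / \<delta> < real N"
      using reals_Archimedean2[of "\<epsilon> / \<delta>"] \<epsilon> \<delta>(1)
      by (metis divide_pos_pos of_nat_0_less_iff order_less_trans)
    then have "\<epsilon> / real N < \<delta>" using \<epsilon> \<delta>(1) by (simp add: field_simps)
    then show ?thesis using \<delta>(2) N by (intro exI[of _ N]) (auto simp: less_imp_le)
  qed
  then have "\<exists>N::nat \<Rightarrow> nat. \<forall>j. N j > 0 \<and> (\<forall>r\<in>{0..1}. \<forall>q\<in>{0..1}. \<bar>r - q\<bar> \<le> \<epsilon> / real (N j) \<longrightarrow>
      (\<integral>\<omega>. \<bar>g (\<omega> r) - g (\<omega> q)\<bar> \<partial>P) \<le> (1/2)^j)"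
    by (intro choice allI)
  then obtain N :: "nat \<Rightarrow> nat" where N: "\<And>j. N j > 0" and
    osc: "\<And>j r q. r \<in> {0..1} \<Longrightarrow> q \<in> {0..1} \<Longrightarrow> \<bar>r - q\<bar> \<le> \<epsilon> / real (N j) \<Longrightarrow>
      (\<integral>\<omega>. \<bar>g (\<omega> r) - g (\<omega> q)\<bar> \<partial>P) \<le> (1/2)^j"
    by blast
  \<comment> \<open>A Riemann sum for the average over \<open>[0, \<epsilon>]\<close>; its mesh is
    chosen so that, against any test function bounded by 1, the error is at most
    \<open>(1/2)^j\<close>.\<close>
  define F where "F j x = (1 / real (N j)) * (\<Sum>k<N j. T (real k * (\<epsilon> / real (N j))) g x)" for j x
  have node: "0 \<le> real k * (\<epsilon> / real (N j))" "real k * (\<epsilon> / real (N j)) \<le> \<epsilon>" if "k < N j" for k j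
  proof -
    show "0 \<le> real k * (\<epsilon> / real (N j))" using \<epsilon> by simp
    have "real k * (\<epsilon> / real (N j)) \<le> real (N j) * (\<epsilon> / real (N j))"
      using that \<epsilon> by (intro mult_right_mono) auto
    then show "real k * (\<epsilon> / real (N j)) \<le> \<epsilon>" using N[of j] by simp
  qed
  have bT: "bounded_borel (T (real k * (\<epsilon> / real (N j))) g)" if "k < N j" for k j
    using node[OF that] \<epsilon> g by (intro bounded_borel_T) auto
  have bF: "bounded_borel (F j)" for j
    unfolding F_def by (intro bounded_borel_cmult bounded_borel_sum bT) auto
  have err: "\<bar>corr \<phi> u (F j) t - (1 / \<epsilon>) * integral {t..t+\<epsilon>} (corr \<phi> u g)\<bar> \<le> (1/2)^j"
    if \<phi>: "bounded_borel \<phi>" "\<And>x. \<bar>\<phi> x\<bar> \<le> 1" and ut: "0 \<le> u" "u \<le> t" "t + \<epsilon> \<le> 1" for \<phi> u t j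
  proof -
    have "corr \<phi> u (F j) t = (1 / real (N j)) * (\<Sum>k<N j. corr \<phi> u (T (real k * (\<epsilon> / real (N j))) g) t)"
      unfolding F_def by (rule corr_sum) (use \<phi> ut \<epsilon> bT in auto)
    also have "\<dots> = (1 / real (N j)) * (\<Sum>k<N j. corr \<phi> u g (t + real k * (\<epsilon> / real (N j))))"
    proof (intro arg_cong2[where f = "(*)"] refl sum.cong)
      fix k assume "k \<in> {..<N j}"
      then show "corr \<phi> u (T (real k * (\<epsilon> / real (N j))) g) t = corr \<phi> u g (t + real k * (\<epsilon> / real (N j)))"
        using node[of k j] ut \<phi> g by (intro corr_T) auto
    qed
    also have "\<bar>\<dots> - (1 / \<epsilon>) * integral {t..t+\<epsilon>} (corr \<phi> u g)\<bar> \<le> (1/2)^j"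
    proof (rule riemann_sum_error)
      show "continuous_on {t..t+\<epsilon>} (corr \<phi> u g)"
        by (rule continuous_on_subset[OF corr_continuous]) (use \<phi> g cont ut \<epsilon> in auto)
      show "\<bar>corr \<phi> u g r - corr \<phi> u g q\<bar> \<le> (1/2)^j"
        if "r \<in> {t..t+\<epsilon>}" "q \<in> {t..t+\<epsilon>}" "\<bar>r - q\<bar> \<le> \<epsilon> / real (N j)" for r q
        using corr_diff_bound[of \<phi> g u r q 1] osc[of r q j] that \<phi> g ut \<epsilon> by auto
    qed (use \<epsilon> N in auto)
    finally show ?thesis .
  qed
  \<comment> \<open>\<open>lim\<close> is arbitrary where the sums diverge. Clipping makes the bound
    \<open>B\<close> hold everywhere, and almost surely along the process it changes
    nothing.\<close>
  define f where "f x = max (-B) (min B (lim (\<lambda>j. F j x)))" for x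
  have [measurable]: "F j \<in> borel_measurable borel" for j using bF by auto
  have bf: "bounded_borel f"
    unfolding f_def by (rule bounded_borelI[of _ B]) (use B0 in auto)
  have L1: "(\<integral>\<omega>. \<bar>F (Suc j) (\<omega> t) - F j (\<omega> t)\<bar> \<partial>P) \<le> 2 * (1/2)^j" if t: "0 \<le> t" "t + \<epsilon> \<le> 1" for t j
  proof -
    define w where "w x = F (Suc j) x - F j x" for x
    have w: "bounded_borel w" unfolding w_def by (intro bounded_borel_diff bF)
    \<comment> \<open>Taking the sign of the difference as test function, at the same time
      \<open>t\<close>, turns the uniform weak error into an error in the mean.\<close>
    let ?s = "\<lambda>x. sgn (w x)"
    have s: "bounded_borel ?s" "\<And>x. \<bar>?s x\<bar> \<le> 1" using bounded_borel_sgn[OF w] by (auto simp: sgn_if)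
    have "(\<integral>\<omega>. \<bar>F (Suc j) (\<omega> t) - F j (\<omega> t)\<bar> \<partial>P) = corr ?s t w t"
      using L1_norm_eq_corr[of w t] by (simp add: w_def)
    also have "\<dots> = corr ?s t (F (Suc j)) t - corr ?s t (F j) t"
      unfolding w_def using corr_cadd[OF s(1) bF[of "Suc j"] bF[of j], of t t 1 "-1"] t \<epsilon>
      by (simp add: w_def)
    also have "\<dots> \<le> (1/2)^Suc j + (1/2)^j"
      using err[OF s, of t t "Suc j"] err[OF s, of t t j] t by linarith
    also have "\<dots> \<le> 2 * (1/2)^j" by simp
    finally show ?thesis .
  qed
  have conv: "AE \<omega> in P. (\<lambda>j. F j (\<omega> t)) \<longlonglongrightarrow> f (\<omega> t) \<and> (\<forall>j. \<bar>F j (\<omega> t)\<bar> \<le> B)" if t: "0 \<le> t" "t + \<epsilon> \<le> 1" for t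
  proof -
    have "AE \<omega> in P. convergent (\<lambda>j. F j (\<omega> t))"
    proof (rule AE_convergent_of_L1_summable)
      show "integrable P (\<lambda>\<omega>. F (Suc j) (\<omega> t) - F j (\<omega> t))" for j
        using t \<epsilon> by (intro Bochner_Integration.integrable_diff integrable_at bF) auto
      show "(\<integral>\<omega>. \<bar>F (Suc j) (\<omega> t) - F j (\<omega> t)\<bar> \<partial>P) \<le> 2 * (1/2)^j" for j
        by (rule L1[OF t])
      show "summable (\<lambda>j. 2 * (1/2::real)^j)"
        by (intro summable_mult summable_geometric) auto
    qed
    moreover have "AE \<omega> in P. \<forall>j. \<forall>k\<in>{..<N j}. \<bar>T (real k * (\<epsilon> / real (N j))) g (\<omega> t)\<bar> \<le> B"
    proof (subst AE_all_countable, intro allI, subst AE_ball_countable, simp, intro ballI)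
      fix j k assume "k \<in> {..<N j}"
      then show "AE \<omega> in P. \<bar>T (real k * (\<epsilon> / real (N j))) g (\<omega> t)\<bar> \<le> B"
        using node[of k j] t by (intro T_AE_bound[OF g B]) auto
    qed
    ultimately show ?thesis
    proof eventually_elim
      case (elim \<omega>)
      have bd: "\<bar>F j (\<omega> t)\<bar> \<le> B" for j
      proof -
        have "\<bar>\<Sum>k<N j. T (real k * (\<epsilon> / real (N j))) g (\<omega> t)\<bar> \<le> (\<Sum>k<N j. B)"
          using elim(2) by (intro order_trans[OF sum_abs] sum_mono) auto
        then show ?thesis unfolding F_def using N[of j] by (simp add: abs_mult field_simps)
      qed
      have lim: "(\<lambda>j. F j (\<omega> t)) \<longlonglongrightarrow> lim (\<lambda>j. F j (\<omega> t))"
        using elim(1) by (simp add: convergent_LIMSEQ_iff)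
      have "lim (\<lambda>j. F j (\<omega> t)) \<le> B"
        by (rule LIMSEQ_le_const2[OF lim]) (use bd abs_le_D1 in blast)
      moreover have "-B \<le> lim (\<lambda>j. F j (\<omega> t))"
        by (rule LIMSEQ_le_const[OF lim]) (use bd in \<open>auto simp: abs_le_iff minus_le_iff\<close>)
      ultimately have "f (\<omega> t) = lim (\<lambda>j. F j (\<omega> t))" by (simp add: f_def)
      with lim bd show ?case by simp
    qed
  qed
  have main: "corr \<phi> u f t = (1 / \<epsilon>) * integral {t..t+\<epsilon>} (corr \<phi> u g)"
    if \<phi>: "bounded_borel \<phi>" "\<And>x. \<bar>\<phi> x\<bar> \<le> 1" and ut: "0 \<le> u" "u \<le> t" "t + \<epsilon> \<le> 1" for \<phi> u t
  proof (rule LIMSEQ_unique)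
    have t01: "t \<in> {0..1}" "u \<in> {0..1}" using ut \<epsilon> by auto
    show "(\<lambda>j. corr \<phi> u (F j) t) \<longlonglongrightarrow> corr \<phi> u f t"
      unfolding corr_def
    proof (rule integral_dominated_convergence[where w = "\<lambda>_. B"])
      show "AE \<omega> in P. (\<lambda>j. \<phi> (\<omega> u) * F j (\<omega> t)) \<longlonglongrightarrow> \<phi> (\<omega> u) * f (\<omega> t)"
        using conv[of t] ut by (auto elim!: eventually_mono intro!: tendsto_intros)
      show "AE \<omega> in P. norm (\<phi> (\<omega> u) * F j (\<omega> t)) \<le> B" for j
      proof -
        have "AE \<omega> in P. \<bar>F j (\<omega> t)\<bar> \<le> B"
          by (rule eventually_mono[OF conv[of t]]) (use ut in auto)
        then show ?thesis
        proof eventually_elim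
          case (elim \<omega>)
          have "\<bar>\<phi> (\<omega> u)\<bar> * \<bar>F j (\<omega> t)\<bar> \<le> 1 * B"
            using elim \<phi>(2) B0 by (intro mult_mono) auto
          then show ?case by (simp add: abs_mult)
        qed
      qed
    qed (use \<phi> bf t01 in \<open>auto intro!: borel_measurable_times bounded_borel_measurable_at bF\<close>)
    show "(\<lambda>j. corr \<phi> u (F j) t) \<longlonglongrightarrow> (1 / \<epsilon>) * integral {t..t+\<epsilon>} (corr \<phi> u g)"
    proof (rule LIM_zero_cancel, rule tendsto_rabs_zero_cancel, rule tendsto_sandwich[OF _ _ tendsto_const])
      show "\<forall>\<^sub>F j in sequentially. \<bar>corr \<phi> u (F j) t - (1 / \<epsilon>) * integral {t..t+\<epsilon>} (corr \<phi> u g)\<bar> \<le> (1/2)^j"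
        using err[OF \<phi> ut] by auto
      show "(\<lambda>j. (1/2::real)^j) \<longlonglongrightarrow> 0" by (rule LIMSEQ_power_zero) auto
    qed auto
  qed
  show thesis
  proof (rule that[OF bf])
    show "\<bar>f x\<bar> \<le> B" for x unfolding f_def using B0 by auto
    fix \<phi> :: "'a \<Rightarrow> real" and u t assume \<phi>: "bounded_borel \<phi>" and ut: "0 \<le> u" "u \<le> t" "t + \<epsilon> \<le> (1::real)"
    obtain K where K: "K > 0" "\<And>x. \<bar>\<phi> x\<bar> \<le> K" using \<phi> by (metis bounded_borelE)
    \<comment> \<open>The limit was identified for test functions bounded by 1; linearity extends it
      to all bounded ones.\<close>
    have scale: "corr (\<lambda>x. (1/K) * \<phi> x) u h s = (1/K) * corr \<phi> u h s" for h s
      unfolding corr_def by (simp add: mult.assoc)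
    have "corr (\<lambda>x. (1/K) * \<phi> x) u f t = (1 / \<epsilon>) * integral {t..t+\<epsilon>} (corr (\<lambda>x. (1/K) * \<phi> x) u g)"
      using K \<phi> ut by (intro main bounded_borel_cmult) (auto simp: abs_mult)
    moreover have "integral {t..t+\<epsilon>} (corr (\<lambda>x. (1/K) * \<phi> x) u g) = (1/K) * integral {t..t+\<epsilon>} (corr \<phi> u g)"
      unfolding scale[abs_def] by (rule integral_mult_right)
    ultimately show "corr \<phi> u f t = (1 / \<epsilon>) * integral {t..t+\<epsilon>} (corr \<phi> u g)"
      using K unfolding scale by (simp add: field_simps)
  qed
qed

end

text \<open>Closed sets form a generator stable under intersection, and the indicator of a nonempty
  closed set is the pointwise limit of truncated multiples of the distance to it, subtracted from
  1.\<close>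

lemma borel_measure_eqI_continuous:
  fixes Q R :: "'b::metric_space measure"
  assumes "prob_space Q" "prob_space R" "sets Q = sets borel" "sets R = sets borel"
    and eq: "\<And>g. continuous_on UNIV g \<Longrightarrow> (\<And>x. \<bar>g x\<bar> \<le> 1) \<Longrightarrow> (\<integral>x. g x \<partial>Q) = (\<integral>x. (g x :: real) \<partial>R)"
  shows "Q = R"
proof -
  interpret Q: prob_space Q by fact
  interpret R: prob_space R by fact
  have closed: "measure Q C = measure R C" if C: "closed C" for C
  \<comment> \<open>\<open>infdist\<close> to the empty set is 0 by convention, so the approximation
    below would converge to 1 there.\<close>
  proof (cases "C = {}")
    case False
    define g where "g n x = max 0 (1 - real n * infdist x C)" for n :: nat and x
    have cont: "continuous_on UNIV (g n)" for n
      unfolding g_def by (intro continuous_intros continuous_on_infdist)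
    have bd: "\<bar>g n x\<bar> \<le> 1" for n x
      unfolding g_def by (auto simp: infdist_nonneg)
    have lim: "(\<lambda>n. g n x) \<longlonglongrightarrow> indicator C x" for x
    proof (cases "x \<in> C")
      case True
      then show ?thesis by (simp add: g_def)
    next
      case nC: False
      then have pos: "infdist x C > 0" using infdist_pos_not_in_closed[OF C False] by simp
      then obtain n0 where n0: "1 / infdist x C < real n0" using reals_Archimedean2 by blast
      have "g n x = 0" if "n \<ge> n0" for n
      proof -
        have "1 / infdist x C < real n" using n0 that by linarith
        then show ?thesis using pos unfolding g_def by (simp add: field_simps)
      qed
      then show ?thesis using nC by (intro tendsto_eventually) (auto simp: eventually_sequentially)
    qed
    have conv: "(\<lambda>n. \<integral>x. g n x \<partial>S) \<longlonglongrightarrow> measure S C" if S: "prob_space S" "sets S = sets borel" for S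
    proof -
      interpret S: prob_space S by fact
      have ms: "borel_measurable S = borel_measurable borel" by (rule measurable_cong_sets) (auto simp: S)
      have CS: "C \<in> sets S" using C S by auto
      have "(\<lambda>n. \<integral>x. g n x \<partial>S) \<longlonglongrightarrow> (\<integral>x. indicator C x \<partial>S)"
        by (rule integral_dominated_convergence[where w = "\<lambda>_. 1"])
          (use bd lim cont C in \<open>auto simp: ms intro: borel_measurable_continuous_onI\<close>)
      then show ?thesis using CS by (simp add: S.emeasure_eq_measure)
    qed
    show ?thesis
      using conv[OF assms(1,3)] conv[OF assms(2,4)] eq[OF cont bd] by (simp add: LIMSEQ_unique)
  qed simp
  show ?thesis
  proof (rule measure_eqI_generator_eq[where E = "Collect closed" and \<Omega> = UNIV and A = "\<lambda>_. UNIV"])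
    show "sets Q = sigma_sets UNIV (Collect closed)" "sets R = sigma_sets UNIV (Collect closed)"
      using assms(3,4) by (simp_all add: borel_eq_closed)
    show "emeasure Q X = emeasure R X" if "X \<in> Collect closed" for X
      using closed that by (simp add: Q.emeasure_eq_measure R.emeasure_eq_measure)
  qed (auto simp: Int_stable_def Q.emeasure_eq_measure)
qed

section \<open>Membership in the domain and invariance of \<open>M\<close>\<close>

context diffusion begin

text \<open>Each path is uniformly continuous in time after composition with \<open>g\<close>. Along
  a sequence of pairs of times violating the claim the increments therefore tend to 0 pathwise, and
  dominated convergence contradicts the lower bound \<open>e\<close>. The sequence is what allows
  dominated convergence to yield uniformity in both times.\<close>

lemma L1_continuous_of_continuous:
  assumes g: "continuous_on UNIV g" "bounded_borel g"
  shows "L1_continuous g"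
  unfolding L1_continuous_def
proof (rule ccontr)
  assume "\<not> (\<forall>e>0. \<exists>\<delta>>0. \<forall>r\<in>{0..1}. \<forall>q\<in>{0..1}. \<bar>r - q\<bar> < \<delta> \<longrightarrow> (\<integral>\<omega>. \<bar>g (\<omega> r) - g (\<omega> q)\<bar> \<partial>P) < e)"
  then obtain e where e: "e > 0" and
    bad: "\<And>\<delta>. \<delta> > 0 \<Longrightarrow> \<exists>r\<in>{0..1}. \<exists>q\<in>{0..1}. \<bar>r - q\<bar> < \<delta> \<and> (\<integral>\<omega>. \<bar>g (\<omega> r) - g (\<omega> q)\<bar> \<partial>P) \<ge> e"
    by (meson not_le)
  have "\<forall>n::nat. \<exists>rq. fst rq \<in> {0..1} \<and> snd rq \<in> {0..1} \<and> \<bar>fst rq - snd rq\<bar> < 1 / real (Suc n)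
      \<and> (\<integral>\<omega>. \<bar>g (\<omega> (fst rq)) - g (\<omega> (snd rq))\<bar> \<partial>P) \<ge> e"
  proof
    fix n :: nat
    obtain r q where "r \<in> {0..1}" "q \<in> {0..1}" "\<bar>r - q\<bar> < 1 / real (Suc n)"
        "(\<integral>\<omega>. \<bar>g (\<omega> r) - g (\<omega> q)\<bar> \<partial>P) \<ge> e"
      using bad[of "1 / real (Suc n)"] by auto
    then show "\<exists>rq. fst rq \<in> {0..1} \<and> snd rq \<in> {0..1} \<and> \<bar>fst rq - snd rq\<bar> < 1 / real (Suc n)
      \<and> (\<integral>\<omega>. \<bar>g (\<omega> (fst rq)) - g (\<omega> (snd rq))\<bar> \<partial>P) \<ge> e"
      by (intro exI[of _ "(r, q)"]) simp
  qed
  from choice[OF this] obtain rq where rq: "\<And>n. fst (rq n) \<in> {0..1}" "\<And>n. snd (rq n) \<in> {0..1}"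
      "\<And>n. \<bar>fst (rq n) - snd (rq n)\<bar> < 1 / real (Suc n)"
      "\<And>n. (\<integral>\<omega>. \<bar>g (\<omega> (fst (rq n))) - g (\<omega> (snd (rq n)))\<bar> \<partial>P) \<ge> e"
    by blast
  obtain B where B: "B > 0" "\<And>x. \<bar>g x\<bar> \<le> B" using g bounded_borelE by metis
  have d0: "(\<lambda>n. dist (fst (rq n)) (snd (rq n))) \<longlonglongrightarrow> 0"
  proof (rule tendsto_sandwich[OF _ _ tendsto_const])
    show "\<forall>\<^sub>F n in sequentially. dist (fst (rq n)) (snd (rq n)) \<le> 1 / real (Suc n)"
      using rq(3) by (auto simp: dist_real_def less_imp_le)
    show "(\<lambda>n. 1 / real (Suc n)) \<longlonglongrightarrow> 0"
      using LIMSEQ_inverse_real_of_nat by (simp add: inverse_eq_divide)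
  qed auto
  have "(\<lambda>n. \<integral>\<omega>. \<bar>g (\<omega> (fst (rq n))) - g (\<omega> (snd (rq n)))\<bar> \<partial>P) \<longlonglongrightarrow> (\<integral>\<omega>. 0 \<partial>P)"
  proof (rule integral_dominated_convergence[where w = "\<lambda>_. 2 * B"])
    show "AE \<omega> in P. (\<lambda>n. \<bar>g (\<omega> (fst (rq n))) - g (\<omega> (snd (rq n)))\<bar>) \<longlonglongrightarrow> 0"
    proof (rule AE_I2)
      fix \<omega> assume "\<omega> \<in> space P"
      then have "continuous_on {0..1} \<omega>" by (auto simp: space_P path_space_def)
      then have "continuous_on {0..1} (\<lambda>t. g (\<omega> t))"
        by (intro continuous_on_compose2[OF g(1)]) auto
      then have "uniformly_continuous_on {0..1} (\<lambda>t. g (\<omega> t))"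
        by (intro compact_uniformly_continuous) auto
      then have "(\<lambda>n. dist (g (\<omega> (fst (rq n)))) (g (\<omega> (snd (rq n))))) \<longlonglongrightarrow> 0"
        unfolding uniformly_continuous_on_sequentially using rq(1,2) d0
        by (elim allE[of _ "\<lambda>n. fst (rq n)"] allE[of _ "\<lambda>n. snd (rq n)"] impE) auto
      then show "(\<lambda>n. \<bar>g (\<omega> (fst (rq n))) - g (\<omega> (snd (rq n)))\<bar>) \<longlonglongrightarrow> 0"
        by (simp add: dist_real_def)
    qed
    show "AE \<omega> in P. norm \<bar>g (\<omega> (fst (rq n))) - g (\<omega> (snd (rq n)))\<bar> \<le> 2 * B" for n
    proof (rule AE_I2)
      fix \<omega>
      show "norm \<bar>g (\<omega> (fst (rq n))) - g (\<omega> (snd (rq n)))\<bar> \<le> 2 * B"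
        using B(2)[of "\<omega> (fst (rq n))"] B(2)[of "\<omega> (snd (rq n))"] by simp
    qed
    show "(\<lambda>\<omega>. \<bar>g (\<omega> (fst (rq n))) - g (\<omega> (snd (rq n)))\<bar>) \<in> borel_measurable P" for n
      using rq(1,2) g by (intro borel_measurable_abs borel_measurable_diff bounded_borel_measurable_at) auto
  qed auto
  then have "e \<le> 0" using rq(4) by (intro LIMSEQ_le_const) auto
  with e show False by simp
qed

lemma D_L2: "f \<in> D \<Longrightarrow> f \<in> L2 M"
  using form[unfolded dirichlet_form_def, THEN conjunct1] by blast

lemma L2_bounded: "bounded_borel f \<Longrightarrow> f \<in> L2 M"
  unfolding L2_def using integrable_M[OF bounded_borel_power2] by auto

lemma D_iff: "f \<in> L2 M \<Longrightarrow> f \<in> D \<longleftrightarrow> (\<exists>C. \<forall>t\<in>{0<..1}. ((\<integral>x. (f x)^2 \<partial>M) - corr f 0 f t) / t \<le> C)"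
  using assoc unfolding associated_def corr_def by blast

lemma E_limit: "f \<in> D \<Longrightarrow> g \<in> D \<Longrightarrow>
    ((\<lambda>t. ((\<integral>x. f x * g x \<partial>M) - corr f 0 g t) / t) \<longlongrightarrow> E f g) (at_right 0)"
  using assoc unfolding associated_def corr_def by blast

lemma corr_start: "bounded_borel f \<Longrightarrow> bounded_borel g \<Longrightarrow> corr f 0 g 0 = (\<integral>x. f x * g x \<partial>M)"
  unfolding corr_def by (subst integral_M_eq_start) (auto intro: borel_measurable_times)

text \<open>Only small times matter: for \<open>t \<ge> \<delta>\<close> the quotient is at most
  \<open>2 * B^2 / \<delta>\<close>, because correlations of \<open>f\<close> with itself are
  bounded by \<open>B^2\<close>.\<close>

lemma D_I:
  assumes f: "bounded_borel f" and \<delta>: "0 < \<delta>"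
    and le: "\<And>t. 0 < t \<Longrightarrow> t < \<delta> \<Longrightarrow> t \<le> 1 \<Longrightarrow> corr f 0 f 0 - corr f 0 f t \<le> K * t"
  shows "f \<in> D"
proof -
  obtain B where B: "B > 0" "\<And>x. \<bar>f x\<bar> \<le> B" using f bounded_borelE by metis
  have bd: "\<bar>corr f 0 f t\<bar> \<le> B * B" if "t \<in> {0..1}" for t
  proof -
    have "\<bar>corr f 0 f t\<bar> \<le> B * (\<integral>\<omega>. \<bar>f (\<omega> 0)\<bar> \<partial>P)"
      by (rule corr_bound) (use f B that in auto)
    also have "(\<integral>\<omega>. \<bar>f (\<omega> 0)\<bar> \<partial>P) \<le> B"
      by (rule P.integral_le_const) (use f B integrable_at[OF bounded_borel_abs[OF f], of 0] in auto)
    finally show ?thesis using B by simp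
  qed
  have "(corr f 0 f 0 - corr f 0 f t) / t \<le> max K (2 * (B * B) / \<delta>)" if t: "t \<in> {0<..1}" for t
  proof (cases "t < \<delta>")
    case True
    then show ?thesis using le[of t] t by (simp add: field_simps le_max_iff_disj)
  next
    case False
    have "corr f 0 f 0 - corr f 0 f t \<le> 2 * (B * B)" using bd[of 0] bd[of t] t by auto
    then have "(corr f 0 f 0 - corr f 0 f t) / t \<le> 2 * (B * B) / t" using t by (simp add: divide_right_mono)
    also have "\<dots> \<le> 2 * (B * B) / \<delta>" using False \<delta> B by (intro divide_left_mono) auto
    finally show ?thesis by simp
  qed
  then show ?thesis
    unfolding D_iff[OF L2_bounded[OF f]] corr_start[OF f f] power2_eq_square by blast
qed

text \<open>Shifting a window by \<open>h\<close> exchanges a piece of length \<open>h\<close> at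
  one end for a piece of length \<open>h\<close> at the other; the rest cancels. This is why time
  averages vary linearly in time even when \<open>c\<close> itself does not.\<close>

lemma shifted_window_bound:
  fixes c :: "real \<Rightarrow> real"
  assumes "continuous_on {0..1} c" "0 \<le> a" "0 \<le> h" "0 \<le> \<epsilon>" "a + h + \<epsilon> \<le> 1" "\<And>r. r \<in> {0..1} \<Longrightarrow> \<bar>c r\<bar> \<le> K"
  shows "integral {a+h..a+h+\<epsilon>} c - integral {a..a+\<epsilon>} c = integral {a+\<epsilon>..a+\<epsilon>+h} c - integral {a..a+h} c" (is ?eq)
    and "\<bar>integral {a+h..a+h+\<epsilon>} c - integral {a..a+\<epsilon>} c\<bar> \<le> 2 * h * K" (is ?le)
proof -
  have int: "c integrable_on {x..y}" if "0 \<le> x" "y \<le> 1" for x y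
    by (rule integrable_continuous_real, rule continuous_on_subset[OF assms(1)]) (use that in auto)
  have 1: "integral {a..a+h} c + integral {a+h..a+h+\<epsilon>} c = integral {a..a+h+\<epsilon>} c"
    by (rule Henstock_Kurzweil_Integration.integral_combine) (use assms int in auto)
  have 2: "integral {a..a+\<epsilon>} c + integral {a+\<epsilon>..a+\<epsilon>+h} c = integral {a..a+\<epsilon>+h} c"
    by (rule Henstock_Kurzweil_Integration.integral_combine) (use assms int in auto)
  have comm: "a + h + \<epsilon> = a + \<epsilon> + h" by simp
  show eq: ?eq using 1 2 unfolding comm by linarith
  have b: "\<bar>integral {x..x+h} c\<bar> \<le> h * K" if "0 \<le> x" "x + h \<le> 1" for x
  proof -
    have "norm (integral (cbox x (x+h)) c) \<le> K * measure lborel (cbox x (x+h))"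
    proof (rule integrable_bound)
      show "0 \<le> K" using assms(6)[of 0] by simp
    qed (use that assms int in auto)
    then show ?thesis using assms(3) by (simp add: mult.commute)
  qed
  show ?le unfolding eq using b[of a] b[of "a+\<epsilon>"] assms by (simp add: algebra_simps)
qed

lemma one_in_D: "(\<lambda>_. 1) \<in> D"
  by (rule D_I[where \<delta> = 1 and K = 0]) (auto simp: corr_def P.prob_space M.prob_space)

lemma E_one: "f \<in> D \<Longrightarrow> E (\<lambda>_. 1) f = 0"
  \<comment> \<open>With the constant -1 the product in \<open>strongly_local\<close> vanishes
    identically.\<close>
  using local[unfolded strongly_local_def, rule_format, OF one_in_D, of f "-1"] by simp

lemma right_difference_quotient:
  fixes c :: "real \<Rightarrow> real"
  assumes "continuous_on {0..1} c" "0 \<le> a" "a < 1"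
  shows "((\<lambda>h. integral {a..a+h} c / h) \<longlongrightarrow> c a) (at_right 0)"
proof -
  have "((\<lambda>u. integral {0..u} c) has_real_derivative c a) (at a within {0..1})"
    by (rule integral_has_real_derivative) (use assms in auto)
  then have "((\<lambda>u. integral {0..u} c) has_real_derivative c a) (at a within {a..1})"
    by (rule DERIV_subset) (use assms in auto)
  then have "((\<lambda>y. (integral {0..y} c - integral {0..a} c) / (y - a)) \<longlongrightarrow> c a) (at a within {a..1})"
    unfolding has_field_derivative_iff .
  moreover have "filterlim (\<lambda>h. a + h) (at a within {a..1}) (at_right 0)"
    unfolding filterlim_at
  proof
    show "\<forall>\<^sub>F h in at_right 0. a + h \<in> {a..1} \<and> a + h \<noteq> a"
      using assms unfolding eventually_at_right_field by (intro exI[of _ "1 - a"]) auto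
    have "((\<lambda>h. a + h) \<longlongrightarrow> a + 0) (at_right 0)" by (intro tendsto_intros)
    then show "((\<lambda>h. a + h) \<longlongrightarrow> a) (at_right 0)" by simp
  qed
  ultimately have "((\<lambda>h. (integral {0..a+h} c - integral {0..a} c) / (a + h - a)) \<longlongrightarrow> c a) (at_right 0)"
    by (rule filterlim_compose)
  then show ?thesis
  proof (rule Lim_transform_eventually)
    have "(integral {0..a+h} c - integral {0..a} c) / (a + h - a) = integral {a..a+h} c / h"
      if "0 < h" "h < 1 - a" for h
    proof -
      have "integral {0..a} c + integral {a..a+h} c = integral {0..a+h} c"
        by (rule Henstock_Kurzweil_Integration.integral_combine, insert assms that, simp_all)
          (auto intro!: integrable_continuous_real intro: continuous_on_subset)
      then show ?thesis by (simp add: algebra_simps)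
    qed
    then show "\<forall>\<^sub>F h in at_right 0. (integral {0..a+h} c - integral {0..a} c) / (a + h - a) = integral {a..a+h} c / h"
      using assms unfolding eventually_at_right_field by (intro exI[of _ "1 - a"]) auto
  qed
qed

text \<open>The window of the average moves with time, so by \<open>shifted_window_bound\<close> its
  correlation with itself loses at most a multiple of \<open>h\<close>. The offset \<open>r\<close>
  covers both the average itself and its image under \<open>T r\<close>.\<close>

lemma average_in_D:
  assumes g: "bounded_borel g" "\<And>x. \<bar>g x\<bar> \<le> B" "L1_continuous g" and \<epsilon>: "0 < \<epsilon>"
    and w: "bounded_borel w" and r: "0 \<le> r" "r + \<epsilon> < 1"
    and corr_w: "\<And>\<phi> h. bounded_borel \<phi> \<Longrightarrow> 0 \<le> h \<Longrightarrow> r + h + \<epsilon> \<le> 1 \<Longrightarrow>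
      corr \<phi> 0 w h = (1 / \<epsilon>) * integral {r+h..r+h+\<epsilon>} (corr \<phi> 0 g)"
  shows "w \<in> D"
proof (rule D_I[OF w])
  show "0 < 1 - r - \<epsilon>" using r by simp
  fix h :: real assume h: "0 < h" "h < 1 - r - \<epsilon>"
  let ?K = "B * (\<integral>\<omega>. \<bar>w (\<omega> 0)\<bar> \<partial>P)"
  have "corr w 0 w 0 - corr w 0 w h = (1 / \<epsilon>) * (integral {r..r+\<epsilon>} (corr w 0 g) - integral {r+h..r+h+\<epsilon>} (corr w 0 g))"
    using corr_w[OF w, of 0] corr_w[OF w, of h] h r by (simp add: right_diff_distrib)
  also have "\<dots> \<le> (1 / \<epsilon>) * (2 * h * ?K)"
  proof (rule mult_left_mono)
    have "\<bar>integral {r+h..r+h+\<epsilon>} (corr w 0 g) - integral {r..r+\<epsilon>} (corr w 0 g)\<bar> \<le> 2 * h * ?K"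
      by (rule shifted_window_bound(2)) (use w g h r \<epsilon> in \<open>auto intro!: corr_continuous corr_bound\<close>)
    then show "integral {r..r+\<epsilon>} (corr w 0 g) - integral {r+h..r+h+\<epsilon>} (corr w 0 g) \<le> 2 * h * ?K" by simp
  qed (use \<epsilon> in auto)
  finally show "corr w 0 w 0 - corr w 0 w h \<le> ((1 / \<epsilon>) * 2 * ?K) * h" by (simp add: algebra_simps)
qed

text \<open>Let \<open>c t\<close> be the expectation of \<open>g\<close> at time \<open>t\<close>
  and \<open>f\<close> the time average of \<open>g\<close> over a window of length
  \<open>\<epsilon>\<close>. The limit defining \<open>E (\<lambda>_. 1) f\<close> evaluates to
  \<open>(c 0 - c \<epsilon>) / \<epsilon>\<close>, whereas \<open>E_one\<close> gives 0. Hence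
  \<open>c\<close> is constant, although the form only involves the process started at time
  0.\<close>

lemma expectation_continuous_stationary:
  assumes g: "continuous_on UNIV g" "bounded_borel g" and t: "t \<in> {0..1}"
  shows "(\<integral>\<omega>. g (\<omega> t) \<partial>P) = (\<integral>x. g x \<partial>M)"
proof -
  let ?c = "corr (\<lambda>_. 1) 0 g"
  have L1: "L1_continuous g" by (rule L1_continuous_of_continuous[OF g])
  have cont: "continuous_on {0..1} ?c" by (rule corr_continuous) (use g L1 in auto)
  obtain B where B: "B > 0" "\<And>x. \<bar>g x\<bar> \<le> B" using g bounded_borelE by metis
  have inner: "?c \<epsilon> = ?c 0" if \<epsilon>: "0 < \<epsilon>" "\<epsilon> < 1" for \<epsilon>
  proof -
    obtain f where f: "bounded_borel f" "\<And>\<phi> u t. bounded_borel \<phi> \<Longrightarrow> 0 \<le> u \<Longrightarrow> u \<le> t \<Longrightarrow> t + \<epsilon> \<le> 1 \<Longrightarrow>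
      corr \<phi> u f t = (1 / \<epsilon>) * integral {t..t+\<epsilon>} (corr \<phi> u g)"
      using time_average[OF g(2) B(2) L1, of \<epsilon>] \<epsilon> by (metis less_imp_le)
    have fD: "f \<in> D"
      by (rule average_in_D[OF g(2) B(2) L1 \<epsilon>(1) f(1), of 0]) (use \<epsilon> f(2)[of _ 0] in auto)
    have "((\<lambda>t. ((\<integral>x. 1 * f x \<partial>M) - corr (\<lambda>_. 1) 0 f t) / t) \<longlongrightarrow> 0) (at_right 0)"
      using E_limit[OF one_in_D fD] E_one[OF fD] by simp
    moreover have "((\<lambda>t. ((\<integral>x. 1 * f x \<partial>M) - corr (\<lambda>_. 1) 0 f t) / t) \<longlongrightarrow> (1/\<epsilon>) * (?c 0 - ?c \<epsilon>)) (at_right 0)"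
    proof (rule Lim_transform_eventually)
      show "((\<lambda>h. (1/\<epsilon>) * (integral {0..0+h} ?c / h - integral {\<epsilon>..\<epsilon>+h} ?c / h)) \<longlongrightarrow> (1/\<epsilon>) * (?c 0 - ?c \<epsilon>)) (at_right 0)"
        by (intro tendsto_intros right_difference_quotient cont) (use \<epsilon> in auto)
      have "(1/\<epsilon>) * (integral {0..0+h} ?c / h - integral {\<epsilon>..\<epsilon>+h} ?c / h) = ((\<integral>x. 1 * f x \<partial>M) - corr (\<lambda>_. 1) 0 f h) / h"
        if h: "0 < h" "h < 1 - \<epsilon>" for h
      proof -
        have "(\<integral>x. 1 * f x \<partial>M) - corr (\<lambda>_. 1) 0 f h = - (1/\<epsilon>) * (integral {0+h..0+h+\<epsilon>} ?c - integral {0..0+\<epsilon>} ?c)"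
          using f(2)[of "\<lambda>_. 1" 0 0] f(2)[of "\<lambda>_. 1" 0 h] corr_start[of "\<lambda>_. 1" f] f(1) h \<epsilon>
          by (simp add: right_diff_distrib)
        also have "integral {0+h..0+h+\<epsilon>} ?c - integral {0..0+\<epsilon>} ?c = integral {0+\<epsilon>..0+\<epsilon>+h} ?c - integral {0..0+h} ?c"
          by (rule shifted_window_bound(1)[where K = "B * (\<integral>\<omega>. \<bar>1\<bar> \<partial>P)"])
            (use g B h \<epsilon> cont in \<open>auto intro!: corr_bound[of "\<lambda>_. 1" g, simplified]\<close>)
        finally have *: "(\<integral>x. 1 * f x \<partial>M) - corr (\<lambda>_. 1) 0 f h
            = - (1/\<epsilon>) * (integral {0+\<epsilon>..0+\<epsilon>+h} ?c - integral {0..0+h} ?c)" .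
        show ?thesis unfolding * using h \<epsilon> by (simp add: divide_simps)
      qed
      then show "\<forall>\<^sub>F h in at_right 0. (1/\<epsilon>) * (integral {0..0+h} ?c / h - integral {\<epsilon>..\<epsilon>+h} ?c / h) = ((\<integral>x. 1 * f x \<partial>M) - corr (\<lambda>_. 1) 0 f h) / h"
        using \<epsilon> unfolding eventually_at_right_field by (intro exI[of _ "1 - \<epsilon>"]) auto
    qed
    ultimately have "(1/\<epsilon>) * (?c 0 - ?c \<epsilon>) = 0"
      by (intro tendsto_unique[of "at_right (0::real)"]) auto
    then show ?thesis using \<epsilon> by simp
  qed
  \<comment> \<open>The window argument needs a length strictly between 0 and 1; the endpoint 1 is
    reached by continuity of \<open>?c\<close>.\<close>
  have "?c t = ?c 0"
  proof (rule continuous_constant_on_closure[where S = "{0<..<1}" and f = ?c])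
    show "continuous_on (closure {0<..<1}) ?c" using cont by simp
    show "t \<in> closure {0<..<1}" using t by simp
  qed (use inner in auto)
  then show ?thesis
    using corr_start[of "\<lambda>_. 1" g] g unfolding corr_def by simp
qed

lemma stationary:
  assumes t: "t \<in> {0..1}"
  shows "distr P borel (\<lambda>\<omega>. \<omega> t) = M"
proof (rule borel_measure_eqI_continuous)
  show "prob_space (distr P borel (\<lambda>\<omega>. \<omega> t))"
    by (rule P.prob_space_distr) (use t in auto)
  fix g :: "'a \<Rightarrow> real" assume g: "continuous_on UNIV g" "\<And>x. \<bar>g x\<bar> \<le> 1"
  then have bg: "bounded_borel g" by (intro bounded_borelI[of _ 1] borel_measurable_continuous_onI) auto
  show "(\<integral>x. g x \<partial>distr P borel (\<lambda>\<omega>. \<omega> t)) = (\<integral>x. g x \<partial>M)"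
    using expectation_continuous_stationary[OF g(1) bg t] t bg
    by (subst Bochner_Integration.integral_distr) auto
qed (auto simp: sets_M prob_M)

lemma expectation_at:
  fixes f :: "'a \<Rightarrow> real"
  assumes "f \<in> borel_measurable borel" "t \<in> {0..1}"
  shows "(\<integral>\<omega>. f (\<omega> t) \<partial>P) = (\<integral>x. f x \<partial>M)"
  using Bochner_Integration.integral_distr[of "\<lambda>\<omega>. \<omega> t" P borel f] X_measurable[of t] assms
  by (simp add: stationary)

lemma integrable_at_iff:
  fixes f :: "'a \<Rightarrow> real"
  assumes "f \<in> borel_measurable borel" "t \<in> {0..1}"
  shows "integrable P (\<lambda>\<omega>. f (\<omega> t)) \<longleftrightarrow> integrable M f"
  using integrable_distr_eq[of "\<lambda>\<omega>. \<omega> t" P borel f] X_measurable[of t] assms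
  by (simp add: stationary)

end

section \<open>Calculus for the Dirichlet form\<close>

lemma sum_slices:
  fixes y \<delta> :: real
  assumes "0 \<le> y" "0 \<le> \<delta>"
  shows "(\<Sum>k<n. min \<delta> (max 0 (y - real k * \<delta>))) = min (real n * \<delta>) y"
proof (induction n)
  case (Suc n)
  have "real (Suc n) * \<delta> = real n * \<delta> + \<delta>" by (simp add: algebra_simps)
  then show ?case using Suc assms by (auto simp: min_def max_def)
qed (use assms in auto)

text \<open>Write \<open>y^2 = S + R\<close> with diagonal part \<open>S\<close> and off-diagonal
  part \<open>R\<close>. As all \<open>a k\<close> have one sign, their absolute values add up to
  \<open>\<bar>y\<bar>\<close>, so \<open>S \<le> \<delta> * K\<close> and \<open>R \<ge> 0\<close>;
  then \<open>y^4 = y^2 * S + y^2 * R\<close>. The first part is small for thin slices, the second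
  will vanish by orthogonality.\<close>

lemma quartic_slice_bound:
  fixes a :: "nat \<Rightarrow> real"
  assumes sgn: "(\<forall>k<N. 0 \<le> a k) \<or> (\<forall>k<N. a k \<le> 0)" and le: "\<And>k. k < N \<Longrightarrow> \<bar>a k\<bar> \<le> \<delta>"
    and y: "y = (\<Sum>k<N. a k)" "\<bar>y\<bar> \<le> K" and "0 \<le> \<delta>"
  shows "y^4 \<le> K * \<delta> * y\<^sup>2 + K\<^sup>2 * (\<Sum>k<N. \<Sum>l\<in>{..<N} - {k}. a k * a l)"
proof -
  define R where "R = (\<Sum>k<N. \<Sum>l\<in>{..<N} - {k}. a k * a l)"
  define S where "S = (\<Sum>k<N. (a k)\<^sup>2)"
  have abs_y: "\<bar>y\<bar> = (\<Sum>k<N. \<bar>a k\<bar>)"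
    using sgn
  proof
    assume "\<forall>k<N. 0 \<le> a k"
    then have "0 \<le> (\<Sum>k<N. a k)" "(\<Sum>k<N. \<bar>a k\<bar>) = (\<Sum>k<N. a k)"
      by (auto intro!: sum_nonneg sum.cong)
    then show ?thesis unfolding y by simp
  next
    assume neg: "\<forall>k<N. a k \<le> 0"
    then have "(\<Sum>k<N. a k) \<le> 0" by (intro sum_nonpos) auto
    then show ?thesis unfolding y using neg by (simp add: sum_negf[symmetric])
  qed
  have "y\<^sup>2 = (\<Sum>k<N. \<Sum>l<N. a k * a l)"
    unfolding y power2_eq_square by (rule sum_product)
  also have "\<dots> = (\<Sum>k<N. (a k)\<^sup>2 + (\<Sum>l\<in>{..<N} - {k}. a k * a l))"
    by (intro sum.cong refl, subst sum.remove[of "{..<N}"]) (auto simp: power2_eq_square)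
  finally have y2: "y\<^sup>2 = S + R" unfolding S_def R_def by (simp add: sum.distrib)
  have "S \<le> (\<Sum>k<N. \<delta> * \<bar>a k\<bar>)"
    unfolding S_def
  proof (rule sum_mono)
    fix k assume "k \<in> {..<N}"
    then have "\<bar>a k\<bar> * \<bar>a k\<bar> \<le> \<delta> * \<bar>a k\<bar>" using le by (intro mult_right_mono) auto
    then show "(a k)\<^sup>2 \<le> \<delta> * \<bar>a k\<bar>" by (simp add: power2_eq_square)
  qed
  also have "\<dots> = \<delta> * \<bar>y\<bar>" by (simp add: abs_y sum_distrib_left)
  also have "\<dots> \<le> \<delta> * K" using y(2) \<open>0 \<le> \<delta>\<close> by (rule mult_left_mono)
  finally have S: "S \<le> \<delta> * K" .
  have R: "0 \<le> R" unfolding R_def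
    using sgn by (intro sum_nonneg) (auto simp: mult_nonneg_nonneg mult_nonpos_nonpos)
  have K: "y\<^sup>2 \<le> K\<^sup>2" using y(2) by (simp add: abs_le_square_iff[symmetric])
  have "y^4 = y\<^sup>2 * S + y\<^sup>2 * R" by (simp add: y2[symmetric] distrib_left[symmetric] power_add[symmetric])
  also have "\<dots> \<le> y\<^sup>2 * (\<delta> * K) + K\<^sup>2 * R"
    using S R K by (intro add_mono mult_left_mono mult_right_mono) auto
  finally show ?thesis unfolding R_def by (simp add: algebra_simps)
qed

text \<open>The odd Taylor terms of the two exponentials cancel. The coefficient 1/2 of the square
  has to be exact, because it determines the rate; the quartic constant may be crude, since quartic
  increments will be negligible.\<close>

lemma cosh_quartic_bound:
  fixes x R :: real
  assumes "\<bar>x\<bar> \<le> R"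
  shows "(exp x + exp (-x)) / 2 - 1 \<le> x\<^sup>2 / 2 + exp R * x^4"
proof -
  have *: "exp z \<le> 1 + z + z\<^sup>2 / 2 + z^3 / 6 + exp R * z^4" if z: "\<bar>z\<bar> \<le> R" for z :: real
  proof -
    obtain t where t: "\<bar>t\<bar> \<le> \<bar>z\<bar>" "exp z = (\<Sum>m<4. (z ^ m) / fact m) + (exp t / fact 4) * z ^ 4"
      using Maclaurin_exp_le by blast
    have "(exp t / fact 4) * z ^ 4 \<le> exp R * z^4"
    proof (rule mult_right_mono)
      have "exp t / fact 4 \<le> exp t" by (simp add: fact_numeral)
      also have "\<dots> \<le> exp R" using t z by auto
      finally show "exp t / fact 4 \<le> exp R" .
    qed auto
    then show ?thesis using t by (simp add: eval_nat_numeral field_simps)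
  qed
  show ?thesis using *[of x] *[of "-x"] assms by (simp add: field_simps)
qed

section \<open>Mean-square increments and the bounded part of the domain\<close>

context diffusion begin

text \<open>By stationarity this is twice the inner product minus the two correlations, so
  \<open>inc f g t / t\<close> tends to \<open>2 * E f g\<close>. Unlike correlations it consists of
  products of increments, and pointwise inequalities between increments pass directly to the
  form.\<close>

definition inc :: "('a \<Rightarrow> real) \<Rightarrow> ('a \<Rightarrow> real) \<Rightarrow> real \<Rightarrow> real" where
  "inc f g t = (\<integral>\<omega>. (f (\<omega> t) - f (\<omega> 0)) * (g (\<omega> t) - g (\<omega> 0)) \<partial>P)"

lemma L2_measurable: "f \<in> L2 M \<Longrightarrow> f \<in> borel_measurable borel"
  by (simp add: L2_def)

lemma integrable_L2_at2:
  assumes f: "f \<in> L2 M" and g: "g \<in> L2 M" and st: "s \<in> {0..1}" "t \<in> {0..1}"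
  shows "integrable P (\<lambda>\<omega>. f (\<omega> s) * g (\<omega> t))"
proof (rule Bochner_Integration.integrable_bound)
  have sq: "integrable P (\<lambda>\<omega>. (h (\<omega> r))\<^sup>2)" if "h \<in> L2 M" "r \<in> {0..1}" for h r
  proof -
    have "integrable M (\<lambda>x. (h x)\<^sup>2)" "h \<in> borel_measurable borel" using that by (simp_all add: L2_def)
    then show ?thesis using integrable_at_iff[of "\<lambda>x. (h x)\<^sup>2" r] that(2) by simp
  qed
  show "integrable P (\<lambda>\<omega>. (f (\<omega> s))\<^sup>2 + (g (\<omega> t))\<^sup>2)"
    by (intro Bochner_Integration.integrable_add sq f g st)
  show "(\<lambda>\<omega>. f (\<omega> s) * g (\<omega> t)) \<in> borel_measurable P"
    using assms by (intro borel_measurable_times measurable_at L2_measurable) auto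
  show "AE \<omega> in P. norm (f (\<omega> s) * g (\<omega> t)) \<le> norm ((f (\<omega> s))\<^sup>2 + (g (\<omega> t))\<^sup>2)"
  proof (rule AE_I2)
    fix \<omega>
    have "2 * (\<bar>f (\<omega> s)\<bar> * \<bar>g (\<omega> t)\<bar>) \<le> (f (\<omega> s))\<^sup>2 + (g (\<omega> t))\<^sup>2"
      using sum_squares_bound[of "\<bar>f (\<omega> s)\<bar>" "\<bar>g (\<omega> t)\<bar>"] by simp
    moreover have "0 \<le> \<bar>f (\<omega> s)\<bar> * \<bar>g (\<omega> t)\<bar>" by simp
    ultimately show "norm (f (\<omega> s) * g (\<omega> t)) \<le> norm ((f (\<omega> s))\<^sup>2 + (g (\<omega> t))\<^sup>2)"
      unfolding real_norm_def abs_mult by linarith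
  qed
qed

lemma integrable_inc:
  assumes "f \<in> L2 M" "g \<in> L2 M" "t \<in> {0..1}"
  shows "integrable P (\<lambda>\<omega>. (f (\<omega> t) - f (\<omega> 0)) * (g (\<omega> t) - g (\<omega> 0)))"
  using assms integrable_L2_at2
  by (auto simp: algebra_simps intro!: Bochner_Integration.integrable_add Bochner_Integration.integrable_diff)

lemma inc_eq:
  assumes f: "f \<in> L2 M" and g: "g \<in> L2 M" and t: "t \<in> {0..1}"
  shows "inc f g t = 2 * (\<integral>x. f x * g x \<partial>M) - corr f 0 g t - corr g 0 f t"
proof -
  have t0: "(0::real) \<in> {0..1}" by simp
  have "inc f g t = (\<integral>\<omega>. f (\<omega> t) * g (\<omega> t) + f (\<omega> 0) * g (\<omega> 0) - f (\<omega> 0) * g (\<omega> t) - g (\<omega> 0) * f (\<omega> t) \<partial>P)"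
    unfolding inc_def by (simp add: algebra_simps)
  also have "\<dots> = (\<integral>\<omega>. f (\<omega> t) * g (\<omega> t) \<partial>P) + (\<integral>\<omega>. f (\<omega> 0) * g (\<omega> 0) \<partial>P) - corr f 0 g t - corr g 0 f t"
    unfolding corr_def
    by (simp add: integrable_L2_at2[OF f g t t] integrable_L2_at2[OF f g t0 t0]
        integrable_L2_at2[OF f g t0 t] integrable_L2_at2[OF g f t0 t])
  also have "\<dots> = 2 * (\<integral>x. f x * g x \<partial>M) - corr f 0 g t - corr g 0 f t"
    using expectation_at[of "\<lambda>x. f x * g x" t] expectation_at[of "\<lambda>x. f x * g x" 0] f g t
    by (simp add: L2_measurable borel_measurable_times)
  finally show ?thesis .
qed

text \<open>The quotient defining the domain is half of \<open>inc f f t / t\<close>. Functions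
  whose increments are dominated by those of domain elements are therefore again in the domain,
  which is how products, exponentials and slices are treated.\<close>

lemma D_iff_inc:
  assumes f: "f \<in> L2 M"
  shows "f \<in> D \<longleftrightarrow> (\<exists>C. \<forall>t\<in>{0<..1}. inc f f t \<le> C * t)"
proof -
  have *: "((\<integral>x. (f x)^2 \<partial>M) - corr f 0 f t) / t \<le> C \<longleftrightarrow> inc f f t \<le> (2 * C) * t" if "t \<in> {0<..1}" for t C
    using that inc_eq[OF f f, of t] by (simp add: power2_eq_square field_simps) linarith
  show ?thesis
  proof
    assume "f \<in> D"
    then show "\<exists>C. \<forall>t\<in>{0<..1}. inc f f t \<le> C * t" using * D_iff[OF f] by auto
  next
    assume "\<exists>C. \<forall>t\<in>{0<..1}. inc f f t \<le> C * t"
    then obtain C where "\<forall>t\<in>{0<..1}. inc f f t \<le> (2 * (C / 2)) * t" by auto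
    then show "f \<in> D" unfolding D_iff[OF f] using * by blast
  qed
qed

lemma E_sym: "f \<in> D \<Longrightarrow> g \<in> D \<Longrightarrow> E f g = E g f"
  using form unfolding dirichlet_form_def by meson

lemma inc_limit:
  assumes f: "f \<in> D" and g: "g \<in> D"
  shows "((\<lambda>t. inc f g t / t) \<longlongrightarrow> 2 * E f g) (at_right 0)"
proof -
  have "((\<lambda>t. ((\<integral>x. f x * g x \<partial>M) - corr f 0 g t) / t + ((\<integral>x. g x * f x \<partial>M) - corr g 0 f t) / t)
      \<longlongrightarrow> E f g + E g f) (at_right 0)"
    by (intro tendsto_add E_limit f g)
  moreover have "((\<integral>x. f x * g x \<partial>M) - corr f 0 g t) / t + ((\<integral>x. g x * f x \<partial>M) - corr g 0 f t) / t = inc f g t / t"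
    if "0 < t" "t < 1" for t
    using inc_eq[OF f[THEN D_L2] g[THEN D_L2], of t] that
    by (simp add: add_divide_distrib[symmetric] mult.commute[of "g _"])
  then have "\<forall>\<^sub>F t in at_right 0. ((\<integral>x. f x * g x \<partial>M) - corr f 0 g t) / t
      + ((\<integral>x. g x * f x \<partial>M) - corr g 0 f t) / t = inc f g t / t"
    unfolding eventually_at_right_field by (intro exI[of _ 1]) auto
  ultimately show ?thesis
    using E_sym[OF f g] Lim_transform_eventually by fastforce
qed

lemma Db_iff: "f \<in> Db D \<longleftrightarrow> f \<in> D \<and> bounded_borel f"
  using D_L2 L2_measurable unfolding Db_def bounded_borel_def by blast

lemma Db_lipschitz2:
  assumes f: "f \<in> Db D" and h: "h \<in> Db D" and g: "bounded_borel g"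
    and lip: "\<And>x y. \<bar>g x - g y\<bar> \<le> K * (\<bar>f x - f y\<bar> + \<bar>h x - h y\<bar>)"
  shows "g \<in> Db D"
proof -
  obtain C1 where C1: "\<forall>t\<in>{0<..1}. inc f f t \<le> C1 * t" using f by (metis Db_iff D_L2 D_iff_inc)
  obtain C2 where C2: "\<forall>t\<in>{0<..1}. inc h h t \<le> C2 * t" using h by (metis Db_iff D_L2 D_iff_inc)
  have L2: "f \<in> L2 M" "h \<in> L2 M" "g \<in> L2 M" using f g h by (auto simp: Db_iff L2_bounded)
  have "inc g g t \<le> (2 * K\<^sup>2 * (C1 + C2)) * t" if t: "t \<in> {0<..1}" for t
  proof -
    have t01: "t \<in> {0..1}" using t by auto
    have "inc g g t \<le> (\<integral>\<omega>. 2 * K\<^sup>2 * ((f (\<omega> t) - f (\<omega> 0)) * (f (\<omega> t) - f (\<omega> 0))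
        + (h (\<omega> t) - h (\<omega> 0)) * (h (\<omega> t) - h (\<omega> 0))) \<partial>P)"
      unfolding inc_def
    proof (rule integral_mono)
      fix \<omega>
      let ?a = "\<bar>f (\<omega> t) - f (\<omega> 0)\<bar>" and ?b = "\<bar>h (\<omega> t) - h (\<omega> 0)\<bar>"
      have "(g (\<omega> t) - g (\<omega> 0))\<^sup>2 \<le> (K * (?a + ?b))\<^sup>2"
        using lip[of "\<omega> t" "\<omega> 0"] by (simp add: abs_le_square_iff[symmetric])
      also have "\<dots> = K\<^sup>2 * (?a + ?b)\<^sup>2" by (simp add: power_mult_distrib)
      also have "\<dots> \<le> K\<^sup>2 * (2 * (?a\<^sup>2 + ?b\<^sup>2))"
        using sum_squares_bound[of ?a ?b] by (intro mult_left_mono) (auto simp: power2_sum)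
      finally show "(g (\<omega> t) - g (\<omega> 0)) * (g (\<omega> t) - g (\<omega> 0)) \<le> 2 * K\<^sup>2 * ((f (\<omega> t) - f (\<omega> 0)) * (f (\<omega> t) - f (\<omega> 0))
        + (h (\<omega> t) - h (\<omega> 0)) * (h (\<omega> t) - h (\<omega> 0)))"
        by (simp add: power2_eq_square algebra_simps)
    qed (use L2 t01 integrable_inc in auto)
    also have "\<dots> = 2 * K\<^sup>2 * (inc f f t + inc h h t)"
      unfolding inc_def using L2 t01 integrable_inc by simp
    also have "\<dots> \<le> 2 * K\<^sup>2 * (C1 * t + C2 * t)"
      using C1 C2 t by (intro mult_left_mono add_mono) auto
    finally show ?thesis by (simp add: algebra_simps)
  qed
  then show ?thesis unfolding Db_iff using g D_iff_inc[OF L2(3)] by blast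
qed

lemma Db_lipschitz:
  assumes "f \<in> Db D" "bounded_borel g" "\<And>x y. \<bar>g x - g y\<bar> \<le> K * \<bar>f x - f y\<bar>"
  shows "g \<in> Db D"
  using Db_lipschitz2[OF assms(1,1,2), of "K/2"] assms(3) by simp

lemma Db_mult:
  assumes f: "f \<in> Db D" and g: "g \<in> Db D"
  shows "(\<lambda>x. f x * g x) \<in> Db D"
proof -
  obtain A B where A: "A > 0" "\<And>x. \<bar>f x\<bar> \<le> A" and B: "B > 0" "\<And>x. \<bar>g x\<bar> \<le> B"
    using f g by (metis bounded_borelE Db_iff)
  show ?thesis
  proof (rule Db_lipschitz2[OF f g, where K = "A + B"])
    fix x y
    have "\<bar>f x * g x - f y * g y\<bar> = \<bar>g x * (f x - f y) + f y * (g x - g y)\<bar>"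
      by (simp add: algebra_simps)
    also have "\<dots> \<le> \<bar>g x\<bar> * \<bar>f x - f y\<bar> + \<bar>f y\<bar> * \<bar>g x - g y\<bar>"
      by (metis abs_mult abs_triangle_ineq)
    also have "\<dots> \<le> (A + B) * \<bar>f x - f y\<bar> + (A + B) * \<bar>g x - g y\<bar>"
      using A B by (intro add_mono mult_right_mono) (auto intro: order_trans[OF A(2)] order_trans[OF B(2)])
    finally show "\<bar>f x * g x - f y * g y\<bar> \<le> (A + B) * (\<bar>f x - f y\<bar> + \<bar>g x - g y\<bar>)"
      by (simp add: distrib_left)
  qed (use f g in \<open>auto simp: Db_iff intro: bounded_borel_mult\<close>)
qed

lemma Db_power2: "f \<in> Db D \<Longrightarrow> (\<lambda>x. (f x)\<^sup>2) \<in> Db D"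
  using Db_mult[of f f] by (simp add: power2_eq_square)

lemma Db_exp:
  assumes f: "f \<in> Db D"
  shows "(\<lambda>x. exp (c * f x)) \<in> Db D"
proof -
  obtain B where B: "B > 0" "\<And>x. \<bar>f x\<bar> \<le> B" using f by (metis bounded_borelE Db_iff)
  have lip: "\<bar>exp a - exp b\<bar> \<le> exp R * \<bar>a - b\<bar>" if "a \<le> R" "b \<le> R" for a b R :: real
  proof -
    have *: "exp a - exp b \<le> exp R * \<bar>a - b\<bar>" if "a \<le> R" "b \<le> R" for a b :: real
    proof -
      have "1 + (b - a) \<le> exp (b - a)" by (rule exp_ge_add_one_self)
      then have "exp a * (1 - exp (b - a)) \<le> exp a * (a - b)" by (intro mult_left_mono) (linarith, simp)
      then have "exp a - exp b \<le> exp a * (a - b)" by (simp add: right_diff_distrib exp_add[symmetric])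
      also have "\<dots> \<le> exp a * \<bar>a - b\<bar>" by (intro mult_left_mono) auto
      also have "\<dots> \<le> exp R * \<bar>a - b\<bar>" using that by (intro mult_right_mono) auto
      finally show ?thesis .
    qed
    show ?thesis using *[OF that] *[OF that(2,1)] by (auto simp: abs_le_iff abs_minus_commute)
  qed
  show ?thesis
  proof (rule Db_lipschitz[OF f, where K = "exp (\<bar>c\<bar> * B) * \<bar>c\<bar>"])
    have le: "c * f x \<le> \<bar>c\<bar> * B" for x
    proof -
      have "c * f x \<le> \<bar>c\<bar> * \<bar>f x\<bar>" by (metis abs_ge_self abs_mult)
      also have "\<dots> \<le> \<bar>c\<bar> * B" using B by (intro mult_left_mono) auto
      finally show ?thesis .
    qed
    show "\<bar>exp (c * f x) - exp (c * f y)\<bar> \<le> exp (\<bar>c\<bar> * B) * \<bar>c\<bar> * \<bar>f x - f y\<bar>" for x y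
      using lip[OF le le, of x y] by (simp add: right_diff_distrib[symmetric] abs_mult mult.assoc)
  qed (use f in \<open>auto simp: Db_iff intro: bounded_borel_exp\<close>)
qed

text \<open>Strong locality excludes jumps: cutting \<open>f\<close> into slices of height \<open>\<delta>\<close>, distinct slices are
  orthogonal for the form, so a large increment of \<open>f\<close>, which moves several slices at once,
  has probability \<open>o(t)\<close>.\<close>
lemma quartic_increment_negligible:
  assumes f: "f \<in> Db D"
  shows "((\<lambda>t. (\<integral>\<omega>. (f (\<omega> t) - f (\<omega> 0))^4 \<partial>P) / t) \<longlongrightarrow> 0) (at_right 0)"
proof -
  have bf: "bounded_borel f" and fD: "f \<in> D" using f by (auto simp: Db_iff)
  obtain B where B: "B > 0" "\<And>x. \<bar>f x\<bar> \<le> B" using bf bounded_borelE by metis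
  have bound: "\<forall>\<^sub>F t in at_right 0. (\<integral>\<omega>. (f (\<omega> t) - f (\<omega> 0))^4 \<partial>P) / t < e" if e: "e > 0" for e
  proof -
    have Eff: "0 \<le> E f f" using form fD unfolding dirichlet_form_def by meson
    \<comment> \<open>The quantity \<open>8 * B^2 * E f f / N\<close> is what remains in the limit
      of the bound \<open>?J\<close> once the off-diagonal terms have disappeared.\<close>
    obtain N :: nat where N: "8 * B\<^sup>2 * E f f / e < real N" "N > 0"
      using reals_Archimedean2[of "8 * B\<^sup>2 * E f f / e"] Eff e
      by (metis divide_nonneg_pos gr_zeroI mult_nonneg_nonneg not_less of_nat_0 zero_le_numeral zero_le_power2)
    define \<delta> where "\<delta> = 2 * B / real N"
    have \<delta>: "\<delta> > 0" "real N * \<delta> = 2 * B" using B N by (auto simp: \<delta>_def)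
    \<comment> \<open>\<open>f + B\<close> takes values in \<open>[0, 2 * B]\<close>, and
      \<open>N\<close> slices of height \<open>\<delta>\<close> exhaust this range.\<close>
    define \<phi> where "\<phi> k x = min \<delta> (max 0 (f x + B - real k * \<delta>))" for k x
    have \<phi>D: "\<phi> k \<in> Db D" for k
    proof (rule Db_lipschitz[OF f, where K = 1])
      have [measurable]: "f \<in> borel_measurable borel" using bf by auto
      show "bounded_borel (\<phi> k)" unfolding \<phi>_def by (rule bounded_borelI[of _ \<delta>]) (use \<delta> in auto)
    qed (auto simp: \<phi>_def)
    have orth: "E (\<phi> k) (\<phi> l) = 0" if "k \<noteq> l" for k l
    proof -
      have *: "E (\<phi> k) (\<phi> l) = 0" if "k < l" for k l
      proof (rule local[unfolded strongly_local_def, rule_format])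
        have "real k * \<delta> + \<delta> \<le> real l * \<delta>"
        proof -
          have "(real k + 1) * \<delta> \<le> real l * \<delta>" using that \<delta> by (intro mult_right_mono) auto
          then show ?thesis by (simp add: algebra_simps)
        qed
        \<comment> \<open>Where the higher slice is nonzero, the lower one is full, that is, equal
          to the constant \<open>\<delta>\<close>. Strong locality, with its additive constant, is
          made for this configuration.\<close>
        then have "(\<phi> k x + - \<delta>) * \<phi> l x = 0" for x unfolding \<phi>_def by (auto simp: min_def max_def)
        then show "AE x in M. (\<phi> k x + - \<delta>) * \<phi> l x = 0" by simp
      qed (use \<phi>D in \<open>auto simp: Db_iff\<close>)
      show ?thesis using that *[of k l] *[of l k] E_sym[of "\<phi> k" "\<phi> l"] \<phi>D by (cases k l rule: linorder_cases) (auto simp: Db_iff)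
    qed
    let ?J = "\<lambda>t. 2 * B * \<delta> * (inc f f t / t) + (2 * B)\<^sup>2 * (\<Sum>k<N. \<Sum>l\<in>{..<N} - {k}. inc (\<phi> k) (\<phi> l) t / t)"
    have "(?J \<longlongrightarrow> 2 * B * \<delta> * (2 * E f f) + (2 * B)\<^sup>2 * (\<Sum>k<N. \<Sum>l\<in>{..<N} - {k}. 2 * E (\<phi> k) (\<phi> l))) (at_right 0)"
      using \<phi>D fD by (intro tendsto_intros inc_limit) (auto simp: Db_iff)
    also have "2 * B * \<delta> * (2 * E f f) + (2 * B)\<^sup>2 * (\<Sum>k<N. \<Sum>l\<in>{..<N} - {k}. 2 * E (\<phi> k) (\<phi> l)) = 8 * B\<^sup>2 * E f f / real N"
    proof -
      have "(\<Sum>k<N. \<Sum>l\<in>{..<N} - {k}. 2 * E (\<phi> k) (\<phi> l)) = 0"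
        by (intro sum.neutral ballI) (auto simp: orth)
      then show ?thesis by (simp add: \<delta>_def power2_eq_square)
    qed
    finally have lim: "(?J \<longlongrightarrow> 8 * B\<^sup>2 * E f f / real N) (at_right 0)" .
    have "8 * B\<^sup>2 * E f f / real N < e" using N e by (simp add: field_simps)
    with lim have "\<forall>\<^sub>F t in at_right 0. ?J t < e" by (rule order_tendstoD)
    moreover have "\<forall>\<^sub>F t in at_right 0. (\<integral>\<omega>. (f (\<omega> t) - f (\<omega> 0))^4 \<partial>P) / t \<le> ?J t"
    proof -
      have "(\<integral>\<omega>. (f (\<omega> t) - f (\<omega> 0))^4 \<partial>P) / t \<le> ?J t" if t: "0 < t" "t < 1" for t
      proof -
        have t01: "t \<in> {0..1}" using t by auto
        have L2: "\<phi> k \<in> L2 M" "f \<in> L2 M" for k using \<phi>D f by (auto simp: Db_iff L2_bounded)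
        let ?R = "\<lambda>\<omega>. (\<Sum>k<N. \<Sum>l\<in>{..<N} - {k}. (\<phi> k (\<omega> t) - \<phi> k (\<omega> 0)) * (\<phi> l (\<omega> t) - \<phi> l (\<omega> 0)))"
        let ?y = "\<lambda>\<omega>. f (\<omega> t) - f (\<omega> 0)"
        have intR: "integrable P ?R"
          by (intro Bochner_Integration.integrable_sum integrable_inc L2 t01)
        have "(\<integral>\<omega>. (?y \<omega>)^4 \<partial>P) \<le> (\<integral>\<omega>. 2 * B * \<delta> * (?y \<omega> * ?y \<omega>) + (2 * B)\<^sup>2 * ?R \<omega> \<partial>P)"
        proof (rule integral_mono)
          fix \<omega>
          have bd: "0 \<le> f x + B" "f x + B \<le> 2 * B" for x using B(2)[of x] by auto
          have sl: "(\<Sum>k<N. \<phi> k x) = f x + B" for x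
            unfolding \<phi>_def using sum_slices[of "f x + B" \<delta> N] bd[of x] \<delta> by simp
          have "(?y \<omega>)^4 \<le> 2 * B * \<delta> * (?y \<omega>)\<^sup>2 + (2 * B)\<^sup>2 * ?R \<omega>"
          proof (rule quartic_slice_bound)
            show "?y \<omega> = (\<Sum>k<N. \<phi> k (\<omega> t) - \<phi> k (\<omega> 0))" using sl by (simp add: sum_subtractf)
            show "\<bar>?y \<omega>\<bar> \<le> 2 * B" using B(2)[of "\<omega> t"] B(2)[of "\<omega> 0"] by auto
            show "\<bar>\<phi> k (\<omega> t) - \<phi> k (\<omega> 0)\<bar> \<le> \<delta>" for k unfolding \<phi>_def using \<delta> by (auto simp: min_def max_def)
            show "(\<forall>k<N. 0 \<le> \<phi> k (\<omega> t) - \<phi> k (\<omega> 0)) \<or> (\<forall>k<N. \<phi> k (\<omega> t) - \<phi> k (\<omega> 0) \<le> 0)"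
              unfolding \<phi>_def by (cases "f (\<omega> 0) \<le> f (\<omega> t)") (auto simp: min_def max_def)
          qed (use \<delta> in auto)
          then show "(?y \<omega>)^4 \<le> 2 * B * \<delta> * (?y \<omega> * ?y \<omega>) + (2 * B)\<^sup>2 * ?R \<omega>" by (simp add: power2_eq_square)
        next
          show "integrable P (\<lambda>\<omega>. (?y \<omega>)^4)"
          proof (rule P.integrable_const_bound[where B = "(2 * B)^4"])
            have "\<bar>?y \<omega>\<bar> \<le> 2 * B" for \<omega> using B(2)[of "\<omega> t"] B(2)[of "\<omega> 0"] by auto
            then have "\<bar>?y \<omega>\<bar>^4 \<le> (2 * B)^4" for \<omega> by (intro power_mono) auto
            then show "AE \<omega> in P. norm ((?y \<omega>)^4) \<le> (2 * B)^4" by (simp add: power_abs)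
            show "(\<lambda>\<omega>. (?y \<omega>)^4) \<in> borel_measurable P"
              using bf t01 by (intro borel_measurable_power borel_measurable_diff bounded_borel_measurable_at) auto
          qed
        qed (use intR integrable_inc[OF L2(2,2) t01] in auto)
        also have "\<dots> = 2 * B * \<delta> * inc f f t + (2 * B)\<^sup>2 * (\<integral>\<omega>. ?R \<omega> \<partial>P)"
          using intR integrable_inc[OF L2(2,2) t01] unfolding inc_def by simp
        also have "(\<integral>\<omega>. ?R \<omega> \<partial>P) = (\<Sum>k<N. \<Sum>l\<in>{..<N} - {k}. inc (\<phi> k) (\<phi> l) t)"
          unfolding inc_def
          by (simp add: Bochner_Integration.integral_sum Bochner_Integration.integrable_sum integrable_inc[OF L2(1,1) t01])
        finally have "(\<integral>\<omega>. (?y \<omega>)^4 \<partial>P) / t \<le> (2 * B * \<delta> * inc f f t + (2 * B)\<^sup>2 * (\<Sum>k<N. \<Sum>l\<in>{..<N} - {k}. inc (\<phi> k) (\<phi> l) t)) / t"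
          using t by (intro divide_right_mono) auto
        then show ?thesis by (simp add: add_divide_distrib sum_divide_distrib[symmetric])
      qed
      then show ?thesis unfolding eventually_at_right_field by (intro exI[of _ 1]) auto
    qed
    ultimately show ?thesis by eventually_elim simp
  qed
  show ?thesis
  proof (rule order_tendstoI)
    fix a :: real assume "a < 0"
    have "a < (\<integral>\<omega>. (f (\<omega> t) - f (\<omega> 0))^4 \<partial>P) / t" if "0 < t" for t
    proof -
      have "0 \<le> (\<integral>\<omega>. (f (\<omega> t) - f (\<omega> 0))^4 \<partial>P)"
        by (rule Bochner_Integration.integral_nonneg) simp
      then show ?thesis using \<open>a < 0\<close> that by (meson divide_nonneg_pos less_le_trans)
    qed
    then show "\<forall>\<^sub>F t in at_right 0. a < (\<integral>\<omega>. (f (\<omega> t) - f (\<omega> 0))^4 \<partial>P) / t"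
      unfolding eventually_at_right_field by (intro exI[of _ 1]) auto
  qed (rule bound)
qed

end

text \<open>With one-sided derivatives only, the mean value theorem is replaced by a continuation
  argument. Consider the last point up to which \<open>K\<close> stays below the line of slope
  \<open>e\<close> through its initial value: before \<open>b\<close> the right derivative carries
  the inequality a little further. Then \<open>e\<close> tends to 0.\<close>

lemma right_derivative_nonpos_imp_le:
  fixes K :: "real \<Rightarrow> real"
  assumes ab: "a \<le> b" and cont: "continuous_on {a..b} K"
    and der: "\<And>x. a \<le> x \<Longrightarrow> x < b \<Longrightarrow> \<exists>l\<le>0. (K has_real_derivative l) (at_right x)"
  shows "K b \<le> K a"
proof -
  have "K b \<le> K a + e * (b - a)" if e: "e > 0" for e
  proof -
    define G where "G x = K x - K a - e * (x - a)" for x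
    define S where "S = {x\<in>{a..b}. \<forall>y\<in>{a..x}. G y \<le> 0}"
    have aS: "a \<in> S" using ab by (simp add: S_def G_def)
    have bdd: "bdd_above S" by (rule bdd_aboveI[of _ b]) (simp add: S_def)
    define s where "s = Sup S"
    have "a \<le> s" unfolding s_def by (rule cSup_upper[OF aS bdd])
    moreover have "s \<le> b" unfolding s_def by (rule cSup_least) (use aS in \<open>auto simp: S_def\<close>)
    ultimately have s: "a \<le> s" "s \<le> b" .
    have contG: "continuous_on {a..b} G" unfolding G_def by (intro continuous_intros cont)
    have below: "G y \<le> 0" if y: "a \<le> y" "y < s" for y
    proof -
      obtain x where "x \<in> S" "y < x" using less_cSupD[of S y] y(2) aS unfolding s_def by blast
      then show ?thesis using y(1) by (simp add: S_def)
    qed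
    have Gs: "G s \<le> 0"
    proof (cases "s = a")
      case False
      then have "s \<in> closure {a..<s}" using s by simp
      moreover have "continuous_on (closure {a..<s}) G"
        by (rule continuous_on_subset[OF contG]) (use False s in auto)
      ultimately show ?thesis
        using continuous_le_on_closure[of "{a..<s}" G s 0] below by auto
    qed (simp add: G_def)
    have "s = b"
    proof (rule ccontr)
      assume "s \<noteq> b"
      then have sb: "s < b" using s by simp
      obtain l where l: "l \<le> 0" "(K has_real_derivative l) (at_right s)" using der[of s] s sb by auto
      have "((\<lambda>y. (K y - K s) / (y - s)) \<longlongrightarrow> l) (at_right s)"
        using l(2) by (simp add: has_field_derivative_iff)
      then have "\<forall>\<^sub>F y in at_right s. (K y - K s) / (y - s) < e"
        by (rule order_tendstoD(2)) (use l e in linarith)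
      then obtain d where d: "d > s" "\<And>y. s < y \<Longrightarrow> y < d \<Longrightarrow> (K y - K s) / (y - s) < e"
        unfolding eventually_at_right_field by blast
      define x where "x = (s + min d b) / 2"
      have x: "s < x" "x < d" "x \<le> b" using d(1) sb by (auto simp: x_def min_def field_simps)
      have "G y \<le> 0" if "y \<in> {a..x}" for y
      proof (cases "y \<le> s")
        case True
        then show ?thesis using below[of y] Gs that by (cases "y = s") auto
      next
        case False
        then have "K y - K s < e * (y - s)" using d(2)[of y] that x by (simp add: field_simps)
        then show ?thesis using Gs unfolding G_def by (simp add: algebra_simps)
      qed
      then have "x \<in> S" using x s by (simp add: S_def)
      then have "x \<le> s" unfolding s_def using bdd by (rule cSup_upper)
      with x show False by simp
    qed
    then show ?thesis using Gs by (simp add: G_def)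
  qed
  then have "K b \<le> K a + e" if "e > 0" for e
  proof (cases "a = b")
    case False
    then show ?thesis using \<open>\<And>e. e > 0 \<Longrightarrow> K b \<le> K a + e * (b - a)\<close>[of "e / (b - a)"] ab that by simp
  qed (use that in auto)
  then show ?thesis by (rule field_le_epsilon)
qed

lemma right_gronwall:
  fixes F :: "real \<Rightarrow> real"
  assumes "0 \<le> R" "continuous_on {0..R} F"
    and der: "\<And>q. 0 \<le> q \<Longrightarrow> q < R \<Longrightarrow> \<exists>l\<le>c * F q. ((\<lambda>h. (F (q + h) - F q) / h) \<longlongrightarrow> l) (at_right 0)"
  shows "F R \<le> exp (c * R) * F 0"
proof -
  define K where "K q = exp (- c * q) * F q" for q
  have "K R \<le> K 0"
  proof (rule right_derivative_nonpos_imp_le[where K = K])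
    show "continuous_on {0..R} K" unfolding K_def by (intro continuous_intros assms)
    fix q assume q: "0 \<le> q" "q < R"
    obtain l where l: "l \<le> c * F q" "((\<lambda>h. (F (q + h) - F q) / h) \<longlongrightarrow> l) (at_right 0)"
      using der[OF q] by auto
    have "(F has_real_derivative l) (at_right q)"
      unfolding has_field_derivative_iff
      by (subst filterlim_at_right_to_0) (use l(2) in \<open>simp add: add.commute\<close>)
    moreover have "((\<lambda>q. exp (- c * q)) has_real_derivative (exp (- c * q) * - c)) (at_right q)"
      by (auto intro!: derivative_eq_intros)
    ultimately have "(K has_real_derivative (exp (- c * q) * - c * F q + l * exp (- c * q))) (at_right q)"
      unfolding K_def by (rule DERIV_mult[rotated])
    moreover have "exp (- c * q) * - c * F q + l * exp (- c * q) = exp (- c * q) * (l - c * F q)"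
      by (simp add: algebra_simps)
    moreover have "\<dots> \<le> 0" using l(1) by (simp add: mult_le_0_iff)
    ultimately show "\<exists>l\<le>0. (K has_real_derivative l) (at_right q)" by metis
  qed (use assms in auto)
  then have "exp (c * R) * (exp (- c * R) * F R) \<le> exp (c * R) * F 0"
    unfolding K_def by (intro mult_left_mono) auto
  then show ?thesis by (simp add: mult.assoc[symmetric] exp_add[symmetric])
qed

text \<open>The ground-state substitution \<open>w = exp (- l * f) * u\<close>. The mixed terms on
  the left equal \<open>w\<close> at the one time multiplied by \<open>w\<close> at the other and by
  twice the cosh of the increment of \<open>l * f\<close>; taking out the part with cosh replaced by
  1 completes the square of the increment of \<open>w\<close>.\<close>

lemma doob_increment_identity:
  fixes l f0 f1 u0 u1 :: real
  shows "(exp (- 2 * l * f1) * u1 - exp (- 2 * l * f0) * u0) * (u1 - u0)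
    = (exp (- l * f1) * u1 - exp (- l * f0) * u0)\<^sup>2
      - 2 * ((exp (- l * f0) * u0) * (exp (- l * f1) * u1)) * ((exp (l * (f1 - f0)) + exp (- (l * (f1 - f0)))) / 2 - 1)"
proof -
  define p where "p = exp (- l * f0)"
  define q where "q = exp (- l * f1)"
  have pq: "p > 0" "q > 0" by (auto simp: p_def q_def)
  have 1: "exp (- 2 * l * f1) = q\<^sup>2" "exp (- 2 * l * f0) = p\<^sup>2"
    unfolding p_def q_def power2_eq_square exp_add[symmetric] by (simp_all add: algebra_simps)
  have 2: "exp (l * (f1 - f0)) = p / q" "exp (- (l * (f1 - f0))) = q / p"
    unfolding p_def q_def exp_diff[symmetric] by (simp_all add: algebra_simps)
  show ?thesis unfolding 1 2 p_def[symmetric] q_def[symmetric] using pq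
    by (simp add: field_simps power2_eq_square)
qed

section \<open>Energy density and the weighted lower bound for the form\<close>

context diffusion begin

text \<open>The polarised combination of increments in \<open>Iform\<close> collapses algebraically
  to the square of the increment of \<open>f\<close> times the symmetrised weight. So
  \<open>Iform E f f h\<close> is the integral of \<open>h\<close> against the energy density of
  \<open>f\<close>.\<close>

lemma Iform_limit:
  assumes f: "f \<in> Db D" and h: "h \<in> Db D"
  shows "((\<lambda>t. (\<integral>\<omega>. (f (\<omega> t) - f (\<omega> 0))\<^sup>2 * (h (\<omega> 0) + h (\<omega> t)) \<partial>P) / t) \<longlongrightarrow> 2 * Iform E f f h) (at_right 0)"
proof -
  let ?fh = "\<lambda>x. f x * h x" and ?ff = "\<lambda>x. f x * f x"
  have Db: "?fh \<in> Db D" "?ff \<in> Db D" using f h Db_mult by auto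
  then have "((\<lambda>t. 2 * (inc ?fh f t / t) - inc ?ff h t / t) \<longlongrightarrow> 2 * (2 * E ?fh f) - 2 * E ?ff h) (at_right 0)"
    using f h by (intro tendsto_intros inc_limit) (auto simp: Db_iff)
  also have "2 * (2 * E ?fh f) - 2 * E ?ff h = 2 * Iform E f f h" by (simp add: Iform_def)
  finally show ?thesis
  proof (rule Lim_transform_eventually)
    have L2: "?fh \<in> L2 M" "?ff \<in> L2 M" "f \<in> L2 M" "h \<in> L2 M"
      using f h Db by (auto simp: Db_iff D_L2)
    have "2 * (inc ?fh f t / t) - inc ?ff h t / t = (\<integral>\<omega>. (f (\<omega> t) - f (\<omega> 0))\<^sup>2 * (h (\<omega> 0) + h (\<omega> t)) \<partial>P) / t"
      if "0 < t" "t < 1" for t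
    proof -
      have t01: "t \<in> {0..1}" using that by auto
      have "2 * inc ?fh f t - inc ?ff h t
        = (\<integral>\<omega>. 2 * ((?fh (\<omega> t) - ?fh (\<omega> 0)) * (f (\<omega> t) - f (\<omega> 0))) - (?ff (\<omega> t) - ?ff (\<omega> 0)) * (h (\<omega> t) - h (\<omega> 0)) \<partial>P)"
        unfolding inc_def using integrable_inc[OF L2(1,3) t01] integrable_inc[OF L2(2,4) t01] by simp
      also have "\<dots> = (\<integral>\<omega>. (f (\<omega> t) - f (\<omega> 0))\<^sup>2 * (h (\<omega> 0) + h (\<omega> t)) \<partial>P)"
        by (intro Bochner_Integration.integral_cong) (auto simp: algebra_simps power2_eq_square)
      finally show ?thesis by (simp add: diff_divide_distrib[symmetric])
    qed
    then show "\<forall>\<^sub>F t in at_right 0. 2 * (inc ?fh f t / t) - inc ?ff h t / t = (\<integral>\<omega>. (f (\<omega> t) - f (\<omega> 0))\<^sup>2 * (h (\<omega> 0) + h (\<omega> t)) \<partial>P) / t"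
      unfolding eventually_at_right_field by (intro exI[of _ 1]) auto
  qed
qed

text \<open>In \<open>doob_increment_identity\<close> the square is dropped and the product of the
  two values of \<open>w\<close> is replaced by half the sum of their squares, which is allowed
  because cosh is at least 1. Dividing by \<open>t\<close>, the quadratic part of cosh becomes
  \<open>Iform\<close> with weight \<open>w^2\<close>, bounded by the definition of
  \<open>D0\<close>, and the quartic part vanishes.\<close>

lemma weighted_form_lower_bound:
  assumes f: "f \<in> D0 M D E" and u: "u \<in> Db D"
  shows "- (l\<^sup>2 / 2) * (\<integral>x. exp (- 2 * l * f x) * (u x)\<^sup>2 \<partial>M) \<le> E (\<lambda>x. exp (- 2 * l * f x) * u x) u"
proof -
  have fD: "f \<in> Db D" using f by (simp add: D0_def)
  define w where "w x = exp (- l * f x) * u x" for x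
  define v where "v x = exp (- 2 * l * f x) * u x" for x
  have wD: "w \<in> Db D" unfolding w_def by (intro Db_mult Db_exp fD u)
  have vD: "v \<in> Db D" unfolding v_def by (intro Db_mult Db_exp fD u)
  obtain B where B: "B > 0" "\<And>x. \<bar>f x\<bar> \<le> B" using fD by (metis bounded_borelE Db_iff)
  obtain W where W: "W > 0" "\<And>x. \<bar>w x\<bar> \<le> W" using wD by (metis bounded_borelE Db_iff)
  \<comment> \<open>\<open>K\<close> controls the quartic remainder of cosh for arguments up to
    \<open>2 * B * \<bar>l\<bar>\<close>; in \<open>C\<close> the factor
    \<open>2 * W\<^sup>2\<close> bounds the sum of the two squares of \<open>w\<close>, and
    \<open>l^4\<close> comes from the fourth power of the argument.\<close>
  define K where "K = exp (\<bar>l\<bar> * (2 * B))"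
  define C where "C = 2 * W\<^sup>2 * K * l^4"
  let ?J = "\<lambda>\<omega> t. (f (\<omega> t) - f (\<omega> 0))\<^sup>2 * ((w (\<omega> 0))\<^sup>2 + (w (\<omega> t))\<^sup>2)"
  let ?Q = "\<lambda>\<omega> t. (f (\<omega> t) - f (\<omega> 0))^4"
  have pt: "- (l\<^sup>2 / 2) * ?J \<omega> t - C * ?Q \<omega> t \<le> (v (\<omega> t) - v (\<omega> 0)) * (u (\<omega> t) - u (\<omega> 0))" for \<omega> t
  proof -
    define x where "x = l * (f (\<omega> t) - f (\<omega> 0))"
    define c where "c = (exp x + exp (- x)) / 2 - 1"
    define a where "a = w (\<omega> 0)" define b where "b = w (\<omega> t)"
    have c0: "0 \<le> c"
    proof -
      have "(1 + x) + (1 + - x) \<le> exp x + exp (- x)" by (intro add_mono exp_ge_add_one_self)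
      then show ?thesis by (simp add: c_def)
    qed
    have "\<bar>f (\<omega> t) - f (\<omega> 0)\<bar> \<le> 2 * B" using B(2)[of "\<omega> t"] B(2)[of "\<omega> 0"] by auto
    then have "\<bar>x\<bar> \<le> \<bar>l\<bar> * (2 * B)" unfolding x_def abs_mult by (intro mult_left_mono) auto
    then have c1: "c \<le> x\<^sup>2 / 2 + K * x^4" unfolding c_def K_def by (rule cosh_quartic_bound)
    have "(v (\<omega> t) - v (\<omega> 0)) * (u (\<omega> t) - u (\<omega> 0)) = (b - a)\<^sup>2 - 2 * (a * b) * c"
      unfolding v_def w_def a_def b_def c_def x_def by (rule doob_increment_identity)
    moreover have "2 * (a * b) * c \<le> (a\<^sup>2 + b\<^sup>2) * c"
      using sum_squares_bound[of a b] c0 by (intro mult_right_mono) (auto simp: mult.assoc)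
    moreover have "(a\<^sup>2 + b\<^sup>2) * c \<le> (a\<^sup>2 + b\<^sup>2) * (x\<^sup>2 / 2 + K * x^4)"
      using c1 by (intro mult_left_mono) auto
    moreover have "(a\<^sup>2 + b\<^sup>2) * (K * x^4) \<le> (2 * W\<^sup>2) * (K * x^4)"
    proof (rule mult_right_mono)
      have "a\<^sup>2 \<le> W\<^sup>2" "b\<^sup>2 \<le> W\<^sup>2" using W(2)[of "\<omega> t"] W(2)[of "\<omega> 0"] W(1)
        by (auto simp: a_def b_def abs_le_square_iff[symmetric])
      then show "a\<^sup>2 + b\<^sup>2 \<le> 2 * W\<^sup>2" by simp
    qed (simp add: K_def)
    moreover have "(a\<^sup>2 + b\<^sup>2) * (x\<^sup>2 / 2 + K * x^4) = (l\<^sup>2 / 2) * ?J \<omega> t + (a\<^sup>2 + b\<^sup>2) * (K * x^4)"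
      unfolding x_def a_def b_def power_mult_distrib by (simp add: algebra_simps)
    moreover have "C * ?Q \<omega> t = (2 * W\<^sup>2) * (K * x^4)"
      unfolding C_def x_def by (simp add: power_mult_distrib mult.assoc mult.left_commute)
    moreover have "(b - a)\<^sup>2 \<ge> 0" by simp
    moreover have "- (l\<^sup>2 / 2) * ?J \<omega> t = - ((l\<^sup>2 / 2) * ?J \<omega> t)" by simp
    ultimately show ?thesis by linarith
  qed
  have "((\<lambda>t. - (l\<^sup>2 / 2) * ((\<integral>\<omega>. ?J \<omega> t \<partial>P) / t) - C * ((\<integral>\<omega>. ?Q \<omega> t \<partial>P) / t))
      \<longlongrightarrow> - (l\<^sup>2 / 2) * (2 * Iform E f f (\<lambda>x. (w x)\<^sup>2)) - C * 0) (at_right 0)"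
    using fD wD by (intro tendsto_intros Iform_limit[of f "\<lambda>x. (w x)\<^sup>2"] quartic_increment_negligible Db_power2)
  moreover have "((\<lambda>t. inc v u t / t) \<longlongrightarrow> 2 * E v u) (at_right 0)"
    using vD u by (intro inc_limit) (auto simp: Db_iff)
  moreover have "\<forall>\<^sub>F t in at_right 0. - (l\<^sup>2 / 2) * ((\<integral>\<omega>. ?J \<omega> t \<partial>P) / t) - C * ((\<integral>\<omega>. ?Q \<omega> t \<partial>P) / t) \<le> inc v u t / t"
  proof -
    have "- (l\<^sup>2 / 2) * ((\<integral>\<omega>. ?J \<omega> t \<partial>P) / t) - C * ((\<integral>\<omega>. ?Q \<omega> t \<partial>P) / t) \<le> inc v u t / t" if t: "0 < t" "t < 1" for t
    proof -
      have t01: "t \<in> {0..1}" using t by auto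
      have [measurable]: "(\<lambda>\<omega>. f (\<omega> t)) \<in> borel_measurable P" "(\<lambda>\<omega>. f (\<omega> 0)) \<in> borel_measurable P"
        "(\<lambda>\<omega>. w (\<omega> t)) \<in> borel_measurable P" "(\<lambda>\<omega>. w (\<omega> 0)) \<in> borel_measurable P"
        using fD wD t01 by (auto simp: Db_iff intro!: bounded_borel_measurable_at)
      have fb: "\<bar>f (\<omega> t) - f (\<omega> 0)\<bar> \<le> 2 * B" for \<omega> using B(2)[of "\<omega> t"] B(2)[of "\<omega> 0"] by auto
      have iQ: "integrable P (\<lambda>\<omega>. ?Q \<omega> t)"
      proof (rule P.integrable_const_bound[where B = "(2 * B)^4"])
        have "\<bar>f (\<omega> t) - f (\<omega> 0)\<bar>^4 \<le> (2 * B)^4" for \<omega> using fb by (intro power_mono) auto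
        then show "AE \<omega> in P. norm (?Q \<omega> t) \<le> (2 * B)^4" by (simp add: power_abs)
      qed simp
      have iJ: "integrable P (\<lambda>\<omega>. ?J \<omega> t)"
      proof (rule P.integrable_const_bound[where B = "(2 * B)\<^sup>2 * (W\<^sup>2 + W\<^sup>2)"])
        have "?J \<omega> t \<le> (2 * B)\<^sup>2 * (W\<^sup>2 + W\<^sup>2)" for \<omega>
        proof -
          have "(f (\<omega> t) - f (\<omega> 0))\<^sup>2 \<le> (2 * B)\<^sup>2" "(w (\<omega> 0))\<^sup>2 \<le> W\<^sup>2" "(w (\<omega> t))\<^sup>2 \<le> W\<^sup>2"
            using fb[of \<omega>] W(2)[of "\<omega> t"] W(2)[of "\<omega> 0"] W(1) B(1)
            by (intro abs_le_square_iff[THEN iffD1]; simp)+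
          then show ?thesis by (intro mult_mono add_mono) auto
        qed
        then show "AE \<omega> in P. norm (?J \<omega> t) \<le> (2 * B)\<^sup>2 * (W\<^sup>2 + W\<^sup>2)" by simp
      qed simp
      have "(\<integral>\<omega>. - (l\<^sup>2 / 2) * ?J \<omega> t - C * ?Q \<omega> t \<partial>P) \<le> inc v u t"
        unfolding inc_def using iJ iQ vD u t01
        by (intro integral_mono pt integrable_inc Bochner_Integration.integrable_diff integrable_mult_right)
          (auto simp: Db_iff D_L2)
      moreover have "(\<integral>\<omega>. - (l\<^sup>2 / 2) * ?J \<omega> t - C * ?Q \<omega> t \<partial>P) = - (l\<^sup>2 / 2) * (\<integral>\<omega>. ?J \<omega> t \<partial>P) - C * (\<integral>\<omega>. ?Q \<omega> t \<partial>P)"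
        using integrable_mult_right[OF iJ, of "- (l\<^sup>2 / 2)"] integrable_mult_right[OF iQ, of C]
        by (subst Bochner_Integration.integral_diff) (simp_all only: integral_mult_right_zero)
      ultimately have "(- (l\<^sup>2 / 2) * (\<integral>\<omega>. ?J \<omega> t \<partial>P) - C * (\<integral>\<omega>. ?Q \<omega> t \<partial>P)) / t \<le> inc v u t / t"
        using t by (intro divide_right_mono) auto
      then show ?thesis by (simp add: diff_divide_distrib)
    qed
    then show ?thesis unfolding eventually_at_right_field by (intro exI[of _ 1]) auto
  qed
  ultimately have "- (l\<^sup>2 / 2) * (2 * Iform E f f (\<lambda>x. (w x)\<^sup>2)) - C * 0 \<le> 2 * E v u"
    by (intro tendsto_le[of "at_right (0::real)"]) auto
  moreover have "Iform E f f (\<lambda>x. (w x)\<^sup>2) \<le> (\<integral>x. \<bar>(w x)\<^sup>2\<bar> \<partial>M)"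
    using f Db_power2[OF wD] unfolding D0_def by blast
  then have "(l\<^sup>2 / 2) * Iform E f f (\<lambda>x. (w x)\<^sup>2) \<le> (l\<^sup>2 / 2) * (\<integral>x. (w x)\<^sup>2 \<partial>M)"
    by (intro mult_left_mono) auto
  moreover have "(w x)\<^sup>2 = exp (- 2 * l * f x) * (u x)\<^sup>2" for x
    unfolding w_def power_mult_distrib exp_double[symmetric] by (simp add: algebra_simps)
  ultimately show ?thesis unfolding v_def by simp
qed

text \<open>Density of the domain supplies \<open>d\<close> close to \<open>g\<close> in mean
  square, and the increments of \<open>d\<close> are controlled by \<open>D_iff_inc\<close>;
  stationarity makes the approximation error the same at all times. Bounded Borel functions are
  needed because images under \<open>T\<close> occur as observables and carry no continuity.\<close>

lemma L1_continuous_bounded: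
  assumes g: "bounded_borel g"
  shows "L1_continuous g"
  unfolding L1_continuous_def
proof (intro allI impI)
  fix e :: real assume e: "e > 0"
  have gL: "g \<in> L2 M" by (rule L2_bounded[OF g])
  have "\<forall>f\<in>L2 M. \<forall>\<epsilon>>0. \<exists>g\<in>D. (\<integral>x. (f x - g x)^2 \<partial>M) < \<epsilon>"
    using form unfolding dirichlet_form_def by meson
  moreover have "e\<^sup>2 / 12 > 0" using e by simp
  ultimately obtain d where d: "d \<in> D" "(\<integral>x. (g x - d x)\<^sup>2 \<partial>M) < e\<^sup>2 / 12"
    using gL by blast
  have dL: "d \<in> L2 M" by (rule D_L2[OF d(1)])
  obtain C where C: "\<forall>t\<in>{0<..1}. inc d d t \<le> C * t" using d(1) D_iff_inc[OF dL] by auto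
  define z where "z x = g x - d x" for x
  have zm: "z \<in> borel_measurable borel" unfolding z_def using gL dL by (auto dest!: L2_measurable)
  have gdint: "integrable M (\<lambda>x. g x * d x)"
    using integrable_L2_at2[OF gL dL, of 0 0] integrable_at_iff[of "\<lambda>x. g x * d x" 0] gL dL
    by (simp add: L2_measurable borel_measurable_times)
  have "integrable M (\<lambda>x. (g x)\<^sup>2 + (d x)\<^sup>2 - 2 * (g x * d x))"
    using gL dL gdint by (intro Bochner_Integration.integrable_add Bochner_Integration.integrable_diff integrable_mult_right) (auto simp: L2_def)
  then have zint: "integrable M (\<lambda>x. (z x)\<^sup>2)" by (simp add: z_def power2_diff mult.assoc)
  have zP: "integrable P (\<lambda>\<omega>. (z (\<omega> t))\<^sup>2)" "(\<integral>\<omega>. (z (\<omega> t))\<^sup>2 \<partial>P) < e\<^sup>2 / 12" if "t \<in> {0..1}" for t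
  proof -
    have m: "(\<lambda>x. (z x)\<^sup>2) \<in> borel_measurable borel" using zm by simp
    show "integrable P (\<lambda>\<omega>. (z (\<omega> t))\<^sup>2)" using integrable_at_iff[OF m that] zint by simp
    show "(\<integral>\<omega>. (z (\<omega> t))\<^sup>2 \<partial>P) < e\<^sup>2 / 12"
      using expectation_at[OF m that] d(2) unfolding z_def by simp
  qed
  \<comment> \<open>The increment of \<open>g\<close> is split into three terms, which costs a
    factor 3: the approximation errors take \<open>e\<^sup>2 / 12\<close> each and the increment of
    \<open>d\<close> takes \<open>e\<^sup>2 / 6\<close>. The added 1 excludes division by
    zero.\<close>
  define \<delta> where "\<delta> = e\<^sup>2 / (6 * (\<bar>C\<bar> + 1))"
  have \<delta>: "\<delta> > 0" using e by (simp add: \<delta>_def)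
  have incg: "inc g g k < e\<^sup>2" if k: "0 < k" "k \<le> 1" "k < \<delta>" for k
  proof -
    have k01: "k \<in> {0..1}" using k by auto
    have "inc g g k \<le> (\<integral>\<omega>. 3 * ((z (\<omega> k))\<^sup>2 + (z (\<omega> 0))\<^sup>2 + (d (\<omega> k) - d (\<omega> 0)) * (d (\<omega> k) - d (\<omega> 0))) \<partial>P)"
      unfolding inc_def
    proof (rule integral_mono)
      fix \<omega>
      have sq3: "(a - b + c)\<^sup>2 \<le> 3 * (a\<^sup>2 + b\<^sup>2 + c\<^sup>2)" for a b c :: real
      proof -
        have "0 \<le> (a + b)\<^sup>2 + (a - c)\<^sup>2 + (b + c)\<^sup>2" by simp
        then show ?thesis by (simp add: power2_eq_square algebra_simps)
      qed
      have "g (\<omega> k) - g (\<omega> 0) = z (\<omega> k) - z (\<omega> 0) + (d (\<omega> k) - d (\<omega> 0))" by (simp add: z_def)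
      then show "(g (\<omega> k) - g (\<omega> 0)) * (g (\<omega> k) - g (\<omega> 0)) \<le> 3 * ((z (\<omega> k))\<^sup>2 + (z (\<omega> 0))\<^sup>2 + (d (\<omega> k) - d (\<omega> 0)) * (d (\<omega> k) - d (\<omega> 0)))"
        using sq3[of "z (\<omega> k)" "z (\<omega> 0)" "d (\<omega> k) - d (\<omega> 0)"] by (simp add: power2_eq_square)
    qed (use zP k01 integrable_inc[OF gL gL k01] integrable_inc[OF dL dL k01] in \<open>auto\<close>)
    also have "\<dots> = 3 * ((\<integral>\<omega>. (z (\<omega> k))\<^sup>2 \<partial>P) + (\<integral>\<omega>. (z (\<omega> 0))\<^sup>2 \<partial>P) + inc d d k)"
      unfolding inc_def using zP(1)[of k] zP(1)[of 0] k01 integrable_inc[OF dL dL k01] by simp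
    also have "\<dots> < 3 * (e\<^sup>2 / 12 + e\<^sup>2 / 12 + e\<^sup>2 / 6)"
    proof -
      have "inc d d k \<le> C * k" using C k by auto
      also have "\<dots> \<le> (\<bar>C\<bar> + 1) * \<delta>" using k by (intro mult_mono) auto
      also have "\<dots> = e\<^sup>2 / 6"
      proof -
        have "\<bar>C\<bar> + 1 \<noteq> 0" by linarith
        then show ?thesis unfolding \<delta>_def by (simp add: divide_simps del: distrib_left_numeral)
      qed
      finally show ?thesis using zP(2)[of k] zP(2)[of 0] k01 by simp
    qed
    also have "\<dots> = e\<^sup>2" by simp
    finally show ?thesis .
  qed
  have sq: "(\<integral>\<omega>. (g (\<omega> r) - g (\<omega> q))\<^sup>2 \<partial>P) = inc g g (q - r)" if rq: "0 \<le> r" "r \<le> q" "q \<le> 1" for r q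
  proof -
    have r01: "r \<in> {0..1}" "q \<in> {0..1}" using rq by auto
    have Tb: "bounded_borel (T (q - r) g)" using g rq by (intro bounded_borel_T) auto
    \<comment> \<open>The Markov property reduces the correlation to a single time, invariance moves
      that time to 0, and the Markov property is undone there.\<close>
    have "corr g r g q = corr g r (T (q - r) g) r" using corr_T[OF g g, of r r "q - r"] rq by simp
    also have "\<dots> = (\<integral>x. g x * T (q - r) g x \<partial>M)"
      unfolding corr_def using expectation_at[of "\<lambda>x. g x * T (q - r) g x" r] g Tb r01 by (auto intro: borel_measurable_times)
    also have "\<dots> = corr g 0 (T (q - r) g) 0" using corr_start[OF g Tb] by simp
    also have "\<dots> = corr g 0 g (q - r)" using corr_T[OF g g, of 0 0 "q - r"] rq by simp
    finally have c: "corr g r g q = corr g 0 g (q - r)" .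
    have "(\<integral>\<omega>. (g (\<omega> r) - g (\<omega> q))\<^sup>2 \<partial>P) = (\<integral>\<omega>. g (\<omega> r) * g (\<omega> r) + g (\<omega> q) * g (\<omega> q) - 2 * (g (\<omega> r) * g (\<omega> q)) \<partial>P)"
      by (simp add: power2_eq_square algebra_simps)
    also have "\<dots> = (\<integral>\<omega>. g (\<omega> r) * g (\<omega> r) \<partial>P) + (\<integral>\<omega>. g (\<omega> q) * g (\<omega> q) \<partial>P) - 2 * corr g r g q"
      unfolding corr_def using integrable_at2[OF g g] r01 by simp
    also have "\<dots> = inc g g (q - r)"
      using inc_eq[OF gL gL, of "q - r"] expectation_at[of "\<lambda>x. g x * g x" r] expectation_at[of "\<lambda>x. g x * g x" q] g rq r01
      unfolding c by (simp add: bounded_borel_measurable borel_measurable_times)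
    finally show ?thesis .
  qed
  have main: "(\<integral>\<omega>. \<bar>g (\<omega> r) - g (\<omega> q)\<bar> \<partial>P) < e" if rq: "0 \<le> r" "r \<le> q" "q \<le> 1" "q - r < \<delta>" for r q
  proof (cases "r = q")
    case False
    have r01: "r \<in> {0..1}" "q \<in> {0..1}" using rq by auto
    have i2: "integrable P (\<lambda>\<omega>. (g (\<omega> r) - g (\<omega> q))\<^sup>2)"
      using integrable_at2[OF g g] r01 by (simp add: power2_eq_square algebra_simps)
    have "(\<integral>\<omega>. \<bar>g (\<omega> r) - g (\<omega> q)\<bar> \<partial>P) \<le> (\<integral>\<omega>. (g (\<omega> r) - g (\<omega> q))\<^sup>2 / (2 * e) + e / 2 \<partial>P)"
    proof (rule integral_mono)
      fix \<omega>
      let ?y = "\<bar>g (\<omega> r) - g (\<omega> q)\<bar>"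
      have "2 * ?y * e \<le> ?y\<^sup>2 + e\<^sup>2" by (rule sum_squares_bound)
      then show "?y \<le> (g (\<omega> r) - g (\<omega> q))\<^sup>2 / (2 * e) + e / 2"
        using e by (simp add: field_simps power2_eq_square)
    qed (use i2 integrable_at[OF g] r01 in auto)
    also have "\<dots> = inc g g (q - r) / (2 * e) + e / 2"
      using i2 sq[OF rq(1-3)] by (simp add: P.prob_space)
    also have "\<dots> < e\<^sup>2 / (2 * e) + e / 2"
      using incg[of "q - r"] False rq e by (intro add_strict_right_mono divide_strict_right_mono) auto
    also have "\<dots> = e" using e by (simp add: power2_eq_square)
    finally show ?thesis .
  qed (use e in auto)
  show "\<exists>\<delta>>0. \<forall>r\<in>{0..1}. \<forall>q\<in>{0..1}. \<bar>r - q\<bar> < \<delta> \<longrightarrow> (\<integral>\<omega>. \<bar>g (\<omega> r) - g (\<omega> q)\<bar> \<partial>P) < e"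
  proof (intro exI[of _ \<delta>] conjI \<delta> ballI impI)
    fix r q :: real assume "r \<in> {0..1}" "q \<in> {0..1}" "\<bar>r - q\<bar> < \<delta>"
    then show "(\<integral>\<omega>. \<bar>g (\<omega> r) - g (\<omega> q)\<bar> \<partial>P) < e"
      using main[of r q] main[of q r] by (cases "r \<le> q") (auto simp: abs_minus_commute)
  qed
qed

end

section \<open>Exponential moments\<close>

context diffusion begin

text \<open>The counterpart of \<open>corr_bound\<close> with the two factors exchanged: now the
  later observable is measured in the mean, under \<open>M\<close> by stationarity. This is what
  makes \<open>T\<close> contract in the mean.\<close>

lemma corr_bound_left:
  assumes "bounded_borel \<phi>" "bounded_borel g" "s \<in> {0..1}" "t \<in> {0..1}" "\<And>x. \<bar>\<phi> x\<bar> \<le> K"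
  shows "\<bar>corr \<phi> s g t\<bar> \<le> K * (\<integral>x. \<bar>g x\<bar> \<partial>M)"
proof -
  have "\<bar>corr \<phi> s g t\<bar> = \<bar>corr g t \<phi> s\<bar>" unfolding corr_def by (simp add: mult.commute)
  also have "\<dots> \<le> K * (\<integral>\<omega>. \<bar>g (\<omega> t)\<bar> \<partial>P)" using assms by (intro corr_bound)
  also have "(\<integral>\<omega>. \<bar>g (\<omega> t)\<bar> \<partial>P) = (\<integral>x. \<bar>g x\<bar> \<partial>M)"
    using expectation_at[of "\<lambda>x. \<bar>g x\<bar>" t] assms by (auto dest!: bounded_borel_measurable)
  finally show ?thesis .
qed

lemma corr_diff:
  assumes "bounded_borel \<phi>" "bounded_borel f" "bounded_borel g" "s \<in> {0..1}" "t \<in> {0..1}"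
  shows "corr \<phi> s (\<lambda>x. f x - g x) t = corr \<phi> s f t - corr \<phi> s g t"
  using corr_cadd[OF assms, of 1 "-1"] by simp

lemma L1_norm_M: "bounded_borel z \<Longrightarrow> (\<integral>x. \<bar>z x\<bar> \<partial>M) = corr (\<lambda>x. sgn (z x)) 0 z 0"
  using L1_norm_eq_corr[of z 0] expectation_at[of "\<lambda>x. \<bar>z x\<bar>" 0] by (auto dest!: bounded_borel_measurable)

lemma T_L1_contraction:
  assumes g: "bounded_borel g1" "bounded_borel g2" and r: "r \<in> {0..1}"
  shows "(\<integral>x. \<bar>T r g1 x - T r g2 x\<bar> \<partial>M) \<le> (\<integral>x. \<bar>g1 x - g2 x\<bar> \<partial>M)"
proof -
  let ?z = "\<lambda>x. T r g1 x - T r g2 x"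
  let ?s = "\<lambda>x. sgn (?z x)"
  have b: "bounded_borel (T r g1)" "bounded_borel (T r g2)" using g r by (auto intro: bounded_borel_T)
  have z: "bounded_borel ?z" by (rule bounded_borel_diff[OF b])
  have s: "bounded_borel ?s" by (rule bounded_borel_sgn[OF z])
  have "(\<integral>x. \<bar>?z x\<bar> \<partial>M) = corr ?s 0 (T r g1) 0 - corr ?s 0 (T r g2) 0"
    unfolding L1_norm_M[OF z] by (rule corr_diff[OF s b]) auto
  also have "\<dots> = corr ?s 0 g1 r - corr ?s 0 g2 r"
    using corr_T[OF s g(1), of 0 0 r] corr_T[OF s g(2), of 0 0 r] r by simp
  also have "\<dots> = corr ?s 0 (\<lambda>x. g1 x - g2 x) r"
    by (rule corr_diff[OF s g, symmetric]) (use r in auto)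
  also have "\<dots> \<le> 1 * (\<integral>x. \<bar>g1 x - g2 x\<bar> \<partial>M)"
    using corr_bound_left[OF s bounded_borel_diff[OF g], of 0 r 1] r by (auto simp: sgn_if abs_le_iff)
  finally show ?thesis by simp
qed

text \<open>\<open>T 0\<close> is determined only by correlations and so is the identity only up to
  null sets. Testing with the sign of the difference gives this; it identifies the initial value in
  the differential inequality below.\<close>

lemma T_zero:
  assumes g: "bounded_borel g"
  shows "(\<integral>x. \<bar>T 0 g x - g x\<bar> \<partial>M) = 0"
proof -
  let ?z = "\<lambda>x. T 0 g x - g x"
  let ?s = "\<lambda>x. sgn (?z x)"
  have b: "bounded_borel (T 0 g)" using g by (auto intro: bounded_borel_T)
  have z: "bounded_borel ?z" by (rule bounded_borel_diff[OF b g])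
  have s: "bounded_borel ?s" by (rule bounded_borel_sgn[OF z])
  have "(\<integral>x. \<bar>?z x\<bar> \<partial>M) = corr ?s 0 (T 0 g) 0 - corr ?s 0 g 0"
    unfolding L1_norm_M[OF z] by (rule corr_diff[OF s b g]) auto
  then show ?thesis using corr_T[OF s g, of 0 0 0] by simp
qed

lemma T_AE_bound_M:
  assumes g: "bounded_borel g" "\<And>x. \<bar>g x\<bar> \<le> B" and r: "r \<in> {0..1}"
  shows "AE x in M. \<bar>T r g x\<bar> \<le> B"
proof -
  have [measurable]: "T r g \<in> borel_measurable borel" using bounded_borel_T[OF g(1) r] by auto
  have "AE \<omega> in P. \<bar>T r g (\<omega> 0)\<bar> \<le> B" using T_AE_bound[OF g, of 0 r] r by auto
  then have "AE x in distr P borel (\<lambda>\<omega>. \<omega> 0). \<bar>T r g x\<bar> \<le> B"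
    by (subst AE_distr_iff) auto
  then show ?thesis unfolding init .
qed

lemma weighted_square_diff:
  assumes b: "bounded_borel W" "bounded_borel a" "bounded_borel b"
    and W: "\<And>x. \<bar>W x\<bar> \<le> K" and ab: "AE x in M. \<bar>a x\<bar> \<le> B" "AE x in M. \<bar>b x\<bar> \<le> B"
  shows "\<bar>(\<integral>x. W x * (a x)\<^sup>2 \<partial>M) - (\<integral>x. W x * (b x)\<^sup>2 \<partial>M)\<bar> \<le> K * (2 * B) * (\<integral>x. \<bar>a x - b x\<bar> \<partial>M)"
proof -
  have int: "integrable M (\<lambda>x. W x * (a x)\<^sup>2)" "integrable M (\<lambda>x. W x * (b x)\<^sup>2)" "integrable M (\<lambda>x. \<bar>a x - b x\<bar>)"
    by (intro integrable_M bounded_borel_mult bounded_borel_power2 bounded_borel_abs bounded_borel_diff b)+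
  have "\<bar>(\<integral>x. W x * (a x)\<^sup>2 \<partial>M) - (\<integral>x. W x * (b x)\<^sup>2 \<partial>M)\<bar> = \<bar>\<integral>x. W x * (a x)\<^sup>2 - W x * (b x)\<^sup>2 \<partial>M\<bar>"
    using int by simp
  also have "\<dots> \<le> (\<integral>x. \<bar>W x * (a x)\<^sup>2 - W x * (b x)\<^sup>2\<bar> \<partial>M)" by (rule integral_abs_bound)
  also have "\<dots> \<le> (\<integral>x. K * (2 * B) * \<bar>a x - b x\<bar> \<partial>M)"
  proof (rule integral_mono_AE)
    show "AE x in M. \<bar>W x * (a x)\<^sup>2 - W x * (b x)\<^sup>2\<bar> \<le> K * (2 * B) * \<bar>a x - b x\<bar>"
      using ab
    proof eventually_elim
      case (elim x)
      have "\<bar>W x * (a x)\<^sup>2 - W x * (b x)\<^sup>2\<bar> = \<bar>W x\<bar> * \<bar>a x + b x\<bar> * \<bar>a x - b x\<bar>"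
        unfolding abs_mult[symmetric] by (simp add: power2_eq_square algebra_simps)
      also have "\<dots> \<le> K * (2 * B) * \<bar>a x - b x\<bar>"
        using W[of x] elim by (intro mult_right_mono mult_mono) auto
      finally show ?case .
    qed
  qed (use int in auto)
  finally show ?thesis by simp
qed

text \<open>Increments of \<open>q \<mapsto> T q u0\<close> over a time \<open>h\<close> are \<open>O(h)\<close> in \<open>L\<^sup>2\<close> because \<open>u0\<close> is a time average. So the
  right derivative of the weighted norm is read off from the limit defining the form, and no symmetry
  of \<open>T\<close> is required.\<close>
lemma weighted_average_decay:
  assumes f: "f \<in> D0 M D E" and g: "bounded_borel g" "\<And>x. \<bar>g x\<bar> \<le> B" and \<epsilon>: "0 < \<epsilon>" and R: "0 \<le> R" "R + \<epsilon> < 1"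
    and u0: "bounded_borel u0" "\<And>x. \<bar>u0 x\<bar> \<le> B"
    and avg: "\<And>\<phi> t. bounded_borel \<phi> \<Longrightarrow> 0 \<le> t \<Longrightarrow> t + \<epsilon> \<le> 1 \<Longrightarrow>
      corr \<phi> 0 u0 t = (1 / \<epsilon>) * integral {t..t+\<epsilon>} (corr \<phi> 0 g)"
  shows "(\<integral>x. exp (- 2 * l * f x) * (T R u0 x)\<^sup>2 \<partial>M) \<le> exp (l\<^sup>2 * R) * (\<integral>x. exp (- 2 * l * f x) * (u0 x)\<^sup>2 \<partial>M)"
proof -
  define W where "W x = exp (- 2 * l * f x)" for x
  define F where "F q = (\<integral>x. W x * (T q u0 x)\<^sup>2 \<partial>M)" for q
  have fD: "f \<in> Db D" using f by (simp add: D0_def)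
  have WD: "W \<in> Db D" unfolding W_def by (rule Db_exp[OF fD])
  then have bW: "bounded_borel W" by (simp add: Db_iff)
  obtain K where K: "K > 0" "\<And>x. \<bar>W x\<bar> \<le> K" using bW bounded_borelE by metis
  have B0: "0 \<le> B" using g(2)[of undefined] by linarith
  have L1: "L1_continuous g" by (rule L1_continuous_bounded[OF g(1)])
  have bu: "bounded_borel (T q u0)" if "0 \<le> q" "q \<le> 1" for q using u0 that by (intro bounded_borel_T) auto
  have avg_u: "corr \<phi> 0 (T q u0) h = (1 / \<epsilon>) * integral {q+h..q+h+\<epsilon>} (corr \<phi> 0 g)"
    if "bounded_borel \<phi>" "0 \<le> q" "0 \<le> h" "q + h + \<epsilon> \<le> 1" for \<phi> q h
    using corr_T[OF that(1) u0(1), of 0 h q] avg[OF that(1), of "h + q"] that \<epsilon> by (simp add: add.commute)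
  have uD: "T q u0 \<in> Db D" if q: "0 \<le> q" "q + \<epsilon> < 1" for q
    unfolding Db_iff
  proof
    show "T q u0 \<in> D"
      by (rule average_in_D[OF g L1 \<epsilon> bu q avg_u]) (use q \<epsilon> in auto)
  qed (use bu q \<epsilon> in auto)
  have cont_corr: "continuous_on {0..1} (corr \<phi> 0 g)" if "bounded_borel \<phi>" for \<phi>
    using that g L1 by (intro corr_continuous) auto
  have z_bound: "(\<integral>x. \<bar>T (q + h) u0 x - T q u0 x\<bar> \<partial>M) \<le> 2 * B / \<epsilon> * h"
    "(\<integral>x. (T (q + h) u0 x - T q u0 x)\<^sup>2 \<partial>M) \<le> (2 * B / \<epsilon> * h)\<^sup>2"
    if q: "0 \<le> q" "0 \<le> h" "q + h + \<epsilon> \<le> 1" for q h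
  proof -
    define z where "z x = T (q + h) u0 x - T q u0 x" for x
    have b: "bounded_borel (T (q + h) u0)" "bounded_borel (T q u0)" using bu q \<epsilon> by auto
    have z: "bounded_borel z" unfolding z_def by (rule bounded_borel_diff[OF b])
    define A where "A = (\<integral>x. \<bar>z x\<bar> \<partial>M)"
    have A0: "0 \<le> A" unfolding A_def by simp
    \<comment> \<open>In both correlations \<open>u0\<close> is a window average of the same
      function, so the difference of two shifted windows is estimated. The bound is by the mean of
      \<open>\<phi>\<close>, not its supremum, which is used next.\<close>
    have test: "\<bar>corr \<phi> 0 z 0\<bar> \<le> 2 * B / \<epsilon> * h * (\<integral>\<omega>. \<bar>\<phi> (\<omega> 0)\<bar> \<partial>P)" if \<phi>: "bounded_borel \<phi>" for \<phi>
    proof -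
      let ?c = "corr \<phi> 0 g" and ?n = "B * (\<integral>\<omega>. \<bar>\<phi> (\<omega> 0)\<bar> \<partial>P)"
      have "corr \<phi> 0 z 0 = corr \<phi> 0 (T (q + h) u0) 0 - corr \<phi> 0 (T q u0) 0"
        unfolding z_def by (rule corr_diff[OF \<phi> b]) auto
      also have "\<dots> = (1 / \<epsilon>) * (integral {q+h..q+h+\<epsilon>} ?c - integral {q..q+\<epsilon>} ?c)"
        using avg_u[OF \<phi>, of "q + h" 0] avg_u[OF \<phi>, of q 0] q \<epsilon> by (simp add: right_diff_distrib)
      also have "\<bar>\<dots>\<bar> \<le> (1 / \<epsilon>) * (2 * h * ?n)"
        unfolding abs_mult
      proof (rule mult_mono)
        show "\<bar>integral {q+h..q+h+\<epsilon>} ?c - integral {q..q+\<epsilon>} ?c\<bar> \<le> 2 * h * ?n"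
          by (rule shifted_window_bound(2)) (use \<phi> g q \<epsilon> cont_corr in \<open>auto intro!: corr_bound\<close>)
      qed (use \<epsilon> in auto)
      finally show ?thesis by (simp add: algebra_simps)
    qed
    have normP: "(\<integral>\<omega>. \<bar>\<phi> (\<omega> 0)\<bar> \<partial>P) = (\<integral>x. \<bar>\<phi> x\<bar> \<partial>M)" if "bounded_borel \<phi>" for \<phi>
      using expectation_at[of "\<lambda>x. \<bar>\<phi> x\<bar>" 0] that by (auto dest!: bounded_borel_measurable)
    let ?k = "2 * B / \<epsilon> * h"
    have k0: "0 \<le> ?k" using B0 \<epsilon> q by simp
    have "A = corr (\<lambda>x. sgn (z x)) 0 z 0" unfolding A_def by (rule L1_norm_M[OF z])
    also have "\<dots> \<le> ?k * (\<integral>x. \<bar>sgn (z x)\<bar> \<partial>M)"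
      using test[OF bounded_borel_sgn[OF z]] normP[OF bounded_borel_sgn[OF z]] by simp
    also have "\<dots> \<le> ?k * 1"
      using k0 integrable_M[OF bounded_borel_abs[OF bounded_borel_sgn[OF z]]]
      by (intro mult_left_mono M.integral_le_const) (auto simp: sgn_if)
    finally have A: "A \<le> ?k" by simp
    then show "(\<integral>x. \<bar>T (q + h) u0 x - T q u0 x\<bar> \<partial>M) \<le> ?k" by (simp add: A_def z_def)
    \<comment> \<open>The choice of \<open>z\<close> itself as test function upgrades the linear
      bound in the mean to a quadratic bound on the square integral.\<close>
    have "(\<integral>x. (z x)\<^sup>2 \<partial>M) = corr z 0 z 0" using corr_start[OF z z] by (simp add: power2_eq_square)
    also have "\<dots> \<le> ?k * A" using test[OF z] normP[OF z] by (simp add: A_def)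
    also have "\<dots> \<le> ?k * ?k" using A k0 by (rule mult_left_mono)
    finally show "(\<integral>x. (T (q + h) u0 x - T q u0 x)\<^sup>2 \<partial>M) \<le> ?k\<^sup>2" by (simp add: z_def power2_eq_square)
  qed
  have lip: "\<bar>F (q + h) - F q\<bar> \<le> K * (2 * B) * (2 * B / \<epsilon>) * h" if q: "0 \<le> q" "0 \<le> h" "q + h + \<epsilon> \<le> 1" for q h
  proof -
    have "\<bar>F (q + h) - F q\<bar> \<le> K * (2 * B) * (\<integral>x. \<bar>T (q + h) u0 x - T q u0 x\<bar> \<partial>M)"
      unfolding F_def using q \<epsilon> bW K u0 bu by (intro weighted_square_diff T_AE_bound_M) auto
    also have "\<dots> \<le> K * (2 * B) * (2 * B / \<epsilon> * h)"
      using z_bound(1)[OF q] K B0 by (intro mult_left_mono) auto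
    finally show ?thesis by (simp add: mult.assoc)
  qed
  have contF: "continuous_on {0..R} F"
  proof (rule lipschitz_on_continuous_on, rule lipschitz_onI)
    show "0 \<le> K * (2 * B) * (2 * B / \<epsilon>)" using K B0 \<epsilon> by simp
    fix x y assume "x \<in> {0..R}" "y \<in> {0..R}"
    then show "dist (F x) (F y) \<le> K * (2 * B) * (2 * B / \<epsilon>) * dist x y"
      using lip[of x "y - x"] lip[of y "x - y"] R
      by (cases "x \<le> y") (auto simp: dist_real_def abs_minus_commute)
  qed
  have "F R \<le> exp (l\<^sup>2 * R) * F 0"
  proof (rule right_gronwall[OF R(1) contF])
    fix q assume q: "0 \<le> q" "q < R"
    define u where "u = T q u0"
    define v where "v x = W x * u x" for x
    have u: "u \<in> Db D" unfolding u_def using q R by (intro uD) auto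
    have v: "v \<in> Db D" unfolding v_def by (rule Db_mult[OF WD u])
    have buv: "bounded_borel u" "bounded_borel v" using u v by (auto simp: Db_iff)
    let ?Z = "\<lambda>h. \<integral>x. W x * (T (q + h) u0 x - u x)\<^sup>2 \<partial>M"
    \<comment> \<open>Writing \<open>z\<close> for the increment of the evolved average from
      \<open>q\<close> to \<open>q + h\<close>, the weighted square changes by
      \<open>2 * W * u * z + W * z^2\<close>. The first part yields the form, the second is
      quadratic in \<open>h\<close>.\<close>
    have "((\<lambda>h. - 2 * (((\<integral>x. v x * u x \<partial>M) - corr v 0 u h) / h) + ?Z h / h) \<longlongrightarrow> - 2 * E v u + 0) (at_right 0)"
    proof (intro tendsto_intros E_limit)
      show "((\<lambda>h. ?Z h / h) \<longlongrightarrow> 0) (at_right 0)"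
      proof (rule Lim_null_comparison)
        have "norm (?Z h / h) \<le> K * (2 * B / \<epsilon>)\<^sup>2 * h" if h: "0 < h" "h < R - q" for h
        proof -
          have bz: "bounded_borel (\<lambda>x. T (q + h) u0 x - u x)"
            using bu[of "q+h"] buv q h R \<epsilon> by (intro bounded_borel_diff) auto
          have "\<bar>?Z h\<bar> \<le> (\<integral>x. \<bar>W x * (T (q + h) u0 x - u x)\<^sup>2\<bar> \<partial>M)" by (rule integral_abs_bound)
          also have "\<dots> \<le> (\<integral>x. K * (T (q + h) u0 x - u x)\<^sup>2 \<partial>M)"
          proof (rule integral_mono)
            show "integrable M (\<lambda>x. \<bar>W x * (T (q + h) u0 x - u x)\<^sup>2\<bar>)"
              by (intro integrable_M bounded_borel_abs bounded_borel_mult bounded_borel_power2 bz bW)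
            show "integrable M (\<lambda>x. K * (T (q + h) u0 x - u x)\<^sup>2)"
              by (intro integrable_M bounded_borel_cmult bounded_borel_power2 bz)
            show "\<bar>W x * (T (q + h) u0 x - u x)\<^sup>2\<bar> \<le> K * (T (q + h) u0 x - u x)\<^sup>2" for x
              unfolding abs_mult using K(2)[of x] by (intro mult_mono) auto
          qed
          also have "\<dots> \<le> K * (2 * B / \<epsilon> * h)\<^sup>2"
            using z_bound(2)[of q h] q h R K unfolding u_def by simp
          finally have "\<bar>?Z h\<bar> / h \<le> K * (2 * B / \<epsilon> * h)\<^sup>2 / h" using h by (intro divide_right_mono) auto
          then show ?thesis using h by (simp add: power2_eq_square algebra_simps)
        qed
        then show "\<forall>\<^sub>F h in at_right 0. norm (?Z h / h) \<le> K * (2 * B / \<epsilon>)\<^sup>2 * h"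
          using q unfolding eventually_at_right_field by (intro exI[of _ "R - q"]) auto
        have "((\<lambda>h. K * (2 * B / \<epsilon>)\<^sup>2 * h) \<longlongrightarrow> K * (2 * B / \<epsilon>)\<^sup>2 * 0) (at_right 0)" by (intro tendsto_intros)
        then show "((\<lambda>h. K * (2 * B / \<epsilon>)\<^sup>2 * h) \<longlongrightarrow> 0) (at_right 0)" by simp
      qed
    qed (use u v in \<open>auto simp: Db_iff\<close>)
    then have "((\<lambda>h. (F (q + h) - F q) / h) \<longlongrightarrow> - 2 * E v u + 0) (at_right 0)"
    proof (rule Lim_transform_eventually)
      have "- 2 * (((\<integral>x. v x * u x \<partial>M) - corr v 0 u h) / h) + ?Z h / h = (F (q + h) - F q) / h" if h: "0 < h" "h < R - q" for h
      proof -
        have b: "bounded_borel (T (q + h) u0)" using bu[of "q+h"] q h R \<epsilon> by auto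
        \<comment> \<open>The composition law of \<open>T\<close> on \<open>u0\<close>, tested
          against \<open>v\<close>: both sides are the same window average of
          \<open>g\<close>.\<close>
        have "corr v 0 u h = corr v 0 (T (q + h) u0) 0"
          unfolding u_def using avg_u[OF buv(2), of q h] avg_u[OF buv(2), of "q + h" 0] q h R by simp
        also have "\<dots> = (\<integral>x. v x * T (q + h) u0 x \<partial>M)" by (rule corr_start[OF buv(2) b])
        finally have c: "corr v 0 u h = (\<integral>x. v x * T (q + h) u0 x \<partial>M)" .
        have i: "integrable M (\<lambda>x. v x * u x)" "integrable M (\<lambda>x. v x * T (q + h) u0 x)"
          "integrable M (\<lambda>x. W x * (T (q + h) u0 x - u x)\<^sup>2)" "integrable M (\<lambda>x. W x * (T (q + h) u0 x)\<^sup>2)"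
          "integrable M (\<lambda>x. W x * (u x)\<^sup>2)"
          by (intro integrable_M bounded_borel_mult bounded_borel_power2 bounded_borel_diff buv b bW)+
        have "- 2 * ((\<integral>x. v x * u x \<partial>M) - corr v 0 u h) + ?Z h
            = (\<integral>x. - 2 * (v x * u x - v x * T (q + h) u0 x) + W x * (T (q + h) u0 x - u x)\<^sup>2 \<partial>M)"
          unfolding c using i by simp
        also have "\<dots> = (\<integral>x. W x * (T (q + h) u0 x)\<^sup>2 - W x * (u x)\<^sup>2 \<partial>M)"
          by (intro Bochner_Integration.integral_cong) (auto simp: v_def power2_eq_square algebra_simps)
        also have "\<dots> = F (q + h) - F q"
          unfolding F_def u_def[symmetric] using i by simp
        finally show ?thesis by (simp add: add_divide_distrib[symmetric])
      qed
      then show "\<forall>\<^sub>F h in at_right 0. - 2 * (((\<integral>x. v x * u x \<partial>M) - corr v 0 u h) / h) + ?Z h / h = (F (q + h) - F q) / h"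
        using q unfolding eventually_at_right_field by (intro exI[of _ "R - q"]) auto
    qed
    moreover have "- 2 * E v u + 0 \<le> l\<^sup>2 * F q"
      using weighted_form_lower_bound[OF f u, of l] unfolding F_def v_def W_def u_def by simp
    ultimately show "\<exists>lb\<le>l\<^sup>2 * F q. ((\<lambda>h. (F (q + h) - F q) / h) \<longlongrightarrow> lb) (at_right 0)" by blast
  qed
  moreover have "F 0 = (\<integral>x. W x * (u0 x)\<^sup>2 \<partial>M)"
  proof -
    have "\<bar>F 0 - (\<integral>x. W x * (u0 x)\<^sup>2 \<partial>M)\<bar> \<le> K * (2 * B) * (\<integral>x. \<bar>T 0 u0 x - u0 x\<bar> \<partial>M)"
      unfolding F_def by (rule weighted_square_diff[OF bW bu u0(1) K(2) T_AE_bound_M]) (use u0 in auto)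
    then show ?thesis unfolding T_zero[OF u0(1)] by simp
  qed
  ultimately show ?thesis unfolding F_def W_def by simp
qed

text \<open>An arbitrary \<open>g\<close> is replaced by its average over a short window, to which
  \<open>weighted_average_decay\<close> applies. Continuity in the mean makes the replacement error
  small, and \<open>T_L1_contraction\<close> keeps it small after evolution. The strict bound
  \<open>r < 1\<close> leaves room for the window.\<close>

lemma weighted_T_contraction:
  assumes f: "f \<in> D0 M D E" and g: "bounded_borel g" and r: "0 \<le> r" "r < 1"
  shows "(\<integral>x. exp (- 2 * l * f x) * (T r g x)\<^sup>2 \<partial>M) \<le> exp (l\<^sup>2 * r) * (\<integral>x. exp (- 2 * l * f x) * (g x)\<^sup>2 \<partial>M)"
proof -
  define W where "W x = exp (- 2 * l * f x)" for x
  have fD: "f \<in> Db D" using f by (simp add: D0_def)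
  then have bW: "bounded_borel W" using Db_exp[OF fD, of "- 2 * l"] unfolding W_def[abs_def] by (simp add: Db_iff)
  obtain K where K: "K > 0" "\<And>x. \<bar>W x\<bar> \<le> K" using bW bounded_borelE by metis
  obtain B where B: "B > 0" "\<And>x. \<bar>g x\<bar> \<le> B" using g bounded_borelE by metis
  define C where "C = K * (2 * B) * (1 + exp (l\<^sup>2 * r))"
  have C: "C > 0" unfolding C_def using K B by (intro mult_pos_pos add_pos_pos) auto
  have L1: "L1_continuous g" by (rule L1_continuous_bounded[OF g])
  have main: "(\<integral>x. W x * (T r g x)\<^sup>2 \<partial>M) \<le> exp (l\<^sup>2 * r) * (\<integral>x. W x * (g x)\<^sup>2 \<partial>M) + C * e" if e: "e > 0" for e
  proof -
    obtain \<delta> where \<delta>: "\<delta> > 0" "\<And>s q. s \<in> {0..1} \<Longrightarrow> q \<in> {0..1} \<Longrightarrow> \<bar>s - q\<bar> < \<delta> \<Longrightarrow>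
      (\<integral>\<omega>. \<bar>g (\<omega> s) - g (\<omega> q)\<bar> \<partial>P) < e"
      using L1_continuousE[OF L1 e] by blast
    \<comment> \<open>Short enough for continuity in the mean and for the window starting at
      \<open>r\<close> to end before time 1.\<close>
    define \<epsilon> where "\<epsilon> = min (\<delta> / 2) ((1 - r) / 2)"
    have \<epsilon>: "0 < \<epsilon>" "\<epsilon> < \<delta>" "r + \<epsilon> < 1" "\<epsilon> \<le> 1" using \<delta>(1) r by (auto simp: \<epsilon>_def min_def field_simps)
    obtain u0 where u0: "bounded_borel u0" "\<And>x. \<bar>u0 x\<bar> \<le> B"
      "\<And>\<phi> u t. bounded_borel \<phi> \<Longrightarrow> 0 \<le> u \<Longrightarrow> u \<le> t \<Longrightarrow> t + \<epsilon> \<le> 1 \<Longrightarrow>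
        corr \<phi> u u0 t = (1 / \<epsilon>) * integral {t..t+\<epsilon>} (corr \<phi> u g)"
      using time_average[OF g B(2) L1 \<epsilon>(1,4)] by blast
    define z where "z x = u0 x - g x" for x
    have z: "bounded_borel z" unfolding z_def by (rule bounded_borel_diff[OF u0(1) g])
    let ?s = "\<lambda>x. sgn (z x)"
    have s: "bounded_borel ?s" by (rule bounded_borel_sgn[OF z])
    let ?c = "corr ?s 0 g"
    have cint: "?c integrable_on {0..\<epsilon>}"
      by (rule integrable_continuous_real, rule continuous_on_subset[OF corr_continuous[OF s g _ L1]]) (use \<epsilon> in auto)
    have "(\<integral>x. \<bar>z x\<bar> \<partial>M) = corr ?s 0 u0 0 - ?c 0"
      unfolding L1_norm_M[OF z] unfolding z_def by (rule corr_diff) (use s u0 g in \<open>auto simp: z_def\<close>)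
    also have "\<dots> = (1 / \<epsilon>) * (integral {0..\<epsilon>} ?c - \<epsilon> * ?c 0)"
      using u0(3)[OF s, of 0 0] \<epsilon> by (simp add: field_simps)
    also have "integral {0..\<epsilon>} ?c - \<epsilon> * ?c 0 = integral {0..\<epsilon>} (\<lambda>q. ?c q - ?c 0)"
      using cint \<epsilon> by (subst integral_diff) auto
    also have "(1 / \<epsilon>) * \<dots> \<le> (1 / \<epsilon>) * (e * \<epsilon>)"
    proof (rule mult_left_mono)
      have "norm (integral (cbox 0 \<epsilon>) (\<lambda>q. ?c q - ?c 0)) \<le> e * measure lborel (cbox 0 \<epsilon>)"
      proof (rule integrable_bound)
        show "(\<lambda>q. ?c q - ?c 0) integrable_on cbox 0 \<epsilon>" using cint by (auto intro: integrable_diff)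
        show "norm (?c q - ?c 0) \<le> e" if "q \<in> cbox 0 \<epsilon>" for q
        proof -
          have "\<bar>?c q - ?c 0\<bar> \<le> 1 * (\<integral>\<omega>. \<bar>g (\<omega> q) - g (\<omega> 0)\<bar> \<partial>P)"
            by (rule corr_diff_bound[OF s g]) (use that \<epsilon> in \<open>auto simp: sgn_if\<close>)
          also have "\<dots> \<le> e" using \<delta>(2)[of q 0] that \<epsilon> by simp
          finally show ?thesis by simp
        qed
      qed (use e in auto)
      then show "integral {0..\<epsilon>} (\<lambda>q. ?c q - ?c 0) \<le> e * \<epsilon>" using \<epsilon> by simp
    qed (use \<epsilon> in auto)
    finally have ze: "(\<integral>x. \<bar>u0 x - g x\<bar> \<partial>M) \<le> e" using \<epsilon> by (simp add: z_def)
    have r01: "r \<in> {0..1}" using r by auto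
    have "\<bar>(\<integral>x. W x * (T r u0 x)\<^sup>2 \<partial>M) - (\<integral>x. W x * (T r g x)\<^sup>2 \<partial>M)\<bar> \<le> K * (2 * B) * (\<integral>x. \<bar>T r u0 x - T r g x\<bar> \<partial>M)"
      using bW K g u0 B r01 by (intro weighted_square_diff T_AE_bound_M bounded_borel_T) auto
    also have "\<dots> \<le> K * (2 * B) * e"
      using T_L1_contraction[OF u0(1) g r01] ze K B by (intro mult_left_mono) auto
    finally have 1: "(\<integral>x. W x * (T r g x)\<^sup>2 \<partial>M) \<le> (\<integral>x. W x * (T r u0 x)\<^sup>2 \<partial>M) + K * (2 * B) * e" by linarith
    have "\<bar>(\<integral>x. W x * (u0 x)\<^sup>2 \<partial>M) - (\<integral>x. W x * (g x)\<^sup>2 \<partial>M)\<bar> \<le> K * (2 * B) * (\<integral>x. \<bar>u0 x - g x\<bar> \<partial>M)"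
      by (rule weighted_square_diff[OF bW u0(1) g K(2)]) (use u0 B in auto)
    also have "\<dots> \<le> K * (2 * B) * e" using ze K B by (intro mult_left_mono) auto
    finally have 2: "(\<integral>x. W x * (u0 x)\<^sup>2 \<partial>M) \<le> (\<integral>x. W x * (g x)\<^sup>2 \<partial>M) + K * (2 * B) * e" by linarith
    have "(\<integral>x. W x * (T r u0 x)\<^sup>2 \<partial>M) \<le> exp (l\<^sup>2 * r) * (\<integral>x. W x * (u0 x)\<^sup>2 \<partial>M)"
      unfolding W_def by (rule weighted_average_decay[OF f g B(2) \<epsilon>(1) r(1) \<epsilon>(3) u0(1,2)]) (use u0(3) in auto)
    also have "\<dots> \<le> exp (l\<^sup>2 * r) * ((\<integral>x. W x * (g x)\<^sup>2 \<partial>M) + K * (2 * B) * e)"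
      using 2 by (intro mult_left_mono) auto
    finally show ?thesis using 1 unfolding C_def by (simp add: algebra_simps)
  qed
  have "(\<integral>x. W x * (T r g x)\<^sup>2 \<partial>M) \<le> exp (l\<^sup>2 * r) * (\<integral>x. W x * (g x)\<^sup>2 \<partial>M)"
  proof (rule field_le_epsilon)
    fix e :: real assume "e > 0"
    then show "(\<integral>x. W x * (T r g x)\<^sup>2 \<partial>M) \<le> exp (l\<^sup>2 * r) * (\<integral>x. W x * (g x)\<^sup>2 \<partial>M) + e"
      using main[of "e / C"] C by simp
  qed
  then show ?thesis by (simp add: W_def)
qed

end

section \<open>Chaining the estimate over several times\<close>

lemma prod_lessThan_double:
  fixes c :: "nat \<Rightarrow> 'b::comm_monoid_mult"
  shows "(\<Prod>j<2 * n. c j) = (\<Prod>i<n. c (2 * i) * c (2 * i + 1))"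
  by (induction n) (simp_all add: mult.assoc)

context diffusion begin

text \<open>Each exponential of an increment is a product of functions at two times, whereas
  \<open>markov_law\<close> takes one function per index. The two kinds of factors are interleaved
  at even and odd indices, with \<open>h\<close> at time \<open>u\<close> as the last one;
  \<open>markov_law\<close> does not ask for the times to be ordered.\<close>

lemma markov_pairs:
  fixes n :: nat
  assumes A: "\<And>i. i < n \<Longrightarrow> bounded_borel (A i)" and B: "\<And>i. i < n \<Longrightarrow> bounded_borel (B i)"
    and s: "\<And>i. i < n \<Longrightarrow> s i \<in> {0..u}" and q: "\<And>i. i < n \<Longrightarrow> q i \<in> {0..u}"
    and h: "bounded_borel h" and g: "bounded_borel g" and ut: "0 \<le> u" "0 \<le> t" "u + t \<le> 1"
  shows "(\<integral>\<omega>. (\<Prod>i<n. A i (\<omega> (s i)) * B i (\<omega> (q i))) * h (\<omega> u) * g (\<omega> (u + t)) \<partial>P)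
    = (\<integral>\<omega>. (\<Prod>i<n. A i (\<omega> (s i)) * B i (\<omega> (q i))) * (h (\<omega> u) * T t g (\<omega> u)) \<partial>P)"
proof -
  define F where "F j = (if j = 2 * n then h else if even j then A (j div 2) else B (j div 2))" for j
  define r where "r j = (if j = 2 * n then u else if even j then s (j div 2) else q (j div 2))" for j
  have eq: "(\<Prod>j<Suc (2 * n). F j (\<omega> (r j))) = (\<Prod>i<n. A i (\<omega> (s i)) * B i (\<omega> (q i))) * h (\<omega> u)" for \<omega>
  proof -
    have "(\<Prod>j<2 * n. F j (\<omega> (r j))) = (\<Prod>i<n. F (2 * i) (\<omega> (r (2 * i))) * F (2 * i + 1) (\<omega> (r (2 * i + 1))))"
      by (rule prod_lessThan_double)
    also have "\<dots> = (\<Prod>i<n. A i (\<omega> (s i)) * B i (\<omega> (q i)))"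
    proof (intro prod.cong refl)
      fix i assume "i \<in> {..<n}"
      moreover have "2 * i + 1 \<noteq> 2 * n" "odd (2 * i + 1)" "(2 * i + 1) div 2 = i" by presburger+
      ultimately show "F (2 * i) (\<omega> (r (2 * i))) * F (2 * i + 1) (\<omega> (r (2 * i + 1))) = A i (\<omega> (s i)) * B i (\<omega> (q i))"
        unfolding F_def r_def by simp
    qed
    finally show ?thesis by (simp add: F_def r_def)
  qed
  have "(\<integral>\<omega>. (\<Prod>j<Suc (2 * n). F j (\<omega> (r j))) * g (\<omega> (u + t)) \<partial>P)
      = (\<integral>\<omega>. (\<Prod>j<Suc (2 * n). F j (\<omega> (r j))) * T t g (\<omega> u) \<partial>P)"
  proof (rule markov[unfolded markov_law_def, THEN conjunct2, rule_format], intro conjI allI impI ut g)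
    fix j assume "j < Suc (2 * n)"
    then have "j = 2 * n \<or> j div 2 < n" by auto
    then show "0 \<le> r j" "r j \<le> u" "bounded_borel (F j)"
      using A B s[of "j div 2"] q[of "j div 2"] h ut by (auto simp: F_def r_def)
  qed
  then show ?thesis unfolding eq by (simp add: mult.assoc)
qed

text \<open>Conditioning at the second-last time removes the last interval and replaces
  \<open>g\<close> by its image under the conjugated operator, whose norm is bounded by
  \<open>weighted_T_contraction\<close>. The induction needs a general final observable
  \<open>g\<close> measured in mean square, although only the constant 1 is wanted at the
  end.\<close>

lemma exponential_moment:
  assumes f: "\<And>i. i < n \<Longrightarrow> f i \<in> D0 M D E" and t0: "0 \<le> t 0" and mono: "\<And>i. i < n \<Longrightarrow> t i \<le> t (Suc i)" and t1: "t n < 1"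
    and g: "bounded_borel g"
  shows "(\<integral>\<omega>. (\<Prod>i<n. exp (a i * (f i (\<omega> (t (Suc i))) - f i (\<omega> (t i))))) * g (\<omega> (t n)) \<partial>P)
    \<le> exp (\<Sum>i<n. (a i)\<^sup>2 * (t (Suc i) - t i) / 2) * sqrt (\<integral>x. (g x)\<^sup>2 \<partial>M)"
  using assms
proof (induction n arbitrary: g)
  case 0
  have i: "integrable M g" "integrable M (\<lambda>x. (g x)\<^sup>2)" using 0 by (auto intro: integrable_M bounded_borel_power2)
  define m where "m = (\<integral>x. g x \<partial>M)"
  \<comment> \<open>Nonnegativity of the variance bounds the mean by the mean-square norm.\<close>
  have "0 \<le> (\<integral>x. (g x - m)\<^sup>2 \<partial>M)" by simp
  also have "\<dots> = (\<integral>x. (g x)\<^sup>2 + m\<^sup>2 - 2 * m * g x \<partial>M)"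
    by (intro Bochner_Integration.integral_cong) (auto simp: power2_diff mult.commute mult.left_commute)
  also have "\<dots> = (\<integral>x. (g x)\<^sup>2 \<partial>M) - m\<^sup>2"
    using i by (simp add: M.prob_space m_def[symmetric] power2_eq_square)
  finally have "m \<le> sqrt (\<integral>x. (g x)\<^sup>2 \<partial>M)" by (intro real_le_rsqrt) simp
  then show ?case
    using expectation_at[of g "t 0"] 0 by (auto simp: m_def)
next
  case (Suc n)
  let ?f = "f n" and ?a = "a n" and ?d = "t (Suc n) - t n"
  have tmono: "t i \<le> t j" if "i \<le> j" "j \<le> Suc n" for i j
    using that
  proof (induction j)
    case (Suc j)
    then show ?case using Suc.prems assms(3) \<open>\<And>i. i < Suc n \<Longrightarrow> t i \<le> t (Suc i)\<close>[of j]
      by (cases "i = Suc j") auto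
  qed simp
  have range: "0 \<le> t i" "t i < 1" if "i \<le> Suc n" for i
    using tmono[of 0 i] tmono[of i "Suc n"] Suc.prems(2,4) that by auto
  have Df: "f i \<in> Db D" if "i < Suc n" for i using Suc.prems(1)[OF that] by (simp add: D0_def)
  have bf: "bounded_borel (\<lambda>x. exp (c * f i x))" if "i < Suc n" for i c
    using Db_exp[OF Df[OF that], of c] by (simp add: Db_iff)
  define k where "k x = exp (?a * ?f x) * g x" for x
  define g' where "g' x = exp (- ?a * ?f x) * T ?d k x" for x
  have bk: "bounded_borel k" unfolding k_def by (intro bounded_borel_mult bf Suc.prems) simp
  have d: "0 \<le> ?d" "?d < 1" using tmono[of n "Suc n"] range[of n] range[of "Suc n"] by auto
  have bTk: "bounded_borel (T ?d k)" using d bk by (intro bounded_borel_T) auto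
  have bg': "bounded_borel g'" unfolding g'_def by (intro bounded_borel_mult bf bTk) simp
  let ?A = "\<lambda>i x. exp (a i * f i x)" and ?B = "\<lambda>i x. exp (- a i * f i x)"
  have split: "exp (a i * (f i x - f i y)) = ?A i x * ?B i y" for i x y
    by (simp add: exp_add[symmetric] algebra_simps)
  have "(\<integral>\<omega>. (\<Prod>i<Suc n. exp (a i * (f i (\<omega> (t (Suc i))) - f i (\<omega> (t i))))) * g (\<omega> (t (Suc n))) \<partial>P)
    = (\<integral>\<omega>. (\<Prod>i<n. ?A i (\<omega> (t (Suc i))) * ?B i (\<omega> (t i))) * ?B n (\<omega> (t n)) * k (\<omega> (t n + ?d)) \<partial>P)"
    unfolding split k_def by (intro Bochner_Integration.integral_cong) (auto simp: mult_ac)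
  also have "\<dots> = (\<integral>\<omega>. (\<Prod>i<n. ?A i (\<omega> (t (Suc i))) * ?B i (\<omega> (t i))) * (?B n (\<omega> (t n)) * T ?d k (\<omega> (t n))) \<partial>P)"
  proof (rule markov_pairs)
    show "t (Suc i) \<in> {0..t n}" "t i \<in> {0..t n}" if "i < n" for i
      using that tmono[of "Suc i" n] tmono[of i n] range[of i] range[of "Suc i"] by auto
  qed (use range[of n] range[of "Suc n"] d bk in \<open>auto intro: bf bf[of _ "- a _", simplified]\<close>)
  also have "\<dots> = (\<integral>\<omega>. (\<Prod>i<n. exp (a i * (f i (\<omega> (t (Suc i))) - f i (\<omega> (t i))))) * g' (\<omega> (t n)) \<partial>P)"
    unfolding split g'_def ..
  also have "\<dots> \<le> exp (\<Sum>i<n. (a i)\<^sup>2 * (t (Suc i) - t i) / 2) * sqrt (\<integral>x. (g' x)\<^sup>2 \<partial>M)"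
    by (rule Suc.IH) (use Suc.prems range[of n] bg' in auto)
  also have "\<dots> \<le> exp (\<Sum>i<n. (a i)\<^sup>2 * (t (Suc i) - t i) / 2) * (exp (?a\<^sup>2 * ?d / 2) * sqrt (\<integral>x. (g x)\<^sup>2 \<partial>M))"
  proof (rule mult_left_mono)
    have e2: "(exp (c * y))\<^sup>2 = exp (2 * c * y)" for c y :: real
      unfolding exp_double[symmetric] by (simp add: algebra_simps)
    have "(g' x)\<^sup>2 = exp (- 2 * ?a * ?f x) * (T ?d k x)\<^sup>2" for x
      unfolding g'_def power_mult_distrib e2 by simp
    then have "(\<integral>x. (g' x)\<^sup>2 \<partial>M) \<le> exp (?a\<^sup>2 * ?d) * (\<integral>x. exp (- 2 * ?a * ?f x) * (k x)\<^sup>2 \<partial>M)"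
      using weighted_T_contraction[OF Suc.prems(1)[of n] bk d, of ?a] by simp
    \<comment> \<open>The weight cancels exactly the exponential put into \<open>k\<close>.\<close>
    also have "(\<lambda>x. exp (- 2 * ?a * ?f x) * (k x)\<^sup>2) = (\<lambda>x. (g x)\<^sup>2)"
      unfolding k_def power_mult_distrib e2 by (simp add: mult.assoc[symmetric] exp_add[symmetric])
    finally have "sqrt (\<integral>x. (g' x)\<^sup>2 \<partial>M) \<le> sqrt (exp (?a\<^sup>2 * ?d) * (\<integral>x. (g x)\<^sup>2 \<partial>M))"
      by (rule real_sqrt_le_mono)
    also have "\<dots> = exp (?a\<^sup>2 * ?d / 2) * sqrt (\<integral>x. (g x)\<^sup>2 \<partial>M)"
    proof -
      have "exp (?a\<^sup>2 * ?d) = (exp (?a\<^sup>2 * ?d / 2))\<^sup>2" unfolding exp_double[symmetric] by simp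
      then show ?thesis by (simp add: real_sqrt_mult)
    qed
    finally show "sqrt (\<integral>x. (g' x)\<^sup>2 \<partial>M) \<le> exp (?a\<^sup>2 * ?d / 2) * sqrt (\<integral>x. (g x)\<^sup>2 \<partial>M)" .
  qed simp
  finally show ?case by (simp add: exp_add mult.assoc)
qed

text \<open>The exponent whose exponential moment is at most 1: the linear term is corrected by the
  logarithm of the bound in \<open>exponential_moment\<close>. Its supremum over slopes is a
  Legendre transform and produces the quadratic energy.\<close>

definition gain :: "nat \<Rightarrow> (nat \<Rightarrow> real) \<Rightarrow> (nat \<Rightarrow> 'a \<Rightarrow> real) \<Rightarrow> (nat \<Rightarrow> real) \<Rightarrow> (real \<Rightarrow> 'a) \<Rightarrow> real" where
  "gain n t f a \<omega> = (\<Sum>i<n. a i * (f i (\<omega> (t (Suc i))) - f i (\<omega> (t i))) - (a i)\<^sup>2 * (t (Suc i) - t i) / 2)"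

text \<open>\<open>exponential_moment\<close> is used at the times \<open>s * t i\<close> with
  slopes \<open>a i / s\<close>, so that the quadratic correction becomes that of
  \<open>gain\<close> divided by \<open>s\<close>; Markov's inequality for
  \<open>exp (gain / s)\<close> finishes. Taking \<open>s < 1\<close> keeps all times strictly below
  1, as the contraction requires.\<close>

lemma chernoff:
  assumes f: "\<And>i. i < n \<Longrightarrow> f i \<in> D0 M D E" and t0: "0 \<le> t 0" and mono: "\<And>i. i < n \<Longrightarrow> t i \<le> t (Suc i)" and t1: "t n \<le> 1"
    and s: "0 < s" "s < 1"
  shows "measure P {\<omega> \<in> space P. gain n t f a (\<lambda>r. \<omega> (s * r)) > \<alpha>} \<le> exp (- \<alpha> / s)"
    and "{\<omega> \<in> space P. gain n t f a (\<lambda>r. \<omega> (s * r)) > \<alpha>} \<in> sets P"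
proof -
  let ?S = "\<lambda>\<omega>. gain n t f a (\<lambda>r. \<omega> (s * r))"
  let ?\<tau> = "\<lambda>i. s * t i" and ?a = "\<lambda>i. a i / s"
  have tmono: "t i \<le> t j" if "i \<le> j" "j \<le> n" for i j
    using that
  proof (induction j)
    case (Suc j)
    then show ?case using mono[of j] by (cases "i = Suc j") auto
  qed simp
  have range: "s * t i \<in> {0..1}" "s * t i < 1" if "i \<le> n" for i
  proof -
    have "0 \<le> t i" "t i \<le> 1" using tmono[of 0 i] tmono[of i n] t0 t1 that by auto
    then have "s * t i \<le> s * 1" "0 \<le> s * t i" using s by (intro mult_left_mono mult_nonneg_nonneg; linarith)+
    then have "s * t i < 1" using s by linarith
    with \<open>0 \<le> s * t i\<close> show "s * t i \<in> {0..1}" "s * t i < 1" by auto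
  qed
  have bf: "bounded_borel (f i)" if "i < n" for i using f[OF that] by (simp add: D0_def Db_iff)
  have [measurable]: "?S \<in> borel_measurable P"
    unfolding gain_def
    by (intro borel_measurable_sum borel_measurable_diff borel_measurable_times bounded_borel_measurable_at borel_measurable_const)
      (use bf range in auto)
  show A: "{\<omega> \<in> space P. ?S \<omega> > \<alpha>} \<in> sets P" by measurable
  let ?Z = "\<lambda>\<omega>. \<Prod>i<n. exp (?a i * (f i (\<omega> (?\<tau> (Suc i))) - f i (\<omega> (?\<tau> i))))"
  define c where "c = (\<Sum>i<n. (a i)\<^sup>2 * (t (Suc i) - t i) / 2) / s"
  have Zeq: "?Z \<omega> = exp (?S \<omega> / s) * exp c" for \<omega>
    unfolding gain_def exp_sum[symmetric, OF finite_lessThan] exp_add[symmetric] c_def sum_divide_distrib sum.distrib[symmetric]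
    by (intro arg_cong[where f = exp] sum.cong refl) (simp add: diff_divide_distrib)
  have "(\<integral>\<omega>. ?Z \<omega> * 1 \<partial>P) \<le> exp (\<Sum>i<n. (?a i)\<^sup>2 * (?\<tau> (Suc i) - ?\<tau> i) / 2) * sqrt (\<integral>x. 1\<^sup>2 \<partial>M)"
    by (rule exponential_moment[where g = "\<lambda>_. 1" and t = ?\<tau>])
      (use f t0 mono s range in \<open>auto intro!: mult_left_mono\<close>)
  also have "(\<Sum>i<n. (?a i)\<^sup>2 * (?\<tau> (Suc i) - ?\<tau> i) / 2) = c"
    unfolding c_def sum_divide_distrib using s
    by (intro sum.cong refl) (simp add: power2_eq_square field_simps)
  finally have "(\<integral>\<omega>. exp (?S \<omega> / s) * exp c \<partial>P) \<le> exp c"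
    unfolding Zeq by (simp add: M.prob_space)
  then have Z1: "(\<integral>\<omega>. exp (?S \<omega> / s) \<partial>P) \<le> 1" by simp
  \<comment> \<open>Functions in \<open>D0\<close> are bounded, hence so is the gain from above;
    this gives integrability.\<close>
  have "\<exists>K. \<forall>\<omega>. \<bar>exp (?S \<omega> / s)\<bar> \<le> K"
  proof -
    have "\<forall>i. \<exists>B. i < n \<longrightarrow> (\<forall>x. \<bar>f i x\<bar> \<le> B)" using bf bounded_borelE by metis
    then obtain B where B: "\<And>i x. i < n \<Longrightarrow> \<bar>f i x\<bar> \<le> B i" by metis
    have "?S \<omega> \<le> (\<Sum>i<n. \<bar>a i\<bar> * (B i + B i) - (a i)\<^sup>2 * (t (Suc i) - t i) / 2)" for \<omega>
      unfolding gain_def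
    proof (intro sum_mono diff_right_mono)
      fix i assume i: "i \<in> {..<n}"
      let ?y = "f i (\<omega> (s * t (Suc i))) - f i (\<omega> (s * t i))"
      have "a i * ?y \<le> \<bar>a i\<bar> * \<bar>?y\<bar>" by (metis abs_ge_self abs_mult)
      also have "\<dots> \<le> \<bar>a i\<bar> * (B i + B i)"
        using B[of i "\<omega> (s * t (Suc i))"] B[of i "\<omega> (s * t i)"] i by (intro mult_left_mono) auto
      finally show "a i * ?y \<le> \<bar>a i\<bar> * (B i + B i)" .
    qed
    then have "\<bar>exp (?S \<omega> / s)\<bar> \<le> exp ((\<Sum>i<n. \<bar>a i\<bar> * (B i + B i) - (a i)\<^sup>2 * (t (Suc i) - t i) / 2) / s)" for \<omega>
      using s by (simp add: divide_right_mono)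
    then show ?thesis by blast
  qed
  then obtain K where K: "\<And>\<omega>. \<bar>exp (?S \<omega> / s)\<bar> \<le> K" by blast
  have int: "integrable P (\<lambda>\<omega>. exp (?S \<omega> / s))"
    by (rule P.integrable_const_bound[where B = K]) (use K in auto)
  have "measure P {\<omega> \<in> space P. ?S \<omega> > \<alpha>} = (\<integral>\<omega>. indicator {\<omega> \<in> space P. ?S \<omega> > \<alpha>} \<omega> \<partial>P)"
    using A by (simp add: P.emeasure_eq_measure)
  also have "\<dots> \<le> (\<integral>\<omega>. exp (- \<alpha> / s) * exp (?S \<omega> / s) \<partial>P)"
  proof (rule integral_mono)
    show "indicator {\<omega> \<in> space P. ?S \<omega> > \<alpha>} \<omega> \<le> exp (- \<alpha> / s) * exp (?S \<omega> / s)" for \<omega>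
      using s by (auto simp: indicator_def exp_add[symmetric] divide_right_mono)
  qed (use int A in \<open>auto simp: P.emeasure_eq_measure\<close>)
  also have "\<dots> \<le> exp (- \<alpha> / s) * 1" using Z1 by simp
  finally show "measure P {\<omega> \<in> space P. ?S \<omega> > \<alpha>} \<le> exp (- \<alpha> / s)" by simp
qed

end

section \<open>The upper bound\<close>

text \<open>\<open>unif_compact\<close> is sequential compactness for uniform convergence. Embedding
  the paths into the metric space of bounded continuous functions turns it into compactness there,
  where finite subcovers are available.\<close>

lemma unif_compact_finite_subcover:
  fixes \<Gamma> :: "(real \<Rightarrow> 'a::metric_space) set" and G :: "'i \<Rightarrow> (real \<Rightarrow> 'a) \<Rightarrow> real"
  assumes \<Gamma>: "unif_compact \<Gamma>"
    and cont: "\<And>i. i \<in> I \<Longrightarrow> continuous_on UNIV (\<lambda>\<phi>::real \<Rightarrow>\<^sub>C 'a. G i (apply_bcontfun \<phi>))"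
    and depends: "\<And>i \<omega> \<omega>'. i \<in> I \<Longrightarrow> (\<And>x. x \<in> {0..1} \<Longrightarrow> \<omega> x = \<omega>' x) \<Longrightarrow> G i \<omega> = G i \<omega>'"
    and cover: "\<And>\<gamma>. \<gamma> \<in> \<Gamma> \<Longrightarrow> \<exists>i\<in>I. G i \<gamma> > \<alpha>"
  obtains J where "finite J" "J \<subseteq> I" "\<And>\<gamma>. \<gamma> \<in> \<Gamma> \<Longrightarrow> \<exists>i\<in>J. G i \<gamma> > \<alpha>"
proof -
  \<comment> \<open>Clamping time to the unit interval extends a path continuously and without new
    values; a functional that depends only on the unit interval does not notice.\<close>
  define c where "c x = max 0 (min 1 x)" for x :: real
  define \<Phi> where "\<Phi> \<gamma> = Bcontfun (\<lambda>x. \<gamma> (c x))" for \<gamma> :: "real \<Rightarrow> 'a"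
  have c01: "c x \<in> {0..1}" for x by (simp add: c_def)
  have c_id: "c x = x" if "x \<in> {0..1}" for x using that by (simp add: c_def)
  have ext: "apply_bcontfun (\<Phi> \<gamma>) x = \<gamma> (c x)" if "\<gamma> \<in> \<Gamma>" for \<gamma> x
  proof -
    have g: "continuous_on {0..1} \<gamma>" using \<Gamma> that by (auto simp: unif_compact_def path_space_def)
    have "continuous_on UNIV (\<lambda>x. \<gamma> (c x))"
      by (rule continuous_on_compose2[OF g]) (auto simp: c_def intro!: continuous_intros)
    moreover have "bounded (range (\<lambda>x. \<gamma> (c x)))"
      by (rule bounded_subset[OF compact_imp_bounded[OF compact_continuous_image[OF g compact_Icc]]]) (use c01 in auto)
    ultimately have "(\<lambda>x. \<gamma> (c x)) \<in> bcontfun" by (simp add: bcontfun_def)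
    then show ?thesis unfolding \<Phi>_def by (simp add: Bcontfun_inverse)
  qed
  have G\<Phi>: "G i (apply_bcontfun (\<Phi> \<gamma>)) = G i \<gamma>" if "i \<in> I" "\<gamma> \<in> \<Gamma>" for i \<gamma>
    by (rule depends[OF that(1)]) (simp add: ext[OF that(2)] c_id)
  have "seq_compact (\<Phi> ` \<Gamma>)"
  proof (rule seq_compactI)
    fix f :: "nat \<Rightarrow> real \<Rightarrow>\<^sub>C 'a" assume "\<forall>n. f n \<in> \<Phi> ` \<Gamma>"
    then have "\<forall>n. \<exists>\<gamma>. \<gamma> \<in> \<Gamma> \<and> f n = \<Phi> \<gamma>" by blast
    from choice[OF this] obtain \<sigma> where \<sigma>: "\<And>n. \<sigma> n \<in> \<Gamma>" "\<And>n. f n = \<Phi> (\<sigma> n)" by blast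
    obtain \<gamma> r where \<gamma>: "\<gamma> \<in> \<Gamma>" "strict_mono r" "uniform_limit {0..1} (\<sigma> \<circ> r) \<gamma> sequentially"
      using \<Gamma> \<sigma>(1) unfolding unif_compact_def by blast
    have "uniform_limit UNIV (\<lambda>n. apply_bcontfun ((f \<circ> r) n)) (apply_bcontfun (\<Phi> \<gamma>)) sequentially"
    proof (rule uniform_limitI)
      fix e :: real assume "e > 0"
      then have "\<forall>\<^sub>F n in sequentially. \<forall>x\<in>{0..1}. dist ((\<sigma> \<circ> r) n x) (\<gamma> x) < e"
        using \<gamma>(3) by (rule uniform_limitD[rotated])
      then show "\<forall>\<^sub>F n in sequentially. \<forall>x\<in>UNIV. dist (apply_bcontfun ((f \<circ> r) n) x) (apply_bcontfun (\<Phi> \<gamma>) x) < e"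
        by eventually_elim (use c01 in \<open>simp add: \<sigma>(2) ext[OF \<sigma>(1)] ext[OF \<gamma>(1)]\<close>)
    qed
    then have "(f \<circ> r) \<longlonglongrightarrow> \<Phi> \<gamma>" by (rule uniform_limit_tendsto_bcontfun)
    then show "\<exists>l\<in>\<Phi> ` \<Gamma>. \<exists>r. strict_mono r \<and> (f \<circ> r) \<longlonglongrightarrow> l" using \<gamma> by blast
  qed
  then have "compact (\<Phi> ` \<Gamma>)" by (simp add: compact_eq_seq_compact_metric)
  moreover have "open {\<phi>. G i (apply_bcontfun \<phi>) > \<alpha>}" if "i \<in> I" for i
    by (rule open_Collect_less[OF continuous_on_const cont[OF that]])
  moreover have "\<Phi> ` \<Gamma> \<subseteq> (\<Union>i\<in>I. {\<phi>. G i (apply_bcontfun \<phi>) > \<alpha>})"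
  proof (intro subsetI, elim imageE)
    fix \<phi> \<gamma> assume \<gamma>: "\<phi> = \<Phi> \<gamma>" "\<gamma> \<in> \<Gamma>"
    obtain i where "i \<in> I" "G i \<gamma> > \<alpha>" using cover[OF \<gamma>(2)] by blast
    then show "\<phi> \<in> (\<Union>i\<in>I. {\<phi>. G i (apply_bcontfun \<phi>) > \<alpha>})" using G\<Phi> \<gamma> by auto
  qed
  ultimately obtain J where J: "J \<subseteq> I" "finite J" "\<Phi> ` \<Gamma> \<subseteq> (\<Union>i\<in>J. {\<phi>. G i (apply_bcontfun \<phi>) > \<alpha>})"
    by (rule compactE_image)
  show thesis
  proof (rule that[OF J(2,1)])
    fix \<gamma> assume \<gamma>: "\<gamma> \<in> \<Gamma>"
    then obtain i where i: "i \<in> J" "G i (apply_bcontfun (\<Phi> \<gamma>)) > \<alpha>" using J(3) by blast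
    have "G i (apply_bcontfun (\<Phi> \<gamma>)) = G i \<gamma>" using J(1) i(1) by (intro G\<Phi> \<gamma>) blast
    with i show "\<exists>i\<in>J. G i \<gamma> > \<alpha>" by (intro bexI[of _ i]) simp_all
  qed
qed

text \<open>The constant \<open>K\<close> contributes \<open>s * ln K\<close>, which vanishes as
  \<open>s\<close> tends to 0; hence the size of a finite cover does not affect the rate.\<close>

lemma Limsup_slog_le:
  assumes K: "K > 0" and le: "\<And>s. 0 < s \<Longrightarrow> s < 1 \<Longrightarrow> 0 \<le> p s \<and> p s \<le> K * exp (- \<alpha> / s)"
  shows "Limsup (at_right 0) (\<lambda>s. slog s (p s)) \<le> ereal (- \<alpha>)"
proof -
  have "\<forall>\<^sub>F s in at_right 0. slog s (p s) \<le> ereal (s * ln K - \<alpha>)"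
  proof -
    have "slog s (p s) \<le> ereal (s * ln K - \<alpha>)" if s: "0 < s" "s < 1" for s
    proof (cases "p s = 0")
      case False
      then have p: "0 < p s" "p s \<le> K * exp (- \<alpha> / s)" using le[OF s] by auto
      then have "ln (p s) \<le> ln (K * exp (- \<alpha> / s))" by simp
      also have "\<dots> = ln K - \<alpha> / s" using K by (simp add: ln_mult)
      finally have "s * ln (p s) \<le> s * (ln K - \<alpha> / s)" using s by (intro mult_left_mono) auto
      then show ?thesis using False s by (simp add: slog_def right_diff_distrib)
    qed (simp add: slog_def)
    then show ?thesis unfolding eventually_at_right_field by (intro exI[of _ 1]) auto
  qed
  then have "Limsup (at_right 0) (\<lambda>s. slog s (p s)) \<le> Limsup (at_right 0) (\<lambda>s. ereal (s * ln K - \<alpha>))"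
    by (rule Limsup_mono)
  also have "\<dots> = ereal (- \<alpha>)"
  proof (rule lim_imp_Limsup)
    have "((\<lambda>s. s * ln K - \<alpha>) \<longlongrightarrow> 0 * ln K - \<alpha>) (at_right 0)" by (intro tendsto_intros)
    then show "((\<lambda>s. ereal (s * ln K - \<alpha>)) \<longlongrightarrow> ereal (- \<alpha>)) (at_right 0)" by simp
  qed simp
  finally show ?thesis .
qed

lemma (in finite_energy) finite_energy_speed_exists:
  obtains \<mu> where "\<mu> \<in> borel_measurable borel" "integrable lborel \<mu>"
    "\<And>s t. 0 \<le> s \<Longrightarrow> s \<le> t \<Longrightarrow> t \<le> 1 \<Longrightarrow> d s t \<le> set_lebesgue_integral lborel {s..t} \<mu>"
    "(\<integral>\<^sup>+x. ennreal ((\<mu> x)\<^sup>2) \<partial>lborel) \<le> ennreal C"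
    "AE t in lborel. t \<in> {0<..<1} \<longrightarrow> ((\<lambda>h. d t (t + h) / \<bar>h\<bar>) \<longlongrightarrow> \<mu> t) (at 0)"
proof -
  obtain \<mu> r where \<mu>: "\<mu> \<in> borel_measurable borel" "\<And>x. 0 \<le> \<mu> x" "\<And>x. x \<notin> {0..<1} \<Longrightarrow> \<mu> x = 0"
    "strict_mono (r :: nat \<Rightarrow> nat)" "integrable lborel \<mu>"
    "\<And>i. (\<integral>x. \<bar>\<mu> x - m (r i) x\<bar> \<partial>lborel) \<le> (1/2)^i"
    "(\<integral>\<^sup>+x. ennreal ((\<mu> x)\<^sup>2) \<partial>lborel) \<le> ennreal C"
    using limit_speed by blast
  interpret finite_energy_speed d C \<mu> r by unfold_locales (use \<mu> in auto)
  show thesis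
    by (rule that[OF \<mu>(1,5) _ \<mu>(7) speed_AE]) (simp add: integral_Icc_bounds(4)[OF \<mu>(5)] d_le_integral)
qed

section \<open>From bounded gains to bounded energy\<close>

context diffusion begin

abbreviation Lip where "Lip \<equiv> {f \<in> D0 M D E. continuous_on UNIV f}"

abbreviation plan :: "nat \<Rightarrow> (nat \<Rightarrow> real) \<Rightarrow> (nat \<Rightarrow> 'a \<Rightarrow> real) \<Rightarrow> bool" where
  "plan n t f \<equiv> 0 \<le> t 0 \<and> (\<forall>i<n. t i \<le> t (Suc i)) \<and> t n \<le> 1 \<and> (\<forall>i<n. f i \<in> Lip)"

lemma E_lin: "f \<in> D \<Longrightarrow> g \<in> D \<Longrightarrow> h \<in> D \<Longrightarrow> E (\<lambda>x. a * f x + b * g x) h = a * E f h + b * E g h"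
  using form unfolding dirichlet_form_def by meson

lemma E_cmult: "f \<in> D \<Longrightarrow> h \<in> D \<Longrightarrow> E (\<lambda>x. a * f x) h = a * E f h"
  using E_lin[of f f h a 0] by simp

text \<open>\<open>Iform\<close> is quadratic in the function, so the factor \<open>a\<close> enters
  as its square. The case of -1 makes the distance along a curve symmetric.\<close>

lemma Lip_cmult:
  assumes f: "f \<in> Lip" and a: "\<bar>a\<bar> \<le> 1"
  shows "(\<lambda>x. a * f x) \<in> Lip"
proof -
  have fD: "f \<in> Db D" using f by (simp add: D0_def)
  have afD: "(\<lambda>x. a * f x) \<in> Db D"
    by (rule Db_lipschitz[OF fD, where K = "\<bar>a\<bar>"])
      (use fD in \<open>auto simp: Db_iff abs_mult[symmetric] right_diff_distrib intro: bounded_borel_cmult\<close>)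
  have "Iform E (\<lambda>x. a * f x) (\<lambda>x. a * f x) h \<le> (\<integral>x. \<bar>h x\<bar> \<partial>M)" if h: "h \<in> Db D" for h
  proof -
    have D: "f \<in> D" "h \<in> D" "(\<lambda>x. f x * h x) \<in> D" "(\<lambda>x. f x * f x) \<in> D" "(\<lambda>x. a * f x) \<in> D"
      using fD h Db_mult[OF fD h] Db_mult[OF fD fD] afD by (auto simp: Db_iff)
    have 1: "E (\<lambda>x. a * f x * h x) (\<lambda>x. a * f x) = a\<^sup>2 * E (\<lambda>x. f x * h x) f"
      using E_cmult[OF D(3,5), of a] E_sym[OF D(3,5)] E_cmult[OF D(1,3), of a] E_sym[OF D(1,3)]
      by (simp add: mult.assoc power2_eq_square)
    have 2: "E (\<lambda>x. a * f x * (a * f x)) h = a\<^sup>2 * E (\<lambda>x. f x * f x) h"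
      using E_cmult[OF D(4,2), of "a\<^sup>2"] by (simp add: power2_eq_square mult_ac)
    have "Iform E (\<lambda>x. a * f x) (\<lambda>x. a * f x) h = a\<^sup>2 * Iform E f f h"
      unfolding Iform_def 1 2 by (simp add: algebra_simps)
    also have "\<dots> \<le> a\<^sup>2 * (\<integral>x. \<bar>h x\<bar> \<partial>M)"
      using f h by (intro mult_left_mono) (auto simp: D0_def)
    also have "\<dots> \<le> 1 * (\<integral>x. \<bar>h x\<bar> \<partial>M)"
      using a by (intro mult_right_mono) (auto simp: abs_square_le_1)
    finally show ?thesis by simp
  qed
  then show ?thesis using f afD by (auto simp: D0_def intro!: continuous_intros)
qed

lemma zero_Lip: "(\<lambda>_. 0) \<in> Lip"
proof -
  have one: "(\<lambda>_. 1) \<in> Db D" using one_in_D by (simp add: Db_iff)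
  have z: "(\<lambda>_. 0) \<in> Db D" by (rule Db_lipschitz[OF one, where K = 0]) auto
  have "E (\<lambda>_. 0) h = 0" if "h \<in> D" for h using E_cmult[OF one_in_D that, of 0] by simp
  then have "Iform E (\<lambda>_. 0) (\<lambda>_. 0) h \<le> (\<integral>x. \<bar>h x\<bar> \<partial>M)" if "h \<in> Db D" for h
    using that z by (simp add: Iform_def Db_iff)
  then show ?thesis using z by (simp add: D0_def)
qed

text \<open>For a partition, choose functions that nearly realise the distances between successive
  points and slopes equal to the difference quotients. The gain is then nearly half the discrete
  energy, so the latter is at most \<open>2 * \<alpha>\<close>, and the limit speed of
  \<open>finite_energy\<close> is the metric derivative.\<close>

lemma Htilde_le:
  assumes gain: "\<And>n t f a. plan n t f \<Longrightarrow> gain n t f a \<gamma> \<le> \<alpha>" and \<alpha>: "\<alpha> > 0"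
  shows "Htilde (intrinsic_dist M D E) \<gamma> \<le> ennreal \<alpha>"
proof -
  define d where "d s t = (SUP f\<in>Lip. f (\<gamma> s) - f (\<gamma> t))" for s t
  have ne: "Lip \<noteq> {}" using zero_Lip by blast
  have neg: "(\<lambda>x. - f x) \<in> Lip" if "f \<in> Lip" for f using Lip_cmult[OF that, of "-1"] by simp
  have fwd: "f (\<gamma> s) - f (\<gamma> t) \<le> \<alpha> + 1" if f: "f \<in> Lip" and st: "0 \<le> s" "s \<le> t" "t \<le> 1" for f s t
  proof -
    \<comment> \<open>The intrinsic distance is extended-valued. A plan with a single step bounds it
      along the curve, so it may be replaced by a real-valued \<open>d\<close>.\<close>
    have "gain 1 (\<lambda>i. if i = 0 then s else t) (\<lambda>_. f) (\<lambda>_. -1) \<gamma> \<le> \<alpha>"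
      by (rule gain) (use f st in auto)
    then have "f (\<gamma> s) - f (\<gamma> t) - (t - s) / 2 \<le> \<alpha>" by (simp add: gain_def)
    moreover have "(t - s) / 2 \<le> 1" using st by simp
    ultimately show ?thesis by linarith
  qed
  have incr: "f (\<gamma> s) - f (\<gamma> t) \<le> \<alpha> + 1" if "f \<in> Lip" "s \<in> {0..1}" "t \<in> {0..1}" for f s t
    using fwd[of f s t] fwd[OF neg, of f t s] that by (cases "s \<le> t") auto
  have bdd: "bdd_above ((\<lambda>f. f (\<gamma> s) - f (\<gamma> t)) ` Lip)" if "s \<in> {0..1}" "t \<in> {0..1}" for s t
    using incr that by (intro bdd_aboveI2) auto
  have up: "f (\<gamma> s) - f (\<gamma> t) \<le> d s t" if "f \<in> Lip" "s \<in> {0..1}" "t \<in> {0..1}" for f s t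
    unfolding d_def by (rule cSUP_upper[OF that(1) bdd[OF that(2,3)]])
  have almost: "\<exists>f\<in>Lip. d s t - e < f (\<gamma> s) - f (\<gamma> t)" if "s \<in> {0..1}" "t \<in> {0..1}" "0 < e" for s t e
  proof -
    have "d s t - e < d s t" using that by simp
    then show ?thesis using less_cSUP_iff[OF ne bdd[OF that(1,2)], of "d s t - e"] by (simp only: d_def[symmetric])
  qed
  have dist_eq: "intrinsic_dist M D E (\<gamma> s) (\<gamma> t) = ereal (d s t)" if st: "s \<in> {0..1}" "t \<in> {0..1}" for s t
  proof (rule antisym)
    show "intrinsic_dist M D E (\<gamma> s) (\<gamma> t) \<le> ereal (d s t)"
      unfolding intrinsic_dist_def using up st by (intro SUP_least) auto
    have "ereal (d s t) \<le> intrinsic_dist M D E (\<gamma> s) (\<gamma> t) + ereal e" if e: "e > 0" for e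
    proof -
      obtain f where f: "f \<in> Lip" "d s t - e < f (\<gamma> s) - f (\<gamma> t)"
        using almost[OF st e] by blast
      have "ereal (d s t) \<le> ereal (f (\<gamma> s) - f (\<gamma> t)) + ereal e" using f(2) by simp
      also have "ereal (f (\<gamma> s) - f (\<gamma> t)) \<le> intrinsic_dist M D E (\<gamma> s) (\<gamma> t)"
        unfolding intrinsic_dist_def by (rule SUP_upper[OF f(1)])
      finally show ?thesis by (simp add: add_right_mono)
    qed
    then show "ereal (d s t) \<le> intrinsic_dist M D E (\<gamma> s) (\<gamma> t)" by (rule ereal_le_epsilon2)
  qed
  interpret finite_energy d "2 * \<alpha>"
  proof
    fix s t u :: real assume s: "s \<in> {0..1}" and t: "t \<in> {0..1}"
    show "0 \<le> d s t" using up[OF zero_Lip s t] by simp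
    show "d t t = 0" unfolding d_def using ne by simp
    have le: "d s t \<le> d t s" if s: "s \<in> {0..1}" and t: "t \<in> {0..1}" for s t
      unfolding d_def[of s t]
    proof (rule cSUP_least[OF ne])
      fix f assume "f \<in> Lip"
      then show "f (\<gamma> s) - f (\<gamma> t) \<le> d t s" using up[OF neg t s, of f] by simp
    qed
    show "d s t = d t s" using le s t by (auto intro: antisym)
    show "d s u \<le> d s t + d t u" if u: "u \<in> {0..1}"
      unfolding d_def[of s u]
    proof (rule cSUP_least[OF ne])
      fix f assume "f \<in> Lip"
      then show "f (\<gamma> s) - f (\<gamma> u) \<le> d s t + d t u" using up[of f s t] up[of f t u] s t u by simp
    qed
  next
    fix n and t :: "nat \<Rightarrow> real"
    assume t: "0 \<le> t 0" "\<And>i. i < n \<Longrightarrow> t i < t (Suc i)" "t n \<le> 1"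
    have tmono: "t i \<le> t j" if "i \<le> j" "j \<le> n" for i j
      using that
    proof (induction j)
      case (Suc j)
      then show ?case using t(2)[of j] by (cases "i = Suc j") auto
    qed simp
    have range: "t i \<in> {0..1}" if "i \<le> n" for i using tmono[of 0 i] tmono[of i n] t that by auto
    let ?d = "\<lambda>i. d (t i) (t (Suc i))" and ?\<Delta> = "\<lambda>i. t (Suc i) - t i"
    define K where "K = (\<Sum>i<n. ?d i / ?\<Delta> i)"
    have d0: "0 \<le> ?d i" if "i < n" for i using up[OF zero_Lip range range, of i "Suc i"] that by simp
    have main: "(\<Sum>i<n. (?d i)\<^sup>2 / ?\<Delta> i) \<le> 2 * \<alpha> + 2 * e * K" if e: "e > 0" for e
    proof -
      have "\<forall>i. \<exists>f. i < n \<longrightarrow> f \<in> Lip \<and> ?d i - e < f (\<gamma> (t i)) - f (\<gamma> (t (Suc i)))"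
      proof (intro allI)
        fix i
        show "\<exists>f. i < n \<longrightarrow> f \<in> Lip \<and> ?d i - e < f (\<gamma> (t i)) - f (\<gamma> (t (Suc i)))"
        proof (cases "i < n")
          case True
          then have "t i \<in> {0..1}" "t (Suc i) \<in> {0..1}" using range by auto
          from almost[OF this e] show ?thesis by blast
        qed simp
      qed
      from choice[OF this] obtain f where f: "\<And>i. i < n \<Longrightarrow> f i \<in> Lip"
        "\<And>i. i < n \<Longrightarrow> ?d i - e < f i (\<gamma> (t i)) - f i (\<gamma> (t (Suc i)))" by blast
      \<comment> \<open>The sign is negative because \<open>d s t\<close> is a supremum of value at
        \<open>s\<close> minus value at \<open>t\<close>, while \<open>gain\<close> subtracts the
        earlier value from the later one.\<close>
      let ?a = "\<lambda>i. - (?d i / ?\<Delta> i)"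
      have "plan n t f" using t f(1) by (auto simp: less_imp_le)
      then have "gain n t f ?a \<gamma> \<le> \<alpha>" by (rule gain)
      moreover have "(\<Sum>i<n. (?d i)\<^sup>2 / ?\<Delta> i / 2 - e * (?d i / ?\<Delta> i)) \<le> gain n t f ?a \<gamma>"
        unfolding gain_def
      proof (rule sum_mono)
        fix i assume "i \<in> {..<n}"
        then have i: "i < n" by simp
        have \<Delta>: "?\<Delta> i > 0" using t(2)[OF i] by simp
        have h1: "(?d i / ?\<Delta> i) * (?d i - e) \<le> (?d i / ?\<Delta> i) * (f i (\<gamma> (t i)) - f i (\<gamma> (t (Suc i))))"
          using f(2)[OF i] d0[OF i] \<Delta> by (intro mult_left_mono) auto
        have h2: "(?a i)\<^sup>2 * ?\<Delta> i / 2 = (?d i)\<^sup>2 / ?\<Delta> i / 2"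
          using \<Delta> by (simp add: power2_eq_square)
        have h3: "(?d i / ?\<Delta> i) * (?d i - e) = (?d i)\<^sup>2 / ?\<Delta> i - e * (?d i / ?\<Delta> i)"
          by (simp add: right_diff_distrib power2_eq_square)
        have h4: "(?d i / ?\<Delta> i) * (f i (\<gamma> (t i)) - f i (\<gamma> (t (Suc i)))) = ?a i * (f i (\<gamma> (t (Suc i))) - f i (\<gamma> (t i)))"
          by (simp add: right_diff_distrib)
        have ar: "v / 2 - z \<le> y - w" if "p \<le> q" "w = v / 2" "p = v - z" "q = y" for p q v w y z :: real
          using that by linarith
        show "(?d i)\<^sup>2 / ?\<Delta> i / 2 - e * (?d i / ?\<Delta> i) \<le> ?a i * (f i (\<gamma> (t (Suc i))) - f i (\<gamma> (t i))) - (?a i)\<^sup>2 * ?\<Delta> i / 2"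
          by (rule ar[OF h1 h2 h3 h4])
      qed
      moreover have "(\<Sum>i<n. (?d i)\<^sup>2 / ?\<Delta> i / 2 - e * (?d i / ?\<Delta> i)) = (\<Sum>i<n. (?d i)\<^sup>2 / ?\<Delta> i) / 2 - e * K"
        unfolding K_def sum_subtractf sum_divide_distrib sum_distrib_left ..
      ultimately show ?thesis by linarith
    qed
    have K0: "0 \<le> K" unfolding K_def using d0 t(2) by (intro sum_nonneg divide_nonneg_pos) auto
    show "(\<Sum>i<n. (?d i)\<^sup>2 / ?\<Delta> i) \<le> 2 * \<alpha>"
    proof (rule field_le_epsilon)
      fix e :: real assume "e > 0"
      \<comment> \<open>The error \<open>2 * e * K\<close> is made at most the new \<open>e\<close>;
        the added 1 keeps the quotient defined when \<open>K\<close> is 0.\<close>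
      then have "(\<Sum>i<n. (?d i)\<^sup>2 / ?\<Delta> i) \<le> 2 * \<alpha> + 2 * (e / (2 * (K + 1))) * K" using K0 by (intro main) auto
      also have "2 * (e / (2 * (K + 1))) * K \<le> e" using K0 \<open>e > 0\<close> by (simp add: field_simps)
      finally show "(\<Sum>i<n. (?d i)\<^sup>2 / ?\<Delta> i) \<le> 2 * \<alpha> + e" by simp
    qed
  qed
  obtain \<mu> where \<mu>: "\<mu> \<in> borel_measurable borel" "integrable lborel \<mu>"
    "\<And>s t. 0 \<le> s \<Longrightarrow> s \<le> t \<Longrightarrow> t \<le> 1 \<Longrightarrow> d s t \<le> set_lebesgue_integral lborel {s..t} \<mu>"
    "(\<integral>\<^sup>+x. ennreal ((\<mu> x)\<^sup>2) \<partial>lborel) \<le> ennreal (2 * \<alpha>)"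
    "AE t in lborel. t \<in> {0<..<1} \<longrightarrow> ((\<lambda>h. d t (t + h) / \<bar>h\<bar>) \<longlongrightarrow> \<mu> t) (at 0)"
    using finite_energy_speed_exists by blast
  have sq: "integrable lborel (\<lambda>x. (\<mu> x)\<^sup>2)"
    using \<mu>(1,4) by (intro integrableI_bounded) (auto intro: le_less_trans)
  have AC: "AC2 (intrinsic_dist M D E) \<gamma>"
    unfolding AC2_def
  proof (intro exI[of _ \<mu>] conjI allI impI)
    show "set_integrable lborel {0..1} \<mu>" "set_integrable lborel {0..1} (\<lambda>r. (\<mu> r)\<^sup>2)"
      unfolding set_integrable_def by (rule integrable_mult_indicator; use \<mu>(2) sq in simp)+
    fix s t :: real assume "0 \<le> s \<and> s \<le> t \<and> t \<le> 1"
    then show "intrinsic_dist M D E (\<gamma> s) (\<gamma> t) \<le> ereal (set_lebesgue_integral lborel {s..t} \<mu>)"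
      using \<mu>(3)[of s t] by (subst dist_eq) auto
  qed (use \<mu>(1) in simp)
  have deriv: "metric_deriv (intrinsic_dist M D E) \<gamma> t = \<mu> t"
    if t: "0 < t" "t < 1" and lim: "((\<lambda>h. d t (t + h) / \<bar>h\<bar>) \<longlongrightarrow> \<mu> t) (at 0)" for t
    unfolding metric_deriv_def
  proof (rule tendsto_Lim)
    \<comment> \<open>At interior times the one-sided restrictions in \<open>metric_deriv\<close>
      disappear; the two endpoints are a null set for the energy integral.\<close>
    have at: "at 0 within {- t..1 - t} = at 0" using t by (intro at_within_interior) auto
    show "at 0 within {- t..1 - t} \<noteq> bot" unfolding at by simp
    have "\<forall>\<^sub>F h in at 0 within {- t..1 - t}. d t (t + h) / \<bar>h\<bar> = real_of_ereal (intrinsic_dist M D E (\<gamma> t) (\<gamma> (t + h))) / \<bar>h\<bar>"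
    proof -
      have "d t (t + h) / \<bar>h\<bar> = real_of_ereal (intrinsic_dist M D E (\<gamma> t) (\<gamma> (t + h))) / \<bar>h\<bar>" if "h \<in> {- t..1 - t}" for h
        using that t by (subst dist_eq) auto
      then show ?thesis unfolding eventually_at_filter by (auto intro: always_eventually)
    qed
    with lim[folded at] show "((\<lambda>h. real_of_ereal (intrinsic_dist M D E (\<gamma> t) (\<gamma> (t + h))) / \<bar>h\<bar>) \<longlongrightarrow> \<mu> t) (at 0 within {- t..1 - t})"
      by (rule Lim_transform_eventually)
  qed
  have "(\<integral>\<^sup>+ t\<in>{0..1}. ennreal ((metric_deriv (intrinsic_dist M D E) \<gamma> t)\<^sup>2) \<partial>lborel)
      \<le> (\<integral>\<^sup>+x. ennreal ((\<mu> x)\<^sup>2) \<partial>lborel)"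
  proof (rule nn_integral_mono_AE)
    have "AE t in lborel. t \<noteq> (0::real)" "AE t in lborel. t \<noteq> (1::real)" by (rule AE_lborel_singleton)+
    then show "AE t in lborel. ennreal ((metric_deriv (intrinsic_dist M D E) \<gamma> t)\<^sup>2) * indicator {0..1} t \<le> ennreal ((\<mu> t)\<^sup>2)"
      using \<mu>(5) by eventually_elim (auto simp: indicator_def deriv)
  qed
  also have "\<dots> \<le> ennreal (2 * \<alpha>)" by (rule \<mu>(4))
  finally have "ennreal (1/2) * (\<integral>\<^sup>+ t\<in>{0..1}. ennreal ((metric_deriv (intrinsic_dist M D E) \<gamma> t)\<^sup>2) \<partial>lborel)
      \<le> ennreal (1/2) * ennreal (2 * \<alpha>)"
    by (rule mult_left_mono) simp
  also have "\<dots> = ennreal (1/2 * (2 * \<alpha>))" by (rule ennreal_mult[symmetric]) (use \<alpha> in auto)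
  also have "1/2 * (2 * \<alpha>) = \<alpha>" by simp
  finally show ?thesis unfolding Htilde_def using AC by simp
qed

lemma large_deviation_upper_bound:
  assumes \<alpha>: "\<alpha> > 0" and \<Gamma>: "unif_compact \<Gamma>" and H: "\<forall>\<gamma>\<in>\<Gamma>. Htilde (intrinsic_dist M D E) \<gamma> > ennreal \<alpha>"
  shows "Limsup (at_right 0) (\<lambda>s. slog s (scaled_prob P s \<Gamma>)) \<le> ereal (- \<alpha>)"
proof -
  define I where "I = {(n, t, f, a :: nat \<Rightarrow> real). plan n t f}"
  define G where "G = (\<lambda>(n, t, f, a). gain n t f a)"
  have mono: "t i \<in> {0..1}" if "plan n t f" "i \<le> n" for n t f i
  proof -
    have "t i \<le> t j" if "i \<le> j" "j \<le> n" for i j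
      using that
    proof (induction j)
      case (Suc j)
      then show ?case using \<open>plan n t f\<close> by (cases "i = Suc j") (force dest: spec[of _ j])+
    qed simp
    from this[of 0 i] this[of i n] show ?thesis using that by auto
  qed
  obtain J where J: "finite J" "J \<subseteq> I" "\<And>\<gamma>. \<gamma> \<in> \<Gamma> \<Longrightarrow> \<exists>j\<in>J. G j \<gamma> > \<alpha>"
  proof (rule unif_compact_finite_subcover[OF \<Gamma>, of I G \<alpha>])
    fix j assume "j \<in> I"
    then obtain n t f a where j: "j = (n, t, f, a)" "plan n t f" by (auto simp: I_def)
    have ev: "continuous_on UNIV (\<lambda>\<phi>::real \<Rightarrow>\<^sub>C 'a. apply_bcontfun \<phi> x)" for x
      unfolding continuous_on_iff by (metis dist_fun_lt_imp_dist_val_lt)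
    have fc: "continuous_on UNIV (f i)" if "i < n" for i using j(2) that by simp
    show "continuous_on UNIV (\<lambda>\<phi>::real \<Rightarrow>\<^sub>C 'a. G j (apply_bcontfun \<phi>))"
      unfolding G_def j gain_def prod.case
      by (intro continuous_intros continuous_on_compose2[OF fc ev]) auto
    fix \<omega> \<omega>' :: "real \<Rightarrow> 'a" assume eq: "\<And>x. x \<in> {0..1} \<Longrightarrow> \<omega> x = \<omega>' x"
    show "G j \<omega> = G j \<omega>'"
      unfolding G_def j gain_def prod.case
      by (intro sum.cong refl) (use eq mono[OF j(2)] in auto)
  next
    fix \<gamma> assume "\<gamma> \<in> \<Gamma>"
    then have "\<not> Htilde (intrinsic_dist M D E) \<gamma> \<le> ennreal \<alpha>" using H by (auto simp: not_le)
    then obtain n t f a where "plan n t f" "\<not> gain n t f a \<gamma> \<le> \<alpha>" using Htilde_le[OF _ \<alpha>, of \<gamma>] by blast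
    then show "\<exists>j\<in>I. G j \<gamma> > \<alpha>" by (intro bexI[of _ "(n, t, f, a)"]) (auto simp: I_def G_def)
  qed blast
  show ?thesis
  proof (rule Limsup_slog_le)
    \<comment> \<open>The added 1 keeps the constant positive when \<open>J\<close>, and with it
      \<open>\<Gamma>\<close>, is empty.\<close>
    show "0 < real (card J) + 1" by simp
    fix s :: real assume s: "0 < s" "s < 1"
    let ?A = "\<lambda>j. {\<omega> \<in> space P. G j (\<lambda>r. \<omega> (s * r)) > \<alpha>}"
    have A: "measure P (?A j) \<le> exp (- \<alpha> / s)" "?A j \<in> sets P" if jJ: "j \<in> J" for j
    proof -
      obtain n t f a where j: "j = (n, t, f, a)" "plan n t f" using subsetD[OF J(2) jJ] by (auto simp: I_def)
      show "measure P (?A j) \<le> exp (- \<alpha> / s)"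
        unfolding j G_def prod.case by (rule chernoff(1)) (use j(2) s in auto)
      show "?A j \<in> sets P"
        unfolding j G_def prod.case by (rule chernoff(2)) (use j(2) s in auto)
    qed
    let ?B = "{\<omega> \<in> space P. (\<lambda>t\<in>{0..1}. \<omega> (s * t)) \<in> \<Gamma>}"
    have sub: "?B \<subseteq> (\<Union>j\<in>J. ?A j)"
    proof
      fix \<omega> assume \<omega>: "\<omega> \<in> ?B"
      then obtain j where j: "j \<in> J" "G j (\<lambda>t\<in>{0..1}. \<omega> (s * t)) > \<alpha>" using J(3) by blast
      obtain n t f a where jj: "j = (n, t, f, a)" "plan n t f" using subsetD[OF J(2) j(1)] by (auto simp: I_def)
      \<comment> \<open>Restriction to the unit interval is invisible to a plan, all of whose times
        lie there.\<close>
      have "G j (\<lambda>t\<in>{0..1}. \<omega> (s * t)) = G j (\<lambda>r. \<omega> (s * r))"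
        unfolding G_def jj gain_def prod.case
        by (intro sum.cong refl) (use mono[OF jj(2)] in \<open>simp add: restrict_def\<close>)
      then show "\<omega> \<in> (\<Union>j\<in>J. ?A j)" using j \<omega> by auto
    qed
    have "measure P ?B \<le> measure P (\<Union>j\<in>J. ?A j)"
    \<comment> \<open>Measurability of the event is not among the assumptions; outside
      \<open>sets P\<close> the value of \<open>measure\<close> is 0 by convention.\<close>
    proof (cases "?B \<in> sets P")
      case True
      then show ?thesis using sub A J(1) by (intro P.finite_measure_mono sets.finite_UN) auto
    qed (simp add: measure_notin_sets)
    also have "\<dots> \<le> (\<Sum>j\<in>J. measure P (?A j))" using A J(1) by (intro measure_UNION_le) auto
    also have "\<dots> \<le> (\<Sum>j\<in>J. exp (- \<alpha> / s))" using A by (intro sum_mono) auto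
    also have "\<dots> \<le> (real (card J) + 1) * exp (- \<alpha> / s)" by (simp add: algebra_simps)
    finally show "0 \<le> scaled_prob P s \<Gamma> \<and> scaled_prob P s \<Gamma> \<le> (real (card J) + 1) * exp (- \<alpha> / s)"
      unfolding scaled_prob_def by simp
  qed
qed

end

theorem theorem4p14:
  fixes M :: "'a::polish_space measure"
    and D :: "('a \<Rightarrow> real) set"
    and E :: "('a \<Rightarrow> real) \<Rightarrow> ('a \<Rightarrow> real) \<Rightarrow> real"
    and P :: "(real \<Rightarrow> 'a) measure"
    and T :: "real \<Rightarrow> ('a \<Rightarrow> real) \<Rightarrow> ('a \<Rightarrow> real)"
    and \<Gamma> :: "(real \<Rightarrow> 'a) set"
    and \<alpha> :: real
  assumes "prob_space M" and "sets M = sets borel"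
    and "\<forall>\<epsilon>>0. \<exists>F. finite F \<and> (\<forall>x. \<exists>y\<in>F. intrinsic_dist M D E x y < ereal \<epsilon>)"
    and "dirichlet_form M D E" and "conservative M T" and "strongly_local M D E"
    and "prob_space P" and "sets P = sets path_sets"
    and "distr P borel (\<lambda>\<omega>. \<omega> 0) = M"
    and "markov_law P T" and "associated M P D E"
    and "\<alpha> > 0"
    and "unif_compact \<Gamma>"
    and "\<forall>\<gamma>\<in>\<Gamma>. Htilde (intrinsic_dist M D E) \<gamma> > ennreal \<alpha>"
  shows "Limsup (at_right 0) (\<lambda>s. slog s (scaled_prob P s \<Gamma>)) \<le> ereal (- \<alpha>)"
proof -
  interpret diffusion M D E P T
    by (rule diffusion.intro; fact assms)
  show ?thesis using assms(12-14) by (rule large_deviation_upper_bound)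
qed

end
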